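(* Let $(M,F)$ be an $n$-dimensional Finsler manifold. The triple $(\nabla^v,\nabla^*_1,\overline\nabla)$, consisting of the Vaisman connection $\nabla^v$ on $\mathcal{L}_\Gamma'$, the restriction $\nabla^*_1$ of the Vr\^anceanu connection to $H(TM^0)$, and the connection $\overline\nabla$ on $\mathcal{L}_\Gamma^\perp=H(TM^0)\oplus\mathcal{L}_\Gamma'$ given by $\overline\nabla_XZ=\nabla^*_{1X}Z^h+\nabla^v_XZ'$ for $X\in\Gamma(T(TM^0))$ and $Z=Z^h+Z'$ with $Z^h\in\Gamma(H(TM^0))$, $Z'\in\Gamma(\mathcal{L}_\Gamma')$, is a triple of basic connections adapted to the subfoliation $(\mathcal{F}_V,\mathcal{F}_\Gamma)$ of $(TM^0,G)$.
   Context: $(M,F)$ is a Finsler manifold of dimension $n$; $TM^0=TM\setminus\{\text{zero section}\}$, with induced local coordinates $(x^i,y^i)$, $i=1,\dots,n$, and summation over repeated indices. For a vector bundle $E$, $\Gamma(E)$ denotes its sections. Put $g_{ij}=\frac12\frac{\partial^2F^2}{\partial y^i\partial y^j}$, with inverse $(g^{ij})$. The vertical bundle $V(TM^0)$, locally spanned by $\{\partial/\partial y^i\}$, is tangent to the vertical foliation $\mathcal{F}_V$ (the fibers of $TM^0\to M$). Put $G^i=\frac14g^{ik}\left(\frac{\partial^2F^2}{\partial y^k\partial x^h}y^h-\frac{\partial F^2}{\partial x^k}\right)$, $G_i^j=\frac{\partial G^j}{\partial y^i}$, $\frac{\delta}{\delta x^i}=\frac{\partial}{\partial x^i}-G_i^j\frac{\partial}{\partial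 y^j}$; these span the horizontal distribution $H(TM^0)$, and $T(TM^0)=H(TM^0)\oplus V(TM^0)$. The Riemannian metric $G$ on $TM^0$ is the Sasaki lift: $G(\frac{\delta}{\delta x^i},\frac{\delta}{\delta x^j})=G(\frac{\partial}{\partial y^i},\frac{\partial}{\partial y^j})=g_{ij}$, $G(\frac{\delta}{\delta x^i},\frac{\partial}{\partial y^j})=0$. The vertical Liouville vector field is $\Gamma=y^i\frac{\partial}{\partial y^i}$; $\mathcal{L}_\Gamma$ is the line distribution spanned by $\Gamma$, with foliation $\mathcal{F}_\Gamma$; $\mathcal{L}_\Gamma'=\{X\in V(TM^0): G(X,\Gamma)=0\}$ and $\mathcal{L}_\Gamma^\perp=\{X\in T(TM^0): G(X,\Gamma)=0\}=H(TM^0)\oplus\mathcal{L}_\Gamma'$. Let $\pi_0:V(TM^0)\to\mathcal{L}_\Gamma'$, $\pi_1:T(TM^0)\to H(TM^0)$, $\pi_2:T(TM^0)\to\mathcal{L}_\Gamma^\perp$ be the projections along $\mathcal{L}_\Gamma$, $V(TM^0)$, $\mathcal{L}_\Gamma$ respectively. Basic connections. A connection $D$ on $\mathcal{L}_\Gamma'$ is basic (with respect to $(\mathcal{F}_V,\mathcal{F}_\Gamma)$) if $D_XZ=\pi_0[X,\widetilde Z]$ for all $X\in\Gamma(\mathcal{L}_\Gamma)$ and $\widetilde Z\in\Gamma(V(TM^0))$ with $\pi_0(\widetilde Z)=Z$. A connection $D$ on $H(TM^0)$ is basic (with respect to $\mathcal{F}_V$) if $D_XY=\pi_1[X,\widetilde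 Y]$ for all $X\in\Gamma(V(TM^0))$ and $\widetilde Y\in\Gamma(T(TM^0))$ with $\pi_1(\widetilde Y)=Y$. A connection $D$ on $\mathcal{L}_\Gamma^\perp$ is basic (with respect to $\mathcal{F}_\Gamma$) if $D_XY=\pi_2[X,\widetilde Y]$ for all $X\in\Gamma(\mathcal{L}_\Gamma)$ and $\widetilde Y\in\Gamma(T(TM^0))$ with $\pi_2(\widetilde Y)=Y$. A triple of basic connections on $\mathcal{L}_\Gamma'$, $H(TM^0)$, $\mathcal{L}_\Gamma^\perp$, respectively, is called adapted to the subfoliation $(\mathcal{F}_V,\mathcal{F}_\Gamma)$. Vr\^anceanu connection. $\nabla^*$ is the connection on $T(TM^0)$ given locally by $\nabla^*_{\frac{\partial}{\partial y^j}}\frac{\partial}{\partial y^i}=C_{ij}^k\frac{\partial}{\partial y^k}$, $\nabla^*_{\frac{\delta}{\delta x^j}}\frac{\partial}{\partial y^i}=G_{ij}^k\frac{\partial}{\partial y^k}$, $\nabla^*_{\frac{\partial}{\partial y^j}}\frac{\delta}{\delta x^i}=0$, $\nabla^*_{\frac{\delta}{\delta x^j}}\frac{\delta}{\delta x^i}=F_{ij}^k\frac{\delta}{\delta x^k}$, where $C_{ij}^k=\frac12g^{kl}\frac{\partial g_{ij}}{\partial y^l}$, $G_{ij}^k=\frac{\partial G_j^k}{\partial y^i}$, $F_{ij}^k=\frac12g^{kl}\left(\frac{\delta g_{il}}{\delta x^j}+\frac{\delta g_{jl}}{\delta x^i}-\frac{\delta g_{ij}}{\delta x^l}\right)$. Its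 restriction to $T(TM^0)\times H(TM^0)$ is a connection $\nabla^*_1$ on $H(TM^0)$. Vaisman connection. Let $v,h$ be the projections of $V(TM^0)=\mathcal{L}_\Gamma'\oplus\mathcal{L}_\Gamma$ onto $\mathcal{L}_\Gamma'$ and $\mathcal{L}_\Gamma$. $\nabla^v$ is the connection on $V(TM^0)$ such that: (a) for every vertical $X$, $\nabla^v_XY\in\Gamma(\mathcal{L}_\Gamma')$ if $Y\in\Gamma(\mathcal{L}_\Gamma')$, and $\nabla^v_XY\in\Gamma(\mathcal{L}_\Gamma)$ if $Y\in\Gamma(\mathcal{L}_\Gamma)$; (b) for vertical $X,Y$, with $T^v(X,Y)=\nabla^v_XY-\nabla^v_YX-[X,Y]$, $v(T^v(X,Y))=0$ if at least one argument is in $\mathcal{L}_\Gamma'$, and $h(T^v(X,Y))=0$ if at least one argument is in $\mathcal{L}_\Gamma$; (c) $(\nabla^v_XG)(Y,Y')=0$ for all $X,Y,Y'\in\Gamma(\mathcal{L}_\Gamma')$, and for all $X,Y,Y'\in\Gamma(\mathcal{L}_\Gamma)$; (d) conditions (a) and (b) are also imposed for horizontal $X$ and vertical $Y$, that is, for $X\in\Gamma(H(TM^0))$, $\nabla^v_XY$ is the $\mathcal{L}_\Gamma'$-component of $[X,Y]$ if $Y\in\Gamma(\mathcal{L}_\Gamma')$ and the $\mathcal{L}_\Gamma$-component of $[X,Y]$ if $Y\in\Gamma(\mathcal{L}_\Gamma)$ (components with respect to $T(TM^0)=H(TM^0)\oplus\mathcal{L}_\Gamma'\oplus\mathcal{L}_\Gamma$).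 By (a) and (d), $\nabla^v$ restricts to a connection on $\mathcal{L}_\Gamma'$, also denoted $\nabla^v$. *)

theory Defs
  imports "HOL-Analysis.Analysis"
begin

section \<open>Smooth maps between Euclidean spaces\<close>

text \<open>For an open set \<open>S\<close> of a Euclidean space: \<open>f\<close> is of class \<open>C\<^sup>k\<close> on \<open>S\<close>, respectively
  \<open>C\<^sup>\<infinity>\<close> on \<open>S\<close>.\<close>

primrec Ck_on :: "nat \<Rightarrow> 'a::real_normed_vector set \<Rightarrow> ('a \<Rightarrow> 'b::real_normed_vector) \<Rightarrow> bool" where
  "Ck_on 0 S f \<longleftrightarrow> continuous_on S f"
| "Ck_on (Suc k) S f \<longleftrightarrow>
     (\<forall>x\<in>S. f differentiable (at x)) \<and> (\<forall>v. Ck_on k S (\<lambda>x. frechet_derivative f (at x) v))"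

definition smooth_on :: "'a::real_normed_vector set \<Rightarrow> ('a \<Rightarrow> 'b::real_normed_vector) \<Rightarrow> bool" where
  "smooth_on S f \<longleftrightarrow> (\<forall>k. Ck_on k S f)"


section \<open>Smooth manifolds\<close>

text \<open>A manifold is presented by an indexed atlas; its underlying set is the union of the chart
  domains and its topology is the one induced by the charts.\<close>

record ('i, 'p, 'e) atlas =
  chart_ind :: "'i set"
  chart_dom :: "'i \<Rightarrow> 'p set"
  chart_map :: "'i \<Rightarrow> 'p \<Rightarrow> 'e"

definition points :: "('i, 'p, 'e) atlas \<Rightarrow> 'p set" where
  "points A = (\<Union>i\<in>chart_ind A. chart_dom A i)"

definition charts_at :: "('i, 'p, 'e) atlas \<Rightarrow> 'p \<Rightarrow> 'i set" where
  "charts_at A p = {i \<in> chart_ind A. p \<in> chart_dom A i}"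

definition chart_inv :: "('i, 'p, 'e) atlas \<Rightarrow> 'i \<Rightarrow> 'e \<Rightarrow> 'p" where
  "chart_inv A i = inv_into (chart_dom A i) (chart_map A i)"

definition transition :: "('i, 'p, 'e) atlas \<Rightarrow> 'i \<Rightarrow> 'i \<Rightarrow> 'e \<Rightarrow> 'e" where
  "transition A i j = chart_map A j \<circ> chart_inv A i"

definition atlas_open :: "('i, 'p, 'e::euclidean_space) atlas \<Rightarrow> 'p set \<Rightarrow> bool" where
  "atlas_open A W \<longleftrightarrow> W \<subseteq> points A \<and>
     (\<forall>i\<in>chart_ind A. open (chart_map A i ` (W \<inter> chart_dom A i)))"

definition atlas_topology :: "('i, 'p, 'e::euclidean_space) atlas \<Rightarrow> 'p topology" where
  "atlas_topology A = topology (atlas_open A)"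

definition smooth_manifold :: "('i, 'p, 'e::euclidean_space) atlas \<Rightarrow> bool" where
  "smooth_manifold A \<longleftrightarrow>
     (\<forall>i\<in>chart_ind A. inj_on (chart_map A i) (chart_dom A i)) \<and>
     (\<forall>i\<in>chart_ind A. open (chart_map A i ` chart_dom A i)) \<and>
     (\<forall>i\<in>chart_ind A. \<forall>j\<in>chart_ind A.
        open (chart_map A i ` (chart_dom A i \<inter> chart_dom A j)) \<and>
        smooth_on (chart_map A i ` (chart_dom A i \<inter> chart_dom A j)) (transition A i j)) \<and>
     Hausdorff_space (atlas_topology A) \<and> second_countable (atlas_topology A)"

lemma openin_atlas_topology:
  assumes inj: "\<And>i. i \<in> chart_ind A \<Longrightarrow> inj_on (chart_map A i) (chart_dom A i)"
  shows "openin (atlas_topology A) = atlas_open A"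
proof -
  have int: "atlas_open A (S \<inter> T)" if S: "atlas_open A S" and T: "atlas_open A T" for S T
    unfolding atlas_open_def
  proof (intro conjI ballI)
    show "S \<inter> T \<subseteq> points A"
      using S by (auto simp: atlas_open_def)
    fix i assume i: "i \<in> chart_ind A"
    have "chart_map A i ` (S \<inter> T \<inter> chart_dom A i) =
        chart_map A i ` ((S \<inter> chart_dom A i) \<inter> (T \<inter> chart_dom A i))"
      by (rule arg_cong[where f = "image (chart_map A i)"]) blast
    also have "\<dots> = chart_map A i ` (S \<inter> chart_dom A i) \<inter> chart_map A i ` (T \<inter> chart_dom A i)"
      by (rule inj_on_image_Int[OF inj[OF i]]) auto
    finally show "open (chart_map A i ` (S \<inter> T \<inter> chart_dom A i))"
      using S T i by (auto simp: atlas_open_def)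
  qed
  have un: "atlas_open A (\<Union>\<K>)" if K: "\<forall>K\<in>\<K>. atlas_open A K" for \<K>
    unfolding atlas_open_def
  proof (intro conjI ballI)
    show "\<Union>\<K> \<subseteq> points A"
      using K by (auto simp: atlas_open_def)
    fix i assume i: "i \<in> chart_ind A"
    have "chart_map A i ` (\<Union>\<K> \<inter> chart_dom A i) = (\<Union>K\<in>\<K>. chart_map A i ` (K \<inter> chart_dom A i))"
      by blast
    then show "open (chart_map A i ` (\<Union>\<K> \<inter> chart_dom A i))"
      using K i by (auto simp: atlas_open_def)
  qed
  have "istopology (atlas_open A)"
    unfolding istopology_def using int un by blast
  then show ?thesis
    by (simp add: atlas_topology_def topology_inverse')
qed

definition smooth_fun :: "('i, 'p, 'e::euclidean_space) atlas \<Rightarrow> 'p set \<Rightarrow> ('p \<Rightarrow> real) \<Rightarrow> bool" where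
  "smooth_fun A W f \<longleftrightarrow>
     (\<forall>i\<in>chart_ind A. smooth_on (chart_map A i ` (W \<inter> chart_dom A i)) (f \<circ> chart_inv A i))"


section \<open>Tangent vectors and vector fields\<close>

text \<open>A tangent vector at \<open>p\<close> is the family of its coordinate vectors in the charts around \<open>p\<close>,
  related by the Jacobians of the coordinate changes. At indices of no chart around \<open>p\<close>
  the family is set to \<open>0\<close>, so that families are equal iff the vectors are.\<close>

definition tangent_space :: "('i, 'p, 'e::euclidean_space) atlas \<Rightarrow> 'p \<Rightarrow> ('i \<Rightarrow> 'e) set" where
  "tangent_space A p = {v.
     (\<forall>i\<in>charts_at A p. \<forall>j\<in>charts_at A p.
        v j = frechet_derivative (transition A i j) (at (chart_map A i p)) (v i)) \<and>
     (\<forall>i. i \<notin> charts_at A p \<longrightarrow> v i = 0)}"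

text \<open>The vector field on the domain of chart \<open>i\<close> with constant coordinates \<open>w\<close> in that chart.\<close>

definition coord_field ::
  "('i, 'p, 'e::euclidean_space) atlas \<Rightarrow> 'i \<Rightarrow> 'e \<Rightarrow> 'p \<Rightarrow> 'i \<Rightarrow> 'e" where
  "coord_field A i w p = (\<lambda>j. if j \<in> charts_at A p
     then frechet_derivative (transition A i j) (at (chart_map A i p)) w else 0)"

definition vector_field ::
  "('i, 'p, 'e::euclidean_space) atlas \<Rightarrow> 'p set \<Rightarrow> ('p \<Rightarrow> 'i \<Rightarrow> 'e) \<Rightarrow> bool" where
  "vector_field A W X \<longleftrightarrow>
     (\<forall>p\<in>W. X p \<in> tangent_space A p) \<and>
     (\<forall>i\<in>chart_ind A.
        smooth_on (chart_map A i ` (W \<inter> chart_dom A i)) (\<lambda>u. X (chart_inv A i u) i))"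

text \<open>The smooth sections over \<open>W\<close> of a distribution \<open>E\<close> (a subset of each tangent space).
  Fields are total functions; their values outside \<open>W\<close> are irrelevant.\<close>

definition sections ::
  "('i, 'p, 'e::euclidean_space) atlas \<Rightarrow> ('p \<Rightarrow> ('i \<Rightarrow> 'e) set) \<Rightarrow> 'p set \<Rightarrow> ('p \<Rightarrow> 'i \<Rightarrow> 'e) set" where
  "sections A E W = {X. vector_field A W X \<and> (\<forall>p\<in>W. X p \<in> E p)}"

definition dist_sum ::
  "('p \<Rightarrow> ('i \<Rightarrow> 'e::euclidean_space) set) \<Rightarrow> ('p \<Rightarrow> ('i \<Rightarrow> 'e) set) \<Rightarrow> 'p \<Rightarrow> ('i \<Rightarrow> 'e) set" where
  "dist_sum E K p = {\<lambda>i. a i + b i | a b. a \<in> E p \<and> b \<in> K p}"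

text \<open>Projection onto \<open>E\<close> along \<open>K\<close>; meaningful for fields with values in \<open>E \<oplus> K\<close>.\<close>

definition proj ::
  "('p \<Rightarrow> ('i \<Rightarrow> 'e::euclidean_space) set) \<Rightarrow> ('p \<Rightarrow> ('i \<Rightarrow> 'e) set) \<Rightarrow>
   ('p \<Rightarrow> 'i \<Rightarrow> 'e) \<Rightarrow> 'p \<Rightarrow> 'i \<Rightarrow> 'e" where
  "proj E K X p = (THE u. u \<in> E p \<and> (\<lambda>i. X p i - u i) \<in> K p)"

text \<open>The function \<open>X f\<close>; by the chain rule the choice of the chart does not matter.\<close>

definition deriv_along ::
  "('i, 'p, 'e::euclidean_space) atlas \<Rightarrow> ('p \<Rightarrow> 'i \<Rightarrow> 'e) \<Rightarrow> ('p \<Rightarrow> real) \<Rightarrow> 'p \<Rightarrow> real" where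
  "deriv_along A X f p = (let i = (SOME i. i \<in> charts_at A p) in
     frechet_derivative (f \<circ> chart_inv A i) (at (chart_map A i p)) (X p i))"

definition lie_bracket ::
  "('i, 'p, 'e::euclidean_space) atlas \<Rightarrow> ('p \<Rightarrow> 'i \<Rightarrow> 'e) \<Rightarrow> ('p \<Rightarrow> 'i \<Rightarrow> 'e) \<Rightarrow> 'p \<Rightarrow> 'i \<Rightarrow> 'e" where
  "lie_bracket A X Y p = (\<lambda>i. if i \<in> charts_at A p then
       frechet_derivative (\<lambda>u. Y (chart_inv A i u) i) (at (chart_map A i p)) (X p i)
     - frechet_derivative (\<lambda>u. X (chart_inv A i u) i) (at (chart_map A i p)) (Y p i)
     else 0)"


section \<open>Connections\<close>

text \<open>A connection on the distribution (subbundle of the tangent bundle) \<open>E\<close>, given as an operator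
  on the smooth sections over arbitrary open sets that commutes with restriction, so that it can be
  applied to local frames; \<open>W = points A\<close> gives the operator on global sections, which
  conversely determines the others. A connection on \<open>E\<close> may also be applied to the sections of
  a distribution contained in \<open>E\<close>; its restriction is therefore the same operator.\<close>

definition connection ::
  "('i, 'p, 'e::euclidean_space) atlas \<Rightarrow> ('p \<Rightarrow> ('i \<Rightarrow> 'e) set) \<Rightarrow>
   (('p \<Rightarrow> 'i \<Rightarrow> 'e) \<Rightarrow> ('p \<Rightarrow> 'i \<Rightarrow> 'e) \<Rightarrow> ('p \<Rightarrow> 'i \<Rightarrow> 'e)) \<Rightarrow> bool" where
  "connection A E D \<longleftrightarrow> (\<forall>W. atlas_open A W \<longrightarrow>
     (\<forall>X\<in>sections A (tangent_space A) W. \<forall>Y\<in>sections A E W.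
        D X Y \<in> sections A E W \<and>
        (\<forall>X'\<in>sections A (tangent_space A) W. \<forall>Y'\<in>sections A E W.
           (\<forall>p\<in>W. X' p = X p \<and> Y' p = Y p) \<longrightarrow> (\<forall>p\<in>W. D X' Y' p = D X Y p)) \<and>
        (\<forall>X'\<in>sections A (tangent_space A) W. \<forall>p\<in>W.
           D (\<lambda>q i. X q i + X' q i) Y p = (\<lambda>i. D X Y p i + D X' Y p i)) \<and>
        (\<forall>Y'\<in>sections A E W. \<forall>p\<in>W.
           D X (\<lambda>q i. Y q i + Y' q i) p = (\<lambda>i. D X Y p i + D X Y' p i)) \<and>
        (\<forall>f. smooth_fun A W f \<longrightarrow> (\<forall>p\<in>W.
           D (\<lambda>q i. f q *\<^sub>R X q i) Y p = (\<lambda>i. f p *\<^sub>R D X Y p i) \<and>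
           D X (\<lambda>q i. f q *\<^sub>R Y q i) p =
             (\<lambda>i. deriv_along A X f p *\<^sub>R Y p i + f p *\<^sub>R D X Y p i)))))"

text \<open>For a bundle \<open>B = E \<oplus> K\<close> of tangent vectors: \<open>D\<close> is a connection on \<open>E\<close> with
  \<open>D X Z = \<pi> [X, Z']\<close> for all sections \<open>X\<close> of \<open>K\<close> and \<open>Z'\<close> of \<open>B\<close> with \<open>\<pi> Z' = Z\<close>, where
  \<open>\<pi>\<close> is the projection of \<open>B\<close> onto \<open>E\<close> along \<open>K\<close>. The three notions of basic connection
  are instances.\<close>

definition basic_connection ::
  "('i, 'p, 'e::euclidean_space) atlas \<Rightarrow> ('p \<Rightarrow> ('i \<Rightarrow> 'e) set) \<Rightarrow>
   ('p \<Rightarrow> ('i \<Rightarrow> 'e) set) \<Rightarrow> ('p \<Rightarrow> ('i \<Rightarrow> 'e) set) \<Rightarrow>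
   (('p \<Rightarrow> 'i \<Rightarrow> 'e) \<Rightarrow> ('p \<Rightarrow> 'i \<Rightarrow> 'e) \<Rightarrow> ('p \<Rightarrow> 'i \<Rightarrow> 'e)) \<Rightarrow> bool" where
  "basic_connection A B E K D \<longleftrightarrow> connection A E D \<and>
     (\<forall>W. atlas_open A W \<longrightarrow>
        (\<forall>X\<in>sections A K W. \<forall>Z\<in>sections A E W. \<forall>Z'\<in>sections A B W.
           (\<forall>p\<in>W. proj E K Z' p = Z p) \<longrightarrow>
           (\<forall>p\<in>W. D X Z p = proj E K (lie_bracket A X Z') p)))"

definition riemannian_metric ::
  "('i, 'p, 'e::euclidean_space) atlas \<Rightarrow> ('p \<Rightarrow> ('i \<Rightarrow> 'e) \<Rightarrow> ('i \<Rightarrow> 'e) \<Rightarrow> real) \<Rightarrow> bool" where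
  "riemannian_metric A G \<longleftrightarrow>
     (\<forall>p\<in>points A. \<forall>u\<in>tangent_space A p. \<forall>v\<in>tangent_space A p.
        G p u v = G p v u \<and>
        (\<forall>w\<in>tangent_space A p. \<forall>a b.
           G p (\<lambda>i. a *\<^sub>R u i + b *\<^sub>R v i) w = a * G p u w + b * G p v w) \<and>
        (u \<noteq> (\<lambda>_. 0) \<longrightarrow> G p u u > 0)) \<and>
     (\<forall>W X Y. atlas_open A W \<and> vector_field A W X \<and> vector_field A W Y \<longrightarrow>
        smooth_fun A W (\<lambda>p. G p (X p) (Y p)))"


section \<open>Finsler manifolds\<close>

text \<open>\<open>TM\<^sup>0\<close> with the induced charts \<open>(x, y)\<close>; they have the same indices as the charts of \<open>M\<close>.\<close>

definition slit_tangent_bundle ::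
  "('i, 'p, 'e::euclidean_space) atlas \<Rightarrow> ('i, 'p \<times> ('i \<Rightarrow> 'e), 'e \<times> 'e) atlas" where
  "slit_tangent_bundle M = \<lparr>
     chart_ind = chart_ind M,
     chart_dom = (\<lambda>i. {(p, v). p \<in> chart_dom M i \<and> v \<in> tangent_space M p \<and> v \<noteq> (\<lambda>_. 0)}),
     chart_map = (\<lambda>i (p, v). (chart_map M i p, v i))\<rparr>"

type_synonym ('i, 'p, 'n) tm_point = "'p \<times> ('i \<Rightarrow> real^'n)"
type_synonym ('i, 'n) ttm_vector = "'i \<Rightarrow> (real^'n) \<times> (real^'n)"
type_synonym ('i, 'p, 'n) ttm_field = "('i, 'p, 'n) tm_point \<Rightarrow> ('i, 'n) ttm_vector"
type_synonym ('i, 'p, 'n) ttm_dist = "('i, 'p, 'n) tm_point \<Rightarrow> ('i, 'n) ttm_vector set"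
type_synonym ('i, 'p, 'n) ttm_metric =
  "('i, 'p, 'n) tm_point \<Rightarrow> ('i, 'n) ttm_vector \<Rightarrow> ('i, 'n) ttm_vector \<Rightarrow> real"
type_synonym ('i, 'p, 'n) ttm_connection =
  "('i, 'p, 'n) ttm_field \<Rightarrow> ('i, 'p, 'n) ttm_field \<Rightarrow> ('i, 'p, 'n) ttm_field"

text \<open>\<open>\<partial>/\<partial>x\<^sup>k\<close> and \<open>\<partial>/\<partial>y\<^sup>k\<close> on functions of \<open>(x, y)\<close>.\<close>

definition Dx :: "'n::finite \<Rightarrow> ((real^'n) \<times> (real^'n) \<Rightarrow> real) \<Rightarrow> (real^'n) \<times> (real^'n) \<Rightarrow> real" where
  "Dx k f z = frechet_derivative f (at z) (axis k 1, 0)"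

definition Dy :: "'n::finite \<Rightarrow> ((real^'n) \<times> (real^'n) \<Rightarrow> real) \<Rightarrow> (real^'n) \<times> (real^'n) \<Rightarrow> real" where
  "Dy k f z = frechet_derivative f (at z) (0, axis k 1)"

text \<open>The following local objects are functions of \<open>z = (x, y)\<close> in the induced chart \<open>i\<close>:
  \<open>F\<^sup>2\<close>, the matrix \<open>(g\<^sub>k\<^sub>l)\<close>, the entries \<open>g\<^sup>k\<^sup>l\<close> of its inverse, and \<open>G\<^sup>k\<close>.\<close>

definition Fsq :: "('i, 'p, real^'n::finite) atlas \<Rightarrow> (('i, 'p, 'n) tm_point \<Rightarrow> real) \<Rightarrow>
    'i \<Rightarrow> (real^'n) \<times> (real^'n) \<Rightarrow> real" where
  "Fsq M F i z = (F (chart_inv (slit_tangent_bundle M) i z))\<^sup>2"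

definition gmat :: "('i, 'p, real^'n::finite) atlas \<Rightarrow> (('i, 'p, 'n) tm_point \<Rightarrow> real) \<Rightarrow>
    'i \<Rightarrow> (real^'n) \<times> (real^'n) \<Rightarrow> real^'n^'n" where
  "gmat M F i z = (\<chi> k l. 1/2 * Dy k (Dy l (Fsq M F i)) z)"

definition ginv :: "('i, 'p, real^'n::finite) atlas \<Rightarrow> (('i, 'p, 'n) tm_point \<Rightarrow> real) \<Rightarrow>
    'i \<Rightarrow> 'n \<Rightarrow> 'n \<Rightarrow> (real^'n) \<times> (real^'n) \<Rightarrow> real" where
  "ginv M F i k l z = matrix_inv (gmat M F i z) $ k $ l"

definition spray :: "('i, 'p, real^'n::finite) atlas \<Rightarrow> (('i, 'p, 'n) tm_point \<Rightarrow> real) \<Rightarrow>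
    'i \<Rightarrow> 'n \<Rightarrow> (real^'n) \<times> (real^'n) \<Rightarrow> real" where
  "spray M F i j z = 1/4 * (\<Sum>k\<in>UNIV. ginv M F i j k z *
     ((\<Sum>h\<in>UNIV. Dy k (Dx h (Fsq M F i)) z * snd z $ h) - Dx k (Fsq M F i) z))"

text \<open>A Finsler metric \<open>F\<close> on \<open>TM\<close>: nonnegative, vanishing exactly on the zero section, positively
  homogeneous, smooth on \<open>TM\<^sup>0\<close>, with \<open>(g\<^sub>k\<^sub>l)\<close> positive definite.\<close>

definition finsler_manifold ::
  "('i, 'p, real^'n::finite) atlas \<Rightarrow> (('i, 'p, 'n) tm_point \<Rightarrow> real) \<Rightarrow> bool" where
  "finsler_manifold M F \<longleftrightarrow> smooth_manifold M \<and>
     (\<forall>p\<in>points M. \<forall>v\<in>tangent_space M p.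
        F (p, v) \<ge> 0 \<and> (F (p, v) = 0 \<longleftrightarrow> v = (\<lambda>_. 0)) \<and>
        (\<forall>t\<ge>0. F (p, \<lambda>i. t *\<^sub>R v i) = t * F (p, v))) \<and>
     smooth_fun (slit_tangent_bundle M) (points (slit_tangent_bundle M)) F \<and>
     (\<forall>i\<in>chart_ind M. \<forall>z\<in>chart_map (slit_tangent_bundle M) i ` chart_dom (slit_tangent_bundle M) i.
        \<forall>\<xi>. \<xi> \<noteq> 0 \<longrightarrow> \<xi> \<bullet> (gmat M F i z *v \<xi>) > 0)"

text \<open>\<open>nlc M F i k j\<close> is \<open>G\<^sub>k\<^sup>j = \<partial>G\<^sup>j/\<partial>y\<^sup>k\<close> (lower index first); \<open>Ddelta\<close> is the action
  of \<open>\<delta>/\<delta>x\<^sup>k\<close> on functions of \<open>(x, y)\<close>.\<close>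

definition nlc :: "('i, 'p, real^'n::finite) atlas \<Rightarrow> (('i, 'p, 'n) tm_point \<Rightarrow> real) \<Rightarrow>
    'i \<Rightarrow> 'n \<Rightarrow> 'n \<Rightarrow> (real^'n) \<times> (real^'n) \<Rightarrow> real" where
  "nlc M F i k j z = Dy k (spray M F i j) z"

definition Ddelta :: "('i, 'p, real^'n::finite) atlas \<Rightarrow> (('i, 'p, 'n) tm_point \<Rightarrow> real) \<Rightarrow>
    'i \<Rightarrow> 'n \<Rightarrow> ((real^'n) \<times> (real^'n) \<Rightarrow> real) \<Rightarrow> (real^'n) \<times> (real^'n) \<Rightarrow> real" where
  "Ddelta M F i k f z = Dx k f z - (\<Sum>j\<in>UNIV. nlc M F i k j z * Dy j f z)"

text \<open>The local vector fields \<open>\<partial>/\<partial>y\<^sup>k\<close> and \<open>\<delta>/\<delta>x\<^sup>k\<close> of chart \<open>i\<close> on \<open>TM\<^sup>0\<close>.\<close>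

definition ddy :: "('i, 'p, real^'n::finite) atlas \<Rightarrow> 'i \<Rightarrow> 'n \<Rightarrow> ('i, 'p, 'n) ttm_field" where
  "ddy M i k = coord_field (slit_tangent_bundle M) i (0, axis k 1)"

definition delta :: "('i, 'p, real^'n::finite) atlas \<Rightarrow> (('i, 'p, 'n) tm_point \<Rightarrow> real) \<Rightarrow>
    'i \<Rightarrow> 'n \<Rightarrow> ('i, 'p, 'n) ttm_field" where
  "delta M F i k q = (\<lambda>c. coord_field (slit_tangent_bundle M) i (axis k 1, 0) q c
     - (\<Sum>j\<in>UNIV. nlc M F i k j (chart_map (slit_tangent_bundle M) i q) *\<^sub>R ddy M i j q c))"

definition vertical :: "('i, 'p, real^'n::finite) atlas \<Rightarrow> ('i, 'p, 'n) ttm_dist" where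
  "vertical M q = {w \<in> tangent_space (slit_tangent_bundle M) q.
     \<forall>i\<in>charts_at (slit_tangent_bundle M) q. \<exists>a. w = (\<lambda>c. \<Sum>k\<in>UNIV. a k *\<^sub>R ddy M i k q c)}"

definition horizontal :: "('i, 'p, real^'n::finite) atlas \<Rightarrow> (('i, 'p, 'n) tm_point \<Rightarrow> real) \<Rightarrow>
    ('i, 'p, 'n) ttm_dist" where
  "horizontal M F q = {w \<in> tangent_space (slit_tangent_bundle M) q.
     \<forall>i\<in>charts_at (slit_tangent_bundle M) q. \<exists>a. w = (\<lambda>c. \<Sum>k\<in>UNIV. a k *\<^sub>R delta M F i k q c)}"

definition sasaki_lift :: "('i, 'p, real^'n::finite) atlas \<Rightarrow> (('i, 'p, 'n) tm_point \<Rightarrow> real) \<Rightarrow>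
    ('i, 'p, 'n) ttm_metric \<Rightarrow> bool" where
  "sasaki_lift M F G \<longleftrightarrow> riemannian_metric (slit_tangent_bundle M) G \<and>
     (\<forall>i\<in>chart_ind M. \<forall>q\<in>chart_dom (slit_tangent_bundle M) i. \<forall>k l.
        let g = gmat M F i (chart_map (slit_tangent_bundle M) i q) $ k $ l in
        G q (delta M F i k q) (delta M F i l q) = g \<and>
        G q (ddy M i k q) (ddy M i l q) = g \<and>
        G q (delta M F i k q) (ddy M i l q) = 0)"

text \<open>\<open>\<Gamma> = y\<^sup>k \<partial>/\<partial>y\<^sup>k\<close> has the coordinates \<open>(0, y)\<close> in each induced chart.\<close>

definition liouville :: "('i, 'p, 'n::finite) ttm_field" where
  "liouville q = (\<lambda>i. (0, snd q i))"

definition liouville_line :: "('i, 'p, 'n::finite) ttm_dist" where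
  "liouville_line q = {\<lambda>i. t *\<^sub>R liouville q i | t. True}"

text \<open>The distributions \<open>\<L>\<^sub>\<Gamma>'\<close> and \<open>\<L>\<^sub>\<Gamma>\<^sup>\<bottom>\<close>.\<close>

definition liouville_vert :: "('i, 'p, real^'n::finite) atlas \<Rightarrow> ('i, 'p, 'n) ttm_metric \<Rightarrow>
    ('i, 'p, 'n) ttm_dist" where
  "liouville_vert M G q = {w \<in> vertical M q. G q w (liouville q) = 0}"

definition liouville_perp :: "('i, 'p, real^'n::finite) atlas \<Rightarrow> ('i, 'p, 'n) ttm_metric \<Rightarrow>
    ('i, 'p, 'n) ttm_dist" where
  "liouville_perp M G q = {w \<in> tangent_space (slit_tangent_bundle M) q. G q w (liouville q) = 0}"


section \<open>The Vranceanu and Vaisman connections\<close>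

text \<open>\<open>C\<^sub>i\<^sub>j\<^sup>k\<close>, \<open>G\<^sub>i\<^sub>j\<^sup>k\<close>, \<open>F\<^sub>i\<^sub>j\<^sup>k\<close> in chart \<open>c\<close>.\<close>

definition Ccoef :: "('i, 'p, real^'n::finite) atlas \<Rightarrow> (('i, 'p, 'n) tm_point \<Rightarrow> real) \<Rightarrow>
    'i \<Rightarrow> 'n \<Rightarrow> 'n \<Rightarrow> 'n \<Rightarrow> (real^'n) \<times> (real^'n) \<Rightarrow> real" where
  "Ccoef M F c i j k z =
     1/2 * (\<Sum>l\<in>UNIV. ginv M F c k l z * Dy l (\<lambda>z. gmat M F c z $ i $ j) z)"

definition Gcoef :: "('i, 'p, real^'n::finite) atlas \<Rightarrow> (('i, 'p, 'n) tm_point \<Rightarrow> real) \<Rightarrow>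
    'i \<Rightarrow> 'n \<Rightarrow> 'n \<Rightarrow> 'n \<Rightarrow> (real^'n) \<times> (real^'n) \<Rightarrow> real" where
  "Gcoef M F c i j k z = Dy i (nlc M F c j k) z"

definition Fcoef :: "('i, 'p, real^'n::finite) atlas \<Rightarrow> (('i, 'p, 'n) tm_point \<Rightarrow> real) \<Rightarrow>
    'i \<Rightarrow> 'n \<Rightarrow> 'n \<Rightarrow> 'n \<Rightarrow> (real^'n) \<times> (real^'n) \<Rightarrow> real" where
  "Fcoef M F c i j k z = 1/2 * (\<Sum>l\<in>UNIV. ginv M F c k l z *
     (Ddelta M F c j (\<lambda>z. gmat M F c z $ i $ l) z
    + Ddelta M F c i (\<lambda>z. gmat M F c z $ j $ l) z
    - Ddelta M F c l (\<lambda>z. gmat M F c z $ i $ j) z))"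

definition vranceanu_connection ::
  "('i, 'p, real^'n::finite) atlas \<Rightarrow> (('i, 'p, 'n) tm_point \<Rightarrow> real) \<Rightarrow>
   ('i, 'p, 'n) ttm_connection \<Rightarrow> bool" where
  "vranceanu_connection M F D \<longleftrightarrow>
     connection (slit_tangent_bundle M) (tangent_space (slit_tangent_bundle M)) D \<and>
     (\<forall>c\<in>chart_ind M. \<forall>q\<in>chart_dom (slit_tangent_bundle M) c. \<forall>i j.
        let z = chart_map (slit_tangent_bundle M) c q in
        D (ddy M c j) (ddy M c i) q = (\<lambda>a. \<Sum>k\<in>UNIV. Ccoef M F c i j k z *\<^sub>R ddy M c k q a) \<and>
        D (delta M F c j) (ddy M c i) q = (\<lambda>a. \<Sum>k\<in>UNIV. Gcoef M F c i j k z *\<^sub>R ddy M c k q a) \<and>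
        D (ddy M c j) (delta M F c i) q = (\<lambda>a. 0) \<and>
        D (delta M F c j) (delta M F c i) q =
          (\<lambda>a. \<Sum>k\<in>UNIV. Fcoef M F c i j k z *\<^sub>R delta M F c k q a))"

definition torsion ::
  "('i, 'p, 'e::euclidean_space) atlas \<Rightarrow>
   (('p \<Rightarrow> 'i \<Rightarrow> 'e) \<Rightarrow> ('p \<Rightarrow> 'i \<Rightarrow> 'e) \<Rightarrow> ('p \<Rightarrow> 'i \<Rightarrow> 'e)) \<Rightarrow>
   ('p \<Rightarrow> 'i \<Rightarrow> 'e) \<Rightarrow> ('p \<Rightarrow> 'i \<Rightarrow> 'e) \<Rightarrow> 'p \<Rightarrow> 'i \<Rightarrow> 'e" where
  "torsion A D X Y p = (\<lambda>i. D X Y p i - D Y X p i - lie_bracket A X Y p i)"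

definition metric_deriv ::
  "('i, 'p, 'e::euclidean_space) atlas \<Rightarrow> ('p \<Rightarrow> ('i \<Rightarrow> 'e) \<Rightarrow> ('i \<Rightarrow> 'e) \<Rightarrow> real) \<Rightarrow>
   (('p \<Rightarrow> 'i \<Rightarrow> 'e) \<Rightarrow> ('p \<Rightarrow> 'i \<Rightarrow> 'e) \<Rightarrow> ('p \<Rightarrow> 'i \<Rightarrow> 'e)) \<Rightarrow>
   ('p \<Rightarrow> 'i \<Rightarrow> 'e) \<Rightarrow> ('p \<Rightarrow> 'i \<Rightarrow> 'e) \<Rightarrow> ('p \<Rightarrow> 'i \<Rightarrow> 'e) \<Rightarrow> 'p \<Rightarrow> real" where
  "metric_deriv A G D X Y Y' p =
     deriv_along A X (\<lambda>q. G q (Y q) (Y' q)) p - G p (D X Y p) (Y' p) - G p (Y p) (D X Y' p)"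

definition vaisman_connection ::
  "('i, 'p, real^'n::finite) atlas \<Rightarrow> (('i, 'p, 'n) tm_point \<Rightarrow> real) \<Rightarrow>
   ('i, 'p, 'n) ttm_metric \<Rightarrow> ('i, 'p, 'n) ttm_connection \<Rightarrow> bool" where
  "vaisman_connection M F G D \<longleftrightarrow>
     (let T = slit_tangent_bundle M; V = vertical M; H = horizontal M F;
          P = liouville_vert M G; L = liouville_line
      in connection T V D \<and>
        (\<forall>W. atlas_open T W \<longrightarrow>
           \<comment> \<open>(a)\<close>
           (\<forall>X\<in>sections T V W.
              (\<forall>Y\<in>sections T P W. D X Y \<in> sections T P W) \<and>
              (\<forall>Y\<in>sections T L W. D X Y \<in> sections T L W)) \<and>
           \<comment> \<open>(b)\<close>
           (\<forall>X\<in>sections T V W. \<forall>Y\<in>sections T V W.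
              (X \<in> sections T P W \<or> Y \<in> sections T P W \<longrightarrow>
                 (\<forall>q\<in>W. proj P L (torsion T D X Y) q = (\<lambda>_. 0))) \<and>
              (X \<in> sections T L W \<or> Y \<in> sections T L W \<longrightarrow>
                 (\<forall>q\<in>W. proj L P (torsion T D X Y) q = (\<lambda>_. 0)))) \<and>
           \<comment> \<open>(c)\<close>
           (\<forall>X\<in>sections T P W. \<forall>Y\<in>sections T P W. \<forall>Y'\<in>sections T P W.
              \<forall>q\<in>W. metric_deriv T G D X Y Y' q = 0) \<and>
           (\<forall>X\<in>sections T L W. \<forall>Y\<in>sections T L W. \<forall>Y'\<in>sections T L W.
              \<forall>q\<in>W. metric_deriv T G D X Y Y' q = 0) \<and>
           \<comment> \<open>(d)\<close>
           (\<forall>X\<in>sections T H W.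
              (\<forall>Y\<in>sections T P W. \<forall>q\<in>W.
                 D X Y q = proj P (dist_sum H L) (lie_bracket T X Y) q) \<and>
              (\<forall>Y\<in>sections T L W. \<forall>q\<in>W.
                 D X Y q = proj L (dist_sum H P) (lie_bracket T X Y) q))))"

text \<open>From connections \<open>D\<^sub>1\<close> on \<open>E\<^sub>1\<close> and \<open>D\<^sub>2\<close> on \<open>E\<^sub>2\<close>, the connection
  \<open>D X (Z\<^sub>1 + Z\<^sub>2) = D\<^sub>1 X Z\<^sub>1 + D\<^sub>2 X Z\<^sub>2\<close> on \<open>E\<^sub>1 \<oplus> E\<^sub>2\<close>.\<close>

definition sum_connection ::
  "('p \<Rightarrow> ('i \<Rightarrow> 'e::euclidean_space) set) \<Rightarrow> ('p \<Rightarrow> ('i \<Rightarrow> 'e) set) \<Rightarrow>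
   (('p \<Rightarrow> 'i \<Rightarrow> 'e) \<Rightarrow> ('p \<Rightarrow> 'i \<Rightarrow> 'e) \<Rightarrow> ('p \<Rightarrow> 'i \<Rightarrow> 'e)) \<Rightarrow>
   (('p \<Rightarrow> 'i \<Rightarrow> 'e) \<Rightarrow> ('p \<Rightarrow> 'i \<Rightarrow> 'e) \<Rightarrow> ('p \<Rightarrow> 'i \<Rightarrow> 'e)) \<Rightarrow>
   ('p \<Rightarrow> 'i \<Rightarrow> 'e) \<Rightarrow> ('p \<Rightarrow> 'i \<Rightarrow> 'e) \<Rightarrow> 'p \<Rightarrow> 'i \<Rightarrow> 'e" where
  "sum_connection E1 E2 D1 D2 X Z p =
     (\<lambda>i. D1 X (proj E1 E2 Z) p i + D2 X (proj E2 E1 Z) p i)"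

text \<open>The triple of basic connections on \<open>\<L>\<^sub>\<Gamma>'\<close>, \<open>H(TM\<^sup>0)\<close>, \<open>\<L>\<^sub>\<Gamma>\<^sup>\<bottom>\<close> adapted to
  \<open>(\<F>\<^sub>V, \<F>\<^sub>\<Gamma>)\<close>.\<close>

definition adapted_basic_triple ::
  "('i, 'p, real^'n::finite) atlas \<Rightarrow> (('i, 'p, 'n) tm_point \<Rightarrow> real) \<Rightarrow> ('i, 'p, 'n) ttm_metric \<Rightarrow>
   ('i, 'p, 'n) ttm_connection \<Rightarrow> ('i, 'p, 'n) ttm_connection \<Rightarrow> ('i, 'p, 'n) ttm_connection \<Rightarrow> bool"
  where
  "adapted_basic_triple M F G D1 D2 D3 \<longleftrightarrow>
     (let A = slit_tangent_bundle M in
      basic_connection A (vertical M) (liouville_vert M G) liouville_line D1 \<and>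
      basic_connection A (tangent_space A) (horizontal M F) (vertical M) D2 \<and>
      basic_connection A (tangent_space A) (liouville_perp M G) liouville_line D3)"

end

theory Submission
  imports Defs
begin

text \<open>The Sasaki metric makes \<open>\<delta>/\<delta>x\<^sup>k\<close> orthogonal to the vertical bundle, so the horizontal bundle is
  the orthogonal complement of the vertical one and no transformation law of the \<open>G\<^sub>i\<^sup>j\<close> is needed.
  For the connection on \<open>\<L>\<^sub>\<Gamma>'\<close> one splits a vertical field as a field in \<open>\<L>\<^sub>\<Gamma>'\<close> plus a multiple of
  \<open>\<Gamma>\<close>: conditions (a) and (b) give \<open>\<nabla>\<^sup>v\<^sub>X Z - [X, Z] \<in> \<L>\<^sub>\<Gamma>\<close> for \<open>X \<in> \<L>\<^sub>\<Gamma>\<close>, and brackets of two multiples of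
  \<open>\<Gamma>\<close> stay in \<open>\<L>\<^sub>\<Gamma>\<close>. For the connection on the horizontal bundle, \<open>\<delta>/\<delta>x\<^sup>k\<close> is parallel in vertical
  directions, so that \<open>\<nabla>\<^sup>*\<^sub>X Z\<close> and the horizontal part of \<open>[X, Z]\<close> both differentiate the components
  of \<open>Z\<close>. For the sum connection one needs in addition that \<open>[a \<Gamma>, Z] - \<nabla>\<^sup>*\<^sub>X Z\<close>, \<open>X = a \<Gamma>\<close>, is a
  multiple of \<open>\<Gamma>\<close> and not merely vertical; this is the homogeneity of the \<open>G\<^sub>i\<^sup>j\<close> in \<open>y\<close>.\<close>

section \<open>Calculus of smooth maps\<close>

text \<open>\<open>proj\<close> is a definite description, so its values are only ever identified by
  uniqueness: an equation \<open>D X Z p = proj E K B p\<close> is shown as \<open>D X Z p\<close>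
  lying in \<open>E p\<close> and the difference \<open>B p - D X Z p\<close> lying in
  \<open>K p\<close>. Being basic is thus a statement about brackets modulo \<open>K\<close>. It
  does not depend on the lift, because two lifts differ by a section of \<open>K\<close> and
  brackets of sections of \<open>K\<close> stay in \<open>K\<close>. A tangent vector is a
  compatible family over all charts, so even for a bracket to be a tangent vector one needs symmetry
  of second derivatives. The frames exist only on chart domains, whereas connections act over
  arbitrary open sets; frame computations therefore take place on the intersection with a chart
  domain. In coordinates, the bracket of \<Gamma> with \<delta>/\<delta>x^k has the components G_k^j
  - \<Gamma>(G_k^j), which vanish by Euler's relation in degree 1. This degree is obtained by
  counting: F^2 has degree 2 in y, g_ij degree 0, G^j degree 2 and G_k^j degree 1.\<close>

lemma frechet_derivative_eqI:
  "(f has_derivative f') (at x) \<Longrightarrow> frechet_derivative f (at x) = f'"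
  by (simp add: frechet_derivative_at[symmetric])

lemma differentiable_transform_within_open:
  assumes "f differentiable (at x)" "open S" "x \<in> S" "\<And>y. y \<in> S \<Longrightarrow> f y = g y"
  shows "g differentiable (at x)"
  using assms has_derivative_transform_within_open unfolding differentiable_def by blast

text \<open>\<open>Ck_on\<close> only involves derivatives in fixed directions; this expansion turns
  a derivative in a moving direction into finitely many fixed-direction derivatives with scalar
  coefficients.\<close>

lemma frechet_derivative_sum_Basis:
  fixes f :: "'a::euclidean_space \<Rightarrow> 'b::real_normed_vector"
  assumes "f differentiable (at x)"
  shows "frechet_derivative f (at x) v = (\<Sum>b\<in>Basis. (v \<bullet> b) *\<^sub>R frechet_derivative f (at x) b)"
proof -
  interpret linear "frechet_derivative f (at x)"
    by (rule linear_frechet_derivative[OF assms])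
  show ?thesis
    by (subst (1) euclidean_representation[of v, symmetric]) (simp only: sum scale)
qed

section \<open>Maps of class C^k on open sets\<close>

lemma Ck_on_cong:
  assumes "open S" "\<And>x. x \<in> S \<Longrightarrow> f x = g x" "Ck_on k S f"
  shows "Ck_on k S g"
  using assms(2,3)
proof (induction k arbitrary: f g)
  case 0
  then show ?case by (simp cong: continuous_on_cong)
next
  case (Suc k)
  have "frechet_derivative f (at x) = frechet_derivative g (at x)" if "x \<in> S" for x
    using Suc.prems that assms(1) by (intro frechet_derivative_transform_within_open) auto
  moreover have "g differentiable (at x)" if "x \<in> S" for x
    using Suc.prems that assms(1) by (auto intro: differentiable_transform_within_open)
  ultimately show ?case
    using Suc.prems by (auto intro: Suc.IH[of "\<lambda>x. frechet_derivative f (at x) v" for v])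
qed

lemma Ck_on_SucD: "Ck_on (Suc k) S f \<Longrightarrow> Ck_on k S f"
  by (induction k arbitrary: f)
    (auto intro: differentiable_at_imp_differentiable_on differentiable_imp_continuous_on)

lemma Ck_on_subset: "Ck_on k S f \<Longrightarrow> T \<subseteq> S \<Longrightarrow> Ck_on k T f"
  by (induction k arbitrary: f) (auto intro: continuous_on_subset)

lemma Ck_on_const: "Ck_on k S (\<lambda>x. c)"
  by (induction k arbitrary: c) auto

lemma Ck_on_linear:
  assumes "bounded_linear L" "open S" "Ck_on k S f"
  shows "Ck_on k S (\<lambda>x. L (f x))"
  using assms(3)
proof (induction k arbitrary: f)
  case 0
  then show ?case by (simp add: bounded_linear.continuous_on[OF assms(1)])
next
  case (Suc k)
  have hd: "((\<lambda>x. L (f x)) has_derivative (\<lambda>v. L (frechet_derivative f (at x) v))) (at x)"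
    if "x \<in> S" for x
    using Suc.prems that
    by (intro bounded_linear.has_derivative[OF assms(1)]) (simp add: frechet_derivative_works)
  have "Ck_on k S (\<lambda>x. frechet_derivative (\<lambda>x. L (f x)) (at x) v)" for v
    by (rule Ck_on_cong[OF assms(2) _ Suc.IH[of "\<lambda>x. frechet_derivative f (at x) v"]])
      (use Suc.prems in \<open>auto simp: frechet_derivative_eqI[OF hd]\<close>)
  then show ?case
    using hd by (auto simp: differentiable_def)
qed

lemma Ck_on_add:
  assumes "open S" "Ck_on k S f" "Ck_on k S g"
  shows "Ck_on k S (\<lambda>x. f x + g x)"
  using assms(2,3)
proof (induction k arbitrary: f g)
  case 0
  then show ?case by (simp add: continuous_on_add)
next
  case (Suc k)
  have hd: "((\<lambda>x. f x + g x) has_derivative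
      (\<lambda>v. frechet_derivative f (at x) v + frechet_derivative g (at x) v)) (at x)"
    if "x \<in> S" for x
    using Suc.prems that by (intro has_derivative_add) (simp_all add: frechet_derivative_works)
  have "Ck_on k S (\<lambda>x. frechet_derivative (\<lambda>x. f x + g x) (at x) v)" for v
    by (rule Ck_on_cong[OF assms(1) _ Suc.IH[of "\<lambda>x. frechet_derivative f (at x) v"
            "\<lambda>x. frechet_derivative g (at x) v"]])
      (use Suc.prems in \<open>auto simp: frechet_derivative_eqI[OF hd]\<close>)
  then show ?case
    using hd by (auto simp: differentiable_def)
qed

text \<open>Each summand of the product rule pairs an undifferentiated factor with a derivative of
  the other one; \<open>Ck_on_SucD\<close> lowers the order of the former so that the induction
  hypothesis applies to both.\<close>

lemma Ck_on_bilinear: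
  assumes "bounded_bilinear b" "open S" "Ck_on k S f" "Ck_on k S g"
  shows "Ck_on k S (\<lambda>x. b (f x) (g x))"
  using assms(3,4)
proof (induction k arbitrary: f g)
  case 0
  then show ?case by (simp add: bounded_bilinear.continuous_on[OF assms(1)])
next
  case (Suc k)
  have hd: "((\<lambda>x. b (f x) (g x)) has_derivative
      (\<lambda>v. b (f x) (frechet_derivative g (at x) v) + b (frechet_derivative f (at x) v) (g x))) (at x)"
    if "x \<in> S" for x
    using Suc.prems that
    by (intro bounded_bilinear.FDERIV[OF assms(1)]) (simp_all add: frechet_derivative_works)
  have "Ck_on k S (\<lambda>x. frechet_derivative (\<lambda>x. b (f x) (g x)) (at x) v)" for v
    by (rule Ck_on_cong[OF assms(2) _ Ck_on_add[OF assms(2)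
            Suc.IH[of f "\<lambda>x. frechet_derivative g (at x) v"]
            Suc.IH[of "\<lambda>x. frechet_derivative f (at x) v" g]]])
      (use Suc.prems in \<open>auto simp: frechet_derivative_eqI[OF hd] simp del: Ck_on.simps
          intro: Ck_on_SucD, (auto)?\<close>)
  then show ?case
    using hd by (auto simp: differentiable_def)
qed

lemma Ck_on_sum:
  assumes "open S" "\<And>i. i \<in> I \<Longrightarrow> Ck_on k S (f i)"
  shows "Ck_on k S (\<lambda>x. \<Sum>i\<in>I. f i x)"
proof (cases "finite I")
  case True
  then show ?thesis
    using assms(2) by induction (auto intro!: Ck_on_add Ck_on_const assms(1))
qed (simp add: Ck_on_const)

text \<open>By the chain rule the derivative of \<open>g\<close> is taken in the moving direction
  given by the derivative of \<open>f\<close>. Basis expansion leaves products of scalar components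
  with fixed-direction derivatives of \<open>g\<close> composed with \<open>f\<close>, so the
  induction generalises \<open>g\<close> and keeps \<open>f\<close> fixed.\<close>

lemma Ck_on_compose:
  fixes f :: "'a::real_normed_vector \<Rightarrow> 'b::euclidean_space"
  assumes "open S" "open T" "f ` S \<subseteq> T" "Ck_on k T g" "Ck_on k S f"
  shows "Ck_on k S (\<lambda>x. g (f x))"
  using assms(4,5)
proof (induction k arbitrary: g)
  case 0
  then show ?case using assms(3) by (auto intro: continuous_on_compose2)
next
  case (Suc k)
  have f: "f differentiable (at x)" if "x \<in> S" for x
    using Suc.prems that by auto
  have g: "g differentiable (at (f x))" if "x \<in> S" for x
    using Suc.prems that assms(3) by auto
  have fd: "frechet_derivative (\<lambda>x. g (f x)) (at x) v =
      (\<Sum>b\<in>Basis. (frechet_derivative f (at x) v \<bullet> b) *\<^sub>R frechet_derivative g (at (f x)) b)"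
    if "x \<in> S" for x v
    using frechet_derivative_compose[OF f[OF that] g[OF that]]
    by (simp add: o_def frechet_derivative_sum_Basis[OF g[OF that], symmetric])
  have "Ck_on k S (\<lambda>x. \<Sum>b\<in>Basis.
      (frechet_derivative f (at x) v \<bullet> b) *\<^sub>R frechet_derivative g (at (f x)) b)" for v
    using Suc.prems
    by (intro Ck_on_sum Ck_on_bilinear[OF bounded_bilinear_scaleR]
        Ck_on_linear[OF bounded_linear_inner_left] Suc.IH[of "\<lambda>y. frechet_derivative g (at y) b" for b]
        Ck_on_SucD[of k S f] assms(1)) auto
  then have "Ck_on k S (\<lambda>x. frechet_derivative (\<lambda>x. g (f x)) (at x) v)" for v
    by (rule Ck_on_cong[OF assms(1), rotated]) (simp add: fd)
  moreover have "(\<lambda>x. g (f x)) differentiable (at x)" if "x \<in> S" for x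
    using differentiable_chain_at[OF f[OF that] g[OF that]] by (simp add: o_def)
  ultimately show ?case by simp
qed

text \<open>The derivative is a polynomial in the inverse itself, so each order follows from the
  preceding one by the product rule.\<close>

lemma Ck_on_inverse: "Ck_on k (- {0}) (inverse :: real \<Rightarrow> real)"
proof (induction k)
  case 0
  then show ?case by (auto intro!: continuous_intros)
next
  case (Suc k)
  have hd: "(inverse has_derivative (\<lambda>v. - (inverse x * v * inverse x))) (at x)" if "x \<noteq> 0" for x :: real
    using has_derivative_inverse'[OF that] by simp
  have "Ck_on k (- {0}) (\<lambda>x::real. - (inverse x * v * inverse x))" for v
    by (intro Ck_on_linear[OF bounded_linear_minus[OF bounded_linear_ident]]
        Ck_on_bilinear[OF bounded_bilinear_mult] Ck_on_const Suc) auto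
  then have "Ck_on k (- {0}) (\<lambda>x::real. frechet_derivative inverse (at x) v)" for v
    by (rule Ck_on_cong[rotated 2]) (auto simp: frechet_derivative_eqI[OF hd])
  then show ?case
    using hd by (auto simp: differentiable_def)
qed

section \<open>Closure properties of smooth maps\<close>

lemma smooth_on_cong:
  "open S \<Longrightarrow> smooth_on S f \<Longrightarrow> (\<And>x. x \<in> S \<Longrightarrow> f x = g x) \<Longrightarrow> smooth_on S g"
  unfolding smooth_on_def using Ck_on_cong by blast

lemma smooth_on_subset: "smooth_on S f \<Longrightarrow> T \<subseteq> S \<Longrightarrow> smooth_on T f"
  unfolding smooth_on_def using Ck_on_subset by blast

lemma smooth_on_differentiable: "smooth_on S f \<Longrightarrow> x \<in> S \<Longrightarrow> f differentiable (at x)"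
  unfolding smooth_on_def by (metis Ck_on.simps(2))

lemma smooth_on_has_derivative:
  "smooth_on S f \<Longrightarrow> x \<in> S \<Longrightarrow> (f has_derivative frechet_derivative f (at x)) (at x)"
  using smooth_on_differentiable frechet_derivative_works by blast

lemma smooth_on_frechet_derivative:
  "smooth_on S f \<Longrightarrow> smooth_on S (\<lambda>x. frechet_derivative f (at x) v)"
  unfolding smooth_on_def by (metis Ck_on.simps(2))

lemma smooth_on_const: "smooth_on S (\<lambda>x. c)"
  by (simp add: smooth_on_def Ck_on_const)

lemma smooth_on_linear:
  "bounded_linear L \<Longrightarrow> open S \<Longrightarrow> smooth_on S f \<Longrightarrow> smooth_on S (\<lambda>x. L (f x))"
  by (simp add: smooth_on_def Ck_on_linear)

lemma smooth_on_ident: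
  assumes "open S"
  shows "smooth_on S (\<lambda>x. x)"
  unfolding smooth_on_def
proof
  fix k show "Ck_on k S (\<lambda>x. x)"
    by (cases k) (auto simp: Ck_on_const)
qed

lemma smooth_on_bounded_linear: "bounded_linear L \<Longrightarrow> open S \<Longrightarrow> smooth_on S L"
  using smooth_on_linear[OF _ _ smooth_on_ident] by blast

lemma smooth_on_add:
  "open S \<Longrightarrow> smooth_on S f \<Longrightarrow> smooth_on S g \<Longrightarrow> smooth_on S (\<lambda>x. f x + g x)"
  by (simp add: smooth_on_def Ck_on_add)

lemma smooth_on_minus: "open S \<Longrightarrow> smooth_on S f \<Longrightarrow> smooth_on S (\<lambda>x. - f x)"
  by (rule smooth_on_linear[OF bounded_linear_minus[OF bounded_linear_ident]])

lemma smooth_on_diff: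
  "open S \<Longrightarrow> smooth_on S f \<Longrightarrow> smooth_on S g \<Longrightarrow> smooth_on S (\<lambda>x. f x - g x)"
  using smooth_on_add[OF _ _ smooth_on_minus] by fastforce

lemma smooth_on_sum:
  "open S \<Longrightarrow> (\<And>i. i \<in> I \<Longrightarrow> smooth_on S (f i)) \<Longrightarrow> smooth_on S (\<lambda>x. \<Sum>i\<in>I. f i x)"
  by (simp add: smooth_on_def Ck_on_sum)

lemma smooth_on_scaleR:
  "open S \<Longrightarrow> smooth_on S f \<Longrightarrow> smooth_on S g \<Longrightarrow> smooth_on S (\<lambda>x. f x *\<^sub>R g x)"
  by (simp add: smooth_on_def Ck_on_bilinear[OF bounded_bilinear_scaleR])

lemma smooth_on_mult:
  fixes f g :: "_ \<Rightarrow> real"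
  shows "open S \<Longrightarrow> smooth_on S f \<Longrightarrow> smooth_on S g \<Longrightarrow> smooth_on S (\<lambda>x. f x * g x)"
  by (simp add: smooth_on_def Ck_on_bilinear[OF bounded_bilinear_mult])

lemma smooth_on_prod:
  fixes f :: "_ \<Rightarrow> _ \<Rightarrow> real"
  assumes "open S" "\<And>i. i \<in> I \<Longrightarrow> smooth_on S (f i)"
  shows "smooth_on S (\<lambda>x. \<Prod>i\<in>I. f i x)"
proof (cases "finite I")
  case True
  then show ?thesis
    using assms(2) by induction (auto intro!: smooth_on_mult smooth_on_const assms(1))
qed (simp add: smooth_on_const)

lemma smooth_on_compose:
  fixes f :: "'a::real_normed_vector \<Rightarrow> 'b::euclidean_space"
  assumes "open S" "open T" "f ` S \<subseteq> T" "smooth_on T g" "smooth_on S f"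
  shows "smooth_on S (\<lambda>x. g (f x))"
  using assms Ck_on_compose unfolding smooth_on_def by blast

lemma smooth_on_divide:
  fixes f g :: "_ \<Rightarrow> real"
  assumes "open S" "smooth_on S f" "smooth_on S g" "\<And>x. x \<in> S \<Longrightarrow> g x \<noteq> 0"
  shows "smooth_on S (\<lambda>x. f x / g x)"
proof -
  have "smooth_on S (\<lambda>x. inverse (g x))"
    by (rule smooth_on_compose[where T = "- {0}"]) (use assms in \<open>auto simp: smooth_on_def Ck_on_inverse\<close>)
  then show ?thesis
    using smooth_on_mult[OF assms(1,2)] by (simp add: divide_inverse)
qed

lemma smooth_on_Pair:
  assumes "open S" "smooth_on S f" "smooth_on S g"
  shows "smooth_on S (\<lambda>x. (f x, g x))"
proof -
  have "smooth_on S (\<lambda>x. (f x, 0) + (0, g x))"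
    by (intro smooth_on_add smooth_on_linear[OF _ assms(1,2)] smooth_on_linear[OF _ assms(1,3)]
        assms(1) bounded_linear_Pair bounded_linear_ident bounded_linear_zero)
  then show ?thesis by simp
qed

lemma smooth_on_frechet_apply:
  fixes f :: "'a::euclidean_space \<Rightarrow> 'b::real_normed_vector"
  assumes "open S" "smooth_on S f" "smooth_on S w"
  shows "smooth_on S (\<lambda>x. frechet_derivative f (at x) (w x))"
proof -
  have "smooth_on S (\<lambda>x. \<Sum>b\<in>Basis. (w x \<bullet> b) *\<^sub>R frechet_derivative f (at x) b)"
    by (intro smooth_on_sum smooth_on_scaleR smooth_on_linear[OF bounded_linear_inner_left]
        smooth_on_frechet_derivative assms)
  then show ?thesis
    by (rule smooth_on_cong[OF assms(1)])
      (simp add: frechet_derivative_sum_Basis[OF smooth_on_differentiable[OF assms(2)], symmetric])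
qed

section \<open>Smooth dependence of determinants and inverse matrices\<close>

lemma smooth_on_det:
  fixes A :: "_ \<Rightarrow> real^'n^'n"
  assumes "open S" "\<And>i j. smooth_on S (\<lambda>x. A x $ i $ j)"
  shows "smooth_on S (\<lambda>x. det (A x))"
  unfolding det_def
  by (intro smooth_on_sum smooth_on_mult smooth_on_prod smooth_on_const assms)

lemma matrix_mult_matrix_inv: "invertible A \<Longrightarrow> A ** matrix_inv A = mat 1"
  unfolding invertible_def matrix_inv_def by (rule someI2_ex) auto

text \<open>Column \<open>l\<close> of the inverse solves the linear system with right side e_l, so
  Cramer's rule writes each entry as a quotient of determinants, which are polynomials in the
  entries. This gives the smoothness of g^kl.\<close>

lemma smooth_on_matrix_inv:
  fixes A :: "_ \<Rightarrow> real^'n^'n"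
  assumes S: "open S" and A: "\<And>i j. smooth_on S (\<lambda>x. A x $ i $ j)"
    and inv: "\<And>x. x \<in> S \<Longrightarrow> invertible (A x)"
  shows "smooth_on S (\<lambda>x. matrix_inv (A x) $ k $ l)"
proof -
  have "smooth_on S (\<lambda>x. det (\<chi> i j. if j = k then axis l 1 $ i else A x $ i $ j) / det (A x))"
  proof (intro smooth_on_divide smooth_on_det S)
    show "smooth_on S (\<lambda>x. (\<chi> i j. if j = k then axis l 1 $ i else A x $ i $ j) $ i $ j)" for i j
      by (cases "j = k") (simp_all add: A smooth_on_const)
  qed (use A inv invertible_det_nz in auto)
  moreover have "det (\<chi> i j. if j = k then axis l 1 $ i else A x $ i $ j) / det (A x) =
      matrix_inv (A x) $ k $ l" if x: "x \<in> S" for x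
  proof -
    have "A x *v (matrix_inv (A x) *v axis l 1) = axis l 1"
      using inv[OF x] by (simp add: matrix_vector_mul_assoc matrix_mult_matrix_inv)
    then have "matrix_inv (A x) *v axis l 1 =
        (\<chi> k. det (\<chi> i j. if j = k then axis l 1 $ i else A x $ i $ j) / det (A x))"
      using cramer[of "A x"] inv[OF x] invertible_det_nz by blast
    then show ?thesis
      by (simp add: vec_eq_iff matrix_vector_mult_basis column_def)
  qed
  ultimately show ?thesis
    by (rule smooth_on_cong[OF S])
qed

text \<open>Two applications of the mean value theorem: first to the increment in direction
  \<open>w\<close>, viewed as a function of the step along \<open>v\<close>, then, along
  \<open>w\<close>, to the difference of derivatives that results.\<close>

lemma second_difference_mean_value:
  fixes f :: "'a::real_normed_vector \<Rightarrow> real"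
  assumes f: "\<And>y. y \<in> ball x r \<Longrightarrow> f differentiable (at y)"
    and f': "\<And>y. y \<in> ball x r \<Longrightarrow> (\<lambda>y. frechet_derivative f (at y) v) differentiable (at y)"
    and h: "h > 0" "h * (norm v + norm w) < r"
  shows "\<exists>y\<in>ball x r. f (x + h *\<^sub>R v + h *\<^sub>R w) - f (x + h *\<^sub>R v) - f (x + h *\<^sub>R w) + f x =
     h\<^sup>2 * frechet_derivative (\<lambda>y. frechet_derivative f (at y) v) (at y) w"
proof -
  have ball: "x + s *\<^sub>R v + t *\<^sub>R w \<in> ball x r" if "0 \<le> s" "s \<le> h" "0 \<le> t" "t \<le> h" for s t
  proof -
    have "norm (s *\<^sub>R v + t *\<^sub>R w) \<le> s * norm v + t * norm w"
      using that by (intro order.trans[OF norm_triangle_ineq]) simp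
    also have "\<dots> \<le> h * norm v + h * norm w"
      using that by (intro add_mono mult_right_mono) auto
    finally have "norm (s *\<^sub>R v + t *\<^sub>R w) < r"
      using h(2) by (simp add: algebra_simps)
    then show ?thesis
      by (simp add: dist_norm norm_minus_commute algebra_simps)
  qed
  \<comment> \<open>The summand \<open>0 *\<^sub>R w\<close> is kept so that both terms are
    instances of \<open>along\<close>, for t = h and for t = 0.\<close>
  define g where "g s = f (x + s *\<^sub>R v + h *\<^sub>R w) - f (x + s *\<^sub>R v + 0 *\<^sub>R w)" for s
  have along: "((\<lambda>s. f (x + s *\<^sub>R v + t *\<^sub>R w)) has_real_derivative
      frechet_derivative f (at (x + s *\<^sub>R v + t *\<^sub>R w)) v) (at s)"
    if "0 \<le> s" "s \<le> h" "0 \<le> t" "t \<le> h" for s t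
  proof -
    note fx = f[OF ball[OF that]]
    have "((\<lambda>s. f (x + s *\<^sub>R v + t *\<^sub>R w)) has_derivative
      (\<lambda>d. frechet_derivative f (at (x + s *\<^sub>R v + t *\<^sub>R w)) (d *\<^sub>R v))) (at s)"
      by (rule has_derivative_compose[where f = "\<lambda>s. x + s *\<^sub>R v + t *\<^sub>R w",
            OF _ fx[unfolded frechet_derivative_works]])
        (auto intro!: derivative_eq_intros)
    then show ?thesis
      by (simp add: has_field_derivative_def linear_cmul[OF linear_frechet_derivative[OF fx]]
          mult.commute[of _ "frechet_derivative f _ v"] mult_commute_abs)
  qed
  obtain s where s: "0 < s" "s < h" and gs: "g h - g 0 = (h - 0) *
      (frechet_derivative f (at (x + s *\<^sub>R v + h *\<^sub>R w)) v -
       frechet_derivative f (at (x + s *\<^sub>R v + 0 *\<^sub>R w)) v)"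
  proof -
    have "\<exists>s>0. s < h \<and> g h - g 0 = (h - 0) *
      (frechet_derivative f (at (x + s *\<^sub>R v + h *\<^sub>R w)) v -
       frechet_derivative f (at (x + s *\<^sub>R v + 0 *\<^sub>R w)) v)"
      unfolding g_def using h(1) by (intro MVT2 DERIV_diff along) auto
    then show ?thesis using that by blast
  qed
  have along2: "((\<lambda>t. frechet_derivative f (at (x + s *\<^sub>R v + t *\<^sub>R w)) v) has_real_derivative
      frechet_derivative (\<lambda>y. frechet_derivative f (at y) v) (at (x + s *\<^sub>R v + t *\<^sub>R w)) w) (at t)"
    if "0 \<le> t" "t \<le> h" for t
  proof -
    have "0 \<le> s" "s \<le> h" using s by auto
    note fx = f'[OF ball[OF this that]]
    have "((\<lambda>t. frechet_derivative f (at (x + s *\<^sub>R v + t *\<^sub>R w)) v) has_derivative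
      (\<lambda>d. frechet_derivative (\<lambda>y. frechet_derivative f (at y) v) (at (x + s *\<^sub>R v + t *\<^sub>R w)) (d *\<^sub>R w))) (at t)"
      by (rule has_derivative_compose[where f = "\<lambda>t. x + s *\<^sub>R v + t *\<^sub>R w",
            OF _ fx[unfolded frechet_derivative_works]])
        (auto intro!: derivative_eq_intros)
    then show ?thesis
      by (simp add: has_field_derivative_def linear_cmul[OF linear_frechet_derivative[OF fx]]
          mult_commute_abs)
  qed
  have "\<exists>t>0. t < h \<and> frechet_derivative f (at (x + s *\<^sub>R v + h *\<^sub>R w)) v -
       frechet_derivative f (at (x + s *\<^sub>R v + 0 *\<^sub>R w)) v = (h - 0) *
       frechet_derivative (\<lambda>y. frechet_derivative f (at y) v) (at (x + s *\<^sub>R v + t *\<^sub>R w)) w"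
    using h(1) by (intro MVT2 along2) auto
  then obtain t where t: "0 < t" "t < h" and ht: "frechet_derivative f (at (x + s *\<^sub>R v + h *\<^sub>R w)) v -
       frechet_derivative f (at (x + s *\<^sub>R v + 0 *\<^sub>R w)) v = h *
       frechet_derivative (\<lambda>y. frechet_derivative f (at y) v) (at (x + s *\<^sub>R v + t *\<^sub>R w)) w"
    by auto
  show ?thesis
  proof
    show "x + s *\<^sub>R v + t *\<^sub>R w \<in> ball x r"
      using s t by (intro ball) auto
    have "f (x + h *\<^sub>R v + h *\<^sub>R w) - f (x + h *\<^sub>R v) - f (x + h *\<^sub>R w) + f x = g h - g 0"
      by (simp add: g_def)
    also note gs
    also note ht
    finally show "f (x + h *\<^sub>R v + h *\<^sub>R w) - f (x + h *\<^sub>R v) - f (x + h *\<^sub>R w) + f x =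
       h\<^sup>2 * frechet_derivative (\<lambda>y. frechet_derivative f (at y) v) (at (x + s *\<^sub>R v + t *\<^sub>R w)) w"
      by (simp add: power2_eq_square)
  qed
qed

text \<open>The second difference is symmetric in \<open>v\<close> and \<open>w\<close>, so a value
  of one mixed derivative near \<open>x\<close> equals a value of the other one near
  \<open>x\<close>; continuity of both at \<open>x\<close> finishes the argument.\<close>

lemma second_derivative_symmetric_real:
  fixes f :: "'a::real_normed_vector \<Rightarrow> real"
  assumes S: "open S" "x \<in> S" and f: "smooth_on S f"
  shows "frechet_derivative (\<lambda>y. frechet_derivative f (at y) v) (at x) w =
         frechet_derivative (\<lambda>y. frechet_derivative f (at y) w) (at x) v"
proof -
  define P where "P y = frechet_derivative (\<lambda>y. frechet_derivative f (at y) v) (at y) w" for y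
  define Q where "Q y = frechet_derivative (\<lambda>y. frechet_derivative f (at y) w) (at y) v" for y
  have sm: "smooth_on S (\<lambda>y. frechet_derivative f (at y) u)" for u
    by (intro smooth_on_frechet_derivative f)
  have "isCont P x" "isCont Q x"
    unfolding P_def Q_def
    by (intro differentiable_imp_continuous_within smooth_on_differentiable[OF _ S(2)]
        smooth_on_frechet_derivative f)+
  have "\<bar>P x - Q x\<bar> < 2 * e" if e: "e > 0" for e
  proof -
    obtain d1 d2 where d: "d1 > 0" "\<And>y. dist y x < d1 \<Longrightarrow> dist (P y) (P x) < e"
      "d2 > 0" "\<And>y. dist y x < d2 \<Longrightarrow> dist (Q y) (Q x) < e"
      using \<open>isCont P x\<close> \<open>isCont Q x\<close> e unfolding continuous_at_eps_delta by metis
    obtain d3 where d3: "d3 > 0" "ball x d3 \<subseteq> S"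
      using S open_contains_ball by metis
    define r where "r = min d1 (min d2 d3)"
    have r: "r > 0" "ball x r \<subseteq> S"
      using d d3 by (auto simp: r_def)
    \<comment> \<open>The 1 in the denominator keeps it positive when \<open>v\<close> and
      \<open>w\<close> both vanish, and makes the bound by \<open>r\<close> strict.\<close>
    define h where "h = r / (norm v + norm w + 1)"
    have pos: "norm v + norm w + 1 > 0"
      by (smt (verit) norm_ge_zero)
    have h: "h > 0" "h * (norm v + norm w) < r"
      using r(1) pos by (auto simp: h_def field_simps)
    have fd: "f differentiable (at y)"
      "(\<lambda>y. frechet_derivative f (at y) u) differentiable (at y)" if "y \<in> ball x r" for y u
      using that r(2) by (auto intro!: smooth_on_differentiable[OF f] smooth_on_differentiable[OF sm])
    obtain y where y: "y \<in> ball x r" and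
      1: "f (x + h *\<^sub>R v + h *\<^sub>R w) - f (x + h *\<^sub>R v) - f (x + h *\<^sub>R w) + f x = h\<^sup>2 * P y"
      using second_difference_mean_value[OF fd h] unfolding P_def by blast
    have h': "h * (norm w + norm v) < r" using h(2) by (simp add: add.commute)
    obtain z where z: "z \<in> ball x r" and
      2: "f (x + h *\<^sub>R w + h *\<^sub>R v) - f (x + h *\<^sub>R w) - f (x + h *\<^sub>R v) + f x = h\<^sup>2 * Q z"
      using second_difference_mean_value[OF fd h(1) h'] unfolding Q_def by blast
    have "x + h *\<^sub>R w + h *\<^sub>R v = x + h *\<^sub>R v + h *\<^sub>R w"
      by simp
    then have "h\<^sup>2 * P y = h\<^sup>2 * Q z"
      using 1 2 by (simp only:)
    then have "P y = Q z"
      using h(1) by simp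
    moreover have "\<bar>P y - P x\<bar> < e" "\<bar>Q z - Q x\<bar> < e"
      using d(2)[of y] d(4)[of z] y z by (auto simp: r_def dist_commute dist_real_def)
    ultimately show ?thesis by linarith
  qed
  \<comment> \<open>With half the distance as \<open>e\<close>, distinct values would have a
    distance smaller than itself.\<close>
  from this[of "\<bar>P x - Q x\<bar> / 2"] have "P x = Q x"
    by (cases "P x = Q x") auto
  then show ?thesis
    by (simp add: P_def Q_def)
qed

lemma second_derivative_symmetric:
  fixes f :: "'a::real_normed_vector \<Rightarrow> 'b::euclidean_space"
  assumes S: "open S" "x \<in> S" and f: "smooth_on S f"
  shows "frechet_derivative (\<lambda>y. frechet_derivative f (at y) v) (at x) w =
         frechet_derivative (\<lambda>y. frechet_derivative f (at y) w) (at x) v"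
proof (rule euclidean_eqI)
  fix b :: 'b
  have comp: "frechet_derivative (\<lambda>y. frechet_derivative f (at y) u \<bullet> b) (at x) u' =
     frechet_derivative (\<lambda>y. frechet_derivative (\<lambda>y. f y \<bullet> b) (at y) u) (at x) u'" for u u'
  proof -
    have inner: "frechet_derivative (\<lambda>y. f y \<bullet> b) (at y) = (\<lambda>u. frechet_derivative f (at y) u \<bullet> b)"
      if "y \<in> S" for y
      by (rule frechet_derivative_eqI)
        (intro has_derivative_inner_left smooth_on_has_derivative[OF f that])
    show ?thesis
      by (rule arg_cong[where f = "\<lambda>g. g u'"], rule frechet_derivative_transform_within_open[OF _ S])
        (auto simp: inner intro!: smooth_on_differentiable[OF _ S(2)]
          smooth_on_linear[OF bounded_linear_inner_left] smooth_on_frechet_derivative f S)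
  qed
  have outer: "frechet_derivative (\<lambda>y. frechet_derivative f (at y) u \<bullet> b) (at x) u' =
      frechet_derivative (\<lambda>y. frechet_derivative f (at y) u) (at x) u' \<bullet> b" for u u'
    by (rule arg_cong[where f = "\<lambda>g. g u'"], rule frechet_derivative_eqI)
      (intro has_derivative_inner_left smooth_on_has_derivative[OF _ S(2)]
        smooth_on_frechet_derivative f)
  have "smooth_on S (\<lambda>y. f y \<bullet> b)"
    by (intro smooth_on_linear[OF bounded_linear_inner_left] S f)
  from second_derivative_symmetric_real[OF S this, of v w]
  show "frechet_derivative (\<lambda>y. frechet_derivative f (at y) v) (at x) w \<bullet> b =
        frechet_derivative (\<lambda>y. frechet_derivative f (at y) w) (at x) v \<bullet> b"
    by (simp add: comp[symmetric] outer)
qed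

text \<open>The product rule first yields the derivative along \<open>d\<close> of the derivative of
  \<open>f\<close> in a basis direction. Symmetry of second derivatives exchanges the two
  directions, so that \<open>d\<close> becomes the inner one and \<open>w x\<close> the outer
  one.\<close>

lemma has_derivative_frechet_apply:
  fixes f :: "'a::euclidean_space \<Rightarrow> 'b::euclidean_space"
  assumes S: "open S" "x \<in> S" and f: "smooth_on S f" and w: "(w has_derivative w') (at x)"
  shows "((\<lambda>u. frechet_derivative f (at u) (w u)) has_derivative
    (\<lambda>d. frechet_derivative f (at x) (w' d) +
      frechet_derivative (\<lambda>u. frechet_derivative f (at u) d) (at x) (w x))) (at x)"
proof -
  have "((\<lambda>u. \<Sum>b\<in>Basis. (w u \<bullet> b) *\<^sub>R frechet_derivative f (at u) b) has_derivative
     (\<lambda>d. \<Sum>b\<in>Basis. (w x \<bullet> b) *\<^sub>R frechet_derivative (\<lambda>u. frechet_derivative f (at u) b) (at x) d +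
        (w' d \<bullet> b) *\<^sub>R frechet_derivative f (at x) b)) (at x)"
    by (intro has_derivative_sum has_derivative_scaleR has_derivative_inner_left w
        smooth_on_has_derivative[OF smooth_on_frechet_derivative[OF f] S(2)])
  then have 1: "((\<lambda>u. frechet_derivative f (at u) (w u)) has_derivative
     (\<lambda>d. \<Sum>b\<in>Basis. (w x \<bullet> b) *\<^sub>R frechet_derivative (\<lambda>u. frechet_derivative f (at u) b) (at x) d +
        (w' d \<bullet> b) *\<^sub>R frechet_derivative f (at x) b)) (at x)"
    by (rule has_derivative_transform_within_open[OF _ S])
      (rule frechet_derivative_sum_Basis[symmetric, OF smooth_on_differentiable[OF f]])
  have 2: "(\<Sum>b\<in>Basis. (w x \<bullet> b) *\<^sub>R frechet_derivative (\<lambda>u. frechet_derivative f (at u) b) (at x) d) =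
      frechet_derivative (\<lambda>u. frechet_derivative f (at u) d) (at x) (w x)" for d
    unfolding frechet_derivative_sum_Basis[OF
        smooth_on_differentiable[OF smooth_on_frechet_derivative[OF f] S(2)], of d "w x"]
    by (simp only: second_derivative_symmetric[OF S f, of _ d])
  show ?thesis
    using 1 unfolding sum.distrib 2
      frechet_derivative_sum_Basis[OF smooth_on_differentiable[OF f S(2)], symmetric]
    by (simp add: add.commute)
qed

section \<open>Atlases, tangent vectors and connections\<close>

text \<open>Collects the chart conditions of \<open>smooth_manifold\<close>. The same locale is
  interpreted for \<open>M\<close> and for its slit tangent bundle.\<close>

locale smooth_atlas =
  fixes A :: "('i, 'p, 'e::euclidean_space) atlas"
  assumes inj_chart: "i \<in> chart_ind A \<Longrightarrow> inj_on (chart_map A i) (chart_dom A i)"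
    and open_chart: "i \<in> chart_ind A \<Longrightarrow> open (chart_map A i ` chart_dom A i)"
    and open_overlap: "i \<in> chart_ind A \<Longrightarrow> j \<in> chart_ind A \<Longrightarrow>
      open (chart_map A i ` (chart_dom A i \<inter> chart_dom A j))"
    and smooth_transition: "i \<in> chart_ind A \<Longrightarrow> j \<in> chart_ind A \<Longrightarrow>
      smooth_on (chart_map A i ` (chart_dom A i \<inter> chart_dom A j)) (transition A i j)"

lemma smooth_manifold_smooth_atlas: "smooth_manifold A \<Longrightarrow> smooth_atlas A"
  unfolding smooth_manifold_def by (intro smooth_atlas.intro) simp_all

text \<open>Tangent vectors are families over chart indices, so the linear structure of a fibre is
  written out index by index.\<close>

definition fibre_subspace :: "('i \<Rightarrow> 'e::real_vector) set \<Rightarrow> bool" where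
  "fibre_subspace S \<longleftrightarrow> (\<lambda>_. 0) \<in> S \<and> (\<forall>u\<in>S. \<forall>v\<in>S. (\<lambda>i. u i + v i) \<in> S) \<and>
     (\<forall>c. \<forall>u\<in>S. (\<lambda>i. c *\<^sub>R u i) \<in> S)"

lemma fibre_subspaceD:
  assumes "fibre_subspace S"
  shows fibre_subspace_0: "(\<lambda>_. 0) \<in> S"
    and fibre_subspace_add: "u \<in> S \<Longrightarrow> v \<in> S \<Longrightarrow> (\<lambda>i. u i + v i) \<in> S"
    and fibre_subspace_scale: "u \<in> S \<Longrightarrow> (\<lambda>i. c *\<^sub>R u i) \<in> S"
  using assms unfolding fibre_subspace_def by blast+

lemma fibre_subspace_diff:
  assumes "fibre_subspace S" "u \<in> S" "v \<in> S"
  shows "(\<lambda>i. u i - v i) \<in> S"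
  using fibre_subspace_add[OF assms(1,2) fibre_subspace_scale[OF assms(1,3), of "-1"]] by simp

lemma fibre_subspace_sum:
  assumes "fibre_subspace S" "\<And>k. k \<in> I \<Longrightarrow> f k \<in> S"
  shows "(\<lambda>i. \<Sum>k\<in>I. f k i) \<in> S"
proof (cases "finite I")
  case True
  then show ?thesis using assms(2)
    by induction (auto intro: fibre_subspace_0[OF assms(1)] fibre_subspace_add[OF assms(1)])
qed (simp add: fibre_subspace_0[OF assms(1)])

lemma fibre_subspace_linear_combination:
  assumes "fibre_subspace S" "\<And>k. k \<in> I \<Longrightarrow> f k \<in> S"
  shows "(\<lambda>i. \<Sum>k\<in>I. a k *\<^sub>R f k i) \<in> S"
  by (intro fibre_subspace_sum fibre_subspace_scale assms)

lemma dist_sumI: "a \<in> E p \<Longrightarrow> b \<in> K p \<Longrightarrow> (\<lambda>i. a i + b i) \<in> dist_sum E K p"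
  unfolding dist_sum_def by blast

lemma fibre_subspace_dist_sum:
  assumes E: "fibre_subspace (E p)" and K: "fibre_subspace (K p)"
  shows "fibre_subspace (dist_sum E K p)"
  unfolding fibre_subspace_def
proof (intro conjI ballI allI)
  show "(\<lambda>_. 0) \<in> dist_sum E K p"
    using dist_sumI[of "\<lambda>_. 0" E p "\<lambda>_. 0" K, OF fibre_subspace_0[OF E] fibre_subspace_0[OF K]]
    by simp
next
  fix u v assume "u \<in> dist_sum E K p" "v \<in> dist_sum E K p"
  then obtain a b c d where u: "u = (\<lambda>i. a i + b i)" "a \<in> E p" "b \<in> K p"
    and v: "v = (\<lambda>i. c i + d i)" "c \<in> E p" "d \<in> K p"
    unfolding dist_sum_def by blast
  show "(\<lambda>i. u i + v i) \<in> dist_sum E K p"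
    using dist_sumI[of "\<lambda>i. a i + c i" E p "\<lambda>i. b i + d i" K]
      fibre_subspace_add[OF E u(2) v(2)] fibre_subspace_add[OF K u(3) v(3)]
    by (simp add: u(1) v(1) algebra_simps)
next
  fix r u assume "u \<in> dist_sum E K p"
  then obtain a b where u: "u = (\<lambda>i. a i + b i)" "a \<in> E p" "b \<in> K p"
    unfolding dist_sum_def by blast
  show "(\<lambda>i. r *\<^sub>R u i) \<in> dist_sum E K p"
    using dist_sumI[of "\<lambda>i. r *\<^sub>R a i" E p "\<lambda>i. r *\<^sub>R b i" K,
        OF fibre_subspace_scale[OF E u(2)] fibre_subspace_scale[OF K u(3)]]
    by (simp add: u(1) scaleR_add_right)
qed

text \<open>The trivial intersection makes the description in \<open>proj\<close> unique. All
  equations between a covariant derivative and a projected bracket are reduced to the two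
  memberships \<open>u\<close>.\<close>

lemma proj_eqI:
  assumes E: "fibre_subspace (E p)" and K: "fibre_subspace (K p)"
    and EK: "E p \<inter> K p \<subseteq> {\<lambda>_. 0}"
    and u: "u \<in> E p" "(\<lambda>i. X p i - u i) \<in> K p"
  shows "proj E K X p = u"
  unfolding proj_def
proof (rule the_equality)
  fix v assume v: "v \<in> E p \<and> (\<lambda>i. X p i - v i) \<in> K p"
  have "(\<lambda>i. (X p i - u i) - (X p i - v i)) \<in> K p"
    by (rule fibre_subspace_diff[OF K u(2) conjunct2[OF v]])
  moreover have "(\<lambda>i. v i - u i) \<in> E p"
    by (rule fibre_subspace_diff[OF E conjunct1[OF v] u(1)])
  ultimately have "(\<lambda>i. v i - u i) = (\<lambda>_. 0)"
    using EK by auto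
  then show "v = u"
    by (simp add: fun_eq_iff)
qed (use u in blast)

lemma sections_mono: "(\<And>p. p \<in> W \<Longrightarrow> E p \<subseteq> K p) \<Longrightarrow> sections A E W \<subseteq> sections A K W"
  unfolding sections_def by blast

lemma sectionsI:
  "vector_field A W X \<Longrightarrow> (\<And>p. p \<in> W \<Longrightarrow> X p \<in> E p) \<Longrightarrow> X \<in> sections A E W"
  by (simp add: sections_def)

lemma sectionsD:
  assumes "X \<in> sections A E W"
  shows sections_vector_field: "vector_field A W X" and sections_mem: "p \<in> W \<Longrightarrow> X p \<in> E p"
  using assms unfolding sections_def by blast+

lemma vector_field_tangent: "vector_field A W X \<Longrightarrow> p \<in> W \<Longrightarrow> X p \<in> tangent_space A p"
  unfolding vector_field_def by blast

lemma vector_field_smooth: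
  "vector_field A W X \<Longrightarrow> i \<in> chart_ind A \<Longrightarrow>
    smooth_on (chart_map A i ` (W \<inter> chart_dom A i)) (\<lambda>u. X (chart_inv A i u) i)"
  unfolding vector_field_def by blast

lemma vector_fieldI:
  "(\<And>p. p \<in> W \<Longrightarrow> X p \<in> tangent_space A p) \<Longrightarrow>
   (\<And>i. i \<in> chart_ind A \<Longrightarrow>
      smooth_on (chart_map A i ` (W \<inter> chart_dom A i)) (\<lambda>u. X (chart_inv A i u) i)) \<Longrightarrow>
   vector_field A W X"
  unfolding vector_field_def by blast

lemma smooth_fun_smooth:
  "smooth_fun A W f \<Longrightarrow> i \<in> chart_ind A \<Longrightarrow>
    smooth_on (chart_map A i ` (W \<inter> chart_dom A i)) (\<lambda>u. f (chart_inv A i u))"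
  unfolding smooth_fun_def o_def by blast

lemma sections_tangent_space: "sections A (tangent_space A) W = {X. vector_field A W X}"
proof (intro equalityI subsetI CollectI)
  show "vector_field A W X" if "X \<in> sections A (tangent_space A) W" for X
    by (rule sections_vector_field[OF that])
  show "X \<in> sections A (tangent_space A) W" if "X \<in> {X. vector_field A W X}" for X
    by (rule sectionsI) (use that in \<open>simp_all add: vector_field_tangent\<close>)
qed

lemma charts_at_iff: "i \<in> charts_at A p \<longleftrightarrow> i \<in> chart_ind A \<and> p \<in> chart_dom A i"
  by (auto simp: charts_at_def)

section \<open>Coordinate changes and tangent vectors\<close>

context smooth_atlas
begin

abbreviation jac :: "'i \<Rightarrow> 'i \<Rightarrow> 'p \<Rightarrow> 'e \<Rightarrow> 'e" where
  "jac i j p \<equiv> frechet_derivative (transition A i j) (at (chart_map A i p))"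

lemma chart_inv_chart_map: "i \<in> charts_at A p \<Longrightarrow> chart_inv A i (chart_map A i p) = p"
  by (auto simp: chart_inv_def charts_at_iff inj_chart)

lemma transition_chart_map: "i \<in> charts_at A p \<Longrightarrow> transition A i j (chart_map A i p) = chart_map A j p"
  by (simp add: transition_def chart_inv_chart_map)

lemma transition_differentiable:
  assumes "i \<in> charts_at A p" "j \<in> charts_at A p"
  shows "transition A i j differentiable (at (chart_map A i p))"
  using assms smooth_transition[of i j]
  by (intro smooth_on_differentiable[of "chart_map A i ` (chart_dom A i \<inter> chart_dom A j)"])
    (auto simp: charts_at_iff)

lemma linear_jac: "i \<in> charts_at A p \<Longrightarrow> j \<in> charts_at A p \<Longrightarrow> linear (jac i j p)"
  by (intro linear_frechet_derivative transition_differentiable)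

lemma chart_image_Int:
  assumes "i \<in> chart_ind A"
  shows "chart_map A i ` (U \<inter> V \<inter> chart_dom A i) =
    chart_map A i ` (U \<inter> chart_dom A i) \<inter> chart_map A i ` (V \<inter> chart_dom A i)"
proof -
  have "U \<inter> V \<inter> chart_dom A i = (U \<inter> chart_dom A i) \<inter> (V \<inter> chart_dom A i)"
    by blast
  then show ?thesis
    using inj_on_image_Int[OF inj_chart[OF assms], of "U \<inter> chart_dom A i" "V \<inter> chart_dom A i"]
    by simp
qed

lemma atlas_open_chart_image:
  "atlas_open A W \<Longrightarrow> i \<in> chart_ind A \<Longrightarrow> open (chart_map A i ` (W \<inter> chart_dom A i))"
  by (simp add: atlas_open_def)

lemma atlas_open_chart_dom: "i \<in> chart_ind A \<Longrightarrow> atlas_open A (chart_dom A i)"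
  by (auto simp: atlas_open_def points_def Int_commute open_overlap)

lemma atlas_open_Int:
  assumes "atlas_open A U" "atlas_open A V"
  shows "atlas_open A (U \<inter> V)"
  using assms unfolding atlas_open_def by (auto simp: chart_image_Int)

lemma atlas_open_charts_at:
  assumes "atlas_open A W" "p \<in> W"
  obtains i where "i \<in> charts_at A p"
  using assms by (auto simp: atlas_open_def points_def charts_at_iff)

text \<open>Chain rule for coordinate changes, whose composition law holds on the open triple
  overlap.\<close>

lemma jac_cocycle:
  assumes p: "i \<in> charts_at A p" "j \<in> charts_at A p" "k \<in> charts_at A p"
  shows "jac j k p (jac i j p w) = jac i k p w"
proof -
  let ?S = "chart_map A i ` (chart_dom A j \<inter> chart_dom A k \<inter> chart_dom A i)"
  have "open ?S"
    using p by (intro atlas_open_chart_image atlas_open_Int atlas_open_chart_dom)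
      (auto simp: charts_at_iff)
  moreover have "(transition A j k \<circ> transition A i j) u = transition A i k u" if "u \<in> ?S" for u
  proof -
    obtain q where q: "u = chart_map A i q" "q \<in> chart_dom A j \<inter> chart_dom A k \<inter> chart_dom A i"
      using \<open>u \<in> ?S\<close> by blast
    then have "i \<in> charts_at A q" "j \<in> charts_at A q"
      using p by (auto simp: charts_at_iff)
    then show ?thesis
      by (simp add: q(1) transition_chart_map)
  qed
  ultimately have "jac i k p = frechet_derivative (transition A j k \<circ> transition A i j) (at (chart_map A i p))"
    using p by (intro frechet_derivative_transform_within_open[of _ _ ?S])
      (auto simp: charts_at_iff intro: transition_differentiable)
  also have "\<dots> = jac j k p \<circ> jac i j p"
    using p by (subst frechet_derivative_compose)
      (simp_all add: transition_chart_map transition_differentiable)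
  finally show ?thesis
    by simp
qed

lemma jac_self:
  assumes "i \<in> charts_at A p"
  shows "jac i i p w = w"
proof -
  have "frechet_derivative (\<lambda>u. u) (at (chart_map A i p)) = jac i i p"
    by (rule frechet_derivative_transform_within_open[of _ _ "chart_map A i ` chart_dom A i"])
      (use assms in \<open>auto simp: charts_at_iff open_chart transition_chart_map\<close>)
  then show ?thesis
    by (simp add: fun_eq_iff)
qed

lemma tangent_jac:
  "v \<in> tangent_space A p \<Longrightarrow> i \<in> charts_at A p \<Longrightarrow> j \<in> charts_at A p \<Longrightarrow> v j = jac i j p (v i)"
  unfolding tangent_space_def by blast

lemma tangent_outside: "v \<in> tangent_space A p \<Longrightarrow> i \<notin> charts_at A p \<Longrightarrow> v i = 0"
  unfolding tangent_space_def by blast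

lemma tangentI:
  "(\<And>i j. i \<in> charts_at A p \<Longrightarrow> j \<in> charts_at A p \<Longrightarrow> v j = jac i j p (v i)) \<Longrightarrow>
   (\<And>i. i \<notin> charts_at A p \<Longrightarrow> v i = 0) \<Longrightarrow> v \<in> tangent_space A p"
  unfolding tangent_space_def by blast

text \<open>The Jacobians determine all components from a single one, so identities between tangent
  vectors may be checked in whichever chart is convenient.\<close>

lemma tangent_eqI:
  assumes "u \<in> tangent_space A p" "v \<in> tangent_space A p" "i \<in> charts_at A p" "u i = v i"
  shows "u = v"
proof
  fix j show "u j = v j"
    using tangent_jac[OF assms(1,3)] tangent_jac[OF assms(2,3)]
      tangent_outside[OF assms(1)] tangent_outside[OF assms(2)] assms(4)
    by (cases "j \<in> charts_at A p") simp_all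
qed

lemma coord_field_self: "i \<in> charts_at A p \<Longrightarrow> coord_field A i w p i = w"
  by (simp add: coord_field_def jac_self)

lemma coord_field_tangent: "i \<in> charts_at A p \<Longrightarrow> coord_field A i w p \<in> tangent_space A p"
  by (rule tangentI) (auto simp: coord_field_def jac_cocycle)

lemma fibre_subspace_tangent: "fibre_subspace (tangent_space A p)"
  unfolding fibre_subspace_def
proof (intro conjI ballI allI)
  show "(\<lambda>_. 0) \<in> tangent_space A p"
    by (rule tangentI) (simp_all add: linear_0[OF linear_jac])
next
  fix u v assume u: "u \<in> tangent_space A p" and v: "v \<in> tangent_space A p"
  show "(\<lambda>i. u i + v i) \<in> tangent_space A p"
  proof (rule tangentI)
    fix i j assume "i \<in> charts_at A p" "j \<in> charts_at A p"
    then show "u j + v j = jac i j p (u i + v i)"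
      using tangent_jac[OF u, of i j] tangent_jac[OF v, of i j] by (simp add: linear_add[OF linear_jac])
  qed (simp add: tangent_outside[OF u] tangent_outside[OF v])
next
  fix c u assume u: "u \<in> tangent_space A p"
  show "(\<lambda>i. c *\<^sub>R u i) \<in> tangent_space A p"
  proof (rule tangentI)
    fix i j assume "i \<in> charts_at A p" "j \<in> charts_at A p"
    then show "c *\<^sub>R u j = jac i j p (c *\<^sub>R u i)"
      using tangent_jac[OF u, of i j] by (simp add: linear_cmul[OF linear_jac])
  qed (simp add: tangent_outside[OF u])
qed

section \<open>Smooth functions and vector fields in charts\<close>

lemma smooth_fun_differentiable:
  assumes "smooth_fun A W f" "p \<in> W" "i \<in> charts_at A p"
  shows "(f \<circ> chart_inv A i) differentiable (at (chart_map A i p))"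
  using assms by (intro smooth_on_differentiable[of "chart_map A i ` (W \<inter> chart_dom A i)"])
    (auto simp: smooth_fun_def charts_at_iff)

lemma vector_field_has_derivative:
  assumes "vector_field A W X" "p \<in> W" "i \<in> charts_at A p"
  shows "((\<lambda>u. X (chart_inv A i u) i) has_derivative
      frechet_derivative (\<lambda>u. X (chart_inv A i u) i) (at (chart_map A i p))) (at (chart_map A i p))"
  using assms by (intro smooth_on_has_derivative[of "chart_map A i ` (W \<inter> chart_dom A i)"])
    (auto simp: vector_field_def charts_at_iff)

lemma transition_chart_image:
  assumes "i \<in> chart_ind A" "c \<in> chart_ind A" "u \<in> chart_map A i ` (W \<inter> chart_dom A c \<inter> chart_dom A i)"
  shows "chart_inv A c (transition A i c u) = chart_inv A i u"
    and "transition A i c u \<in> chart_map A c ` (W \<inter> chart_dom A i \<inter> chart_dom A c)"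
proof -
  obtain p where p: "u = chart_map A i p" "p \<in> W \<inter> chart_dom A c \<inter> chart_dom A i"
    using assms by blast
  then have "i \<in> charts_at A p" "c \<in> charts_at A p"
    using assms by (auto simp: charts_at_iff)
  then show "chart_inv A c (transition A i c u) = chart_inv A i u"
    "transition A i c u \<in> chart_map A c ` (W \<inter> chart_dom A i \<inter> chart_dom A c)"
    using p by (auto simp: transition_chart_map chart_inv_chart_map)
qed

text \<open>Every other chart sees \<open>f\<close> through a smooth coordinate change. This is how
  the coefficients of fields in a local frame are shown to be smooth.\<close>

lemma smooth_fun_chart:
  assumes W: "atlas_open A W" "W \<subseteq> chart_dom A c" "c \<in> chart_ind A"
    and f: "smooth_on (chart_map A c ` W) (f \<circ> chart_inv A c)"
  shows "smooth_fun A W f"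
  unfolding smooth_fun_def
proof
  fix i assume i: "i \<in> chart_ind A"
  let ?S = "chart_map A i ` (W \<inter> chart_dom A i)"
  have S: "open ?S" by (rule atlas_open_chart_image[OF W(1) i])
  have S_eq: "?S = chart_map A i ` (W \<inter> chart_dom A c \<inter> chart_dom A i)"
    using W(2) by (auto intro!: arg_cong[where f = "image (chart_map A i)"])
  have Wc: "chart_map A c ` W = chart_map A c ` (W \<inter> chart_dom A c)"
    using W(2) by (auto intro!: arg_cong[where f = "image (chart_map A c)"])
  have "smooth_on ?S (\<lambda>u. (f \<circ> chart_inv A c) (transition A i c u))"
  proof (rule smooth_on_compose[OF S _ _ f])
    show "open (chart_map A c ` W)"
      unfolding Wc by (rule atlas_open_chart_image[OF W(1,3)])
    show "transition A i c ` ?S \<subseteq> chart_map A c ` W"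
      using transition_chart_image(2)[OF i W(3)] unfolding S_eq by blast
    show "smooth_on ?S (transition A i c)"
      by (rule smooth_on_subset[OF smooth_transition[OF i W(3)]]) (use W(2) in auto)
  qed
  then show "smooth_on ?S (f \<circ> chart_inv A i)"
    by (rule smooth_on_cong[OF S]) (use transition_chart_image(1)[OF i W(3)] S_eq in auto)
qed

text \<open>In another chart the component is the Jacobian at a moving point applied to the moving
  component in chart \<open>c\<close>, which is the situation of
  \<open>smooth_on_frechet_apply\<close>.\<close>

lemma vector_field_chart:
  assumes W: "atlas_open A W" "W \<subseteq> chart_dom A c" "c \<in> chart_ind A"
    and tan: "\<And>p. p \<in> W \<Longrightarrow> X p \<in> tangent_space A p"
    and X: "smooth_on (chart_map A c ` W) (\<lambda>u. X (chart_inv A c u) c)"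
  shows "vector_field A W X"
  unfolding vector_field_def
proof (intro conjI ballI tan)
  fix i assume i: "i \<in> chart_ind A"
  let ?S = "chart_map A i ` (W \<inter> chart_dom A i)"
  let ?T = "chart_map A c ` (W \<inter> chart_dom A i \<inter> chart_dom A c)"
  have S: "open ?S" by (rule atlas_open_chart_image[OF W(1) i])
  have T: "open ?T"
    by (intro atlas_open_chart_image atlas_open_Int atlas_open_chart_dom W i)
  have S_eq: "?S = chart_map A i ` (W \<inter> chart_dom A c \<inter> chart_dom A i)"
    using W(2) by (auto intro!: arg_cong[where f = "image (chart_map A i)"])
  have "smooth_on ?T (\<lambda>y. frechet_derivative (transition A c i) (at y) (X (chart_inv A c y) c))"
    by (intro smooth_on_frechet_apply T smooth_on_subset[OF smooth_transition[OF W(3) i]]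
        smooth_on_subset[OF X]) auto
  then have "smooth_on ?S (\<lambda>u. frechet_derivative (transition A c i) (at (transition A i c u))
      (X (chart_inv A c (transition A i c u)) c))"
  proof (rule smooth_on_compose[OF S T, rotated])
    show "transition A i c ` ?S \<subseteq> ?T"
      using transition_chart_image(2)[OF i W(3)] unfolding S_eq by blast
    show "smooth_on ?S (transition A i c)"
      by (rule smooth_on_subset[OF smooth_transition[OF i W(3)]]) (use W(2) in auto)
  qed
  then show "smooth_on ?S (\<lambda>u. X (chart_inv A i u) i)"
  proof (rule smooth_on_cong[OF S])
    fix u assume "u \<in> ?S"
    then obtain p where p: "u = chart_map A i p" "p \<in> W" "p \<in> chart_dom A i"
      by blast
    then have "i \<in> charts_at A p" "c \<in> charts_at A p"
      using W i by (auto simp: charts_at_iff)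
    then show "frechet_derivative (transition A c i) (at (transition A i c u))
      (X (chart_inv A c (transition A i c u)) c) = X (chart_inv A i u) i"
      using tangent_jac[OF tan[OF p(2)], of c i]
      by (simp add: p(1) transition_chart_map chart_inv_chart_map)
  qed
qed

lemma vector_field_subset:
  assumes "vector_field A W X" "V \<subseteq> W"
  shows "vector_field A V X"
proof (rule vector_fieldI)
  show "X p \<in> tangent_space A p" if "p \<in> V" for p
    by (rule vector_field_tangent[OF assms(1)]) (use that assms(2) in blast)
  show "smooth_on (chart_map A i ` (V \<inter> chart_dom A i)) (\<lambda>u. X (chart_inv A i u) i)"
    if "i \<in> chart_ind A" for i
    by (rule smooth_on_subset[OF vector_field_smooth[OF assms(1) that]]) (use assms(2) in blast)
qed

lemma sections_subset:
  assumes "X \<in> sections A E W" "V \<subseteq> W"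
  shows "X \<in> sections A E V"
  unfolding sections_def mem_Collect_eq
  using vector_field_subset[OF sections_vector_field[OF assms(1)] assms(2)] sections_mem[OF assms(1)] assms(2)
  by blast

lemma vector_field_add:
  assumes "atlas_open A W" "vector_field A W X" "vector_field A W Y"
  shows "vector_field A W (\<lambda>q i. X q i + Y q i)"
proof (rule vector_fieldI)
  show "(\<lambda>i. X p i + Y p i) \<in> tangent_space A p" if "p \<in> W" for p
    by (intro fibre_subspace_add[OF fibre_subspace_tangent] vector_field_tangent[OF assms(2) that]
        vector_field_tangent[OF assms(3) that])
  show "smooth_on (chart_map A i ` (W \<inter> chart_dom A i)) (\<lambda>u. X (chart_inv A i u) i + Y (chart_inv A i u) i)"
    if "i \<in> chart_ind A" for i
    by (rule smooth_on_add[OF atlas_open_chart_image[OF assms(1) that]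
          vector_field_smooth[OF assms(2) that] vector_field_smooth[OF assms(3) that]])
qed

lemma vector_field_scale:
  assumes "atlas_open A W" "smooth_fun A W f" "vector_field A W X"
  shows "vector_field A W (\<lambda>q i. f q *\<^sub>R X q i)"
proof (rule vector_fieldI)
  show "(\<lambda>i. f p *\<^sub>R X p i) \<in> tangent_space A p" if "p \<in> W" for p
    by (intro fibre_subspace_scale[OF fibre_subspace_tangent] vector_field_tangent[OF assms(3) that])
  show "smooth_on (chart_map A i ` (W \<inter> chart_dom A i)) (\<lambda>u. f (chart_inv A i u) *\<^sub>R X (chart_inv A i u) i)"
    if "i \<in> chart_ind A" for i
    by (rule smooth_on_scaleR[OF atlas_open_chart_image[OF assms(1) that]
          smooth_fun_smooth[OF assms(2) that] vector_field_smooth[OF assms(3) that]])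
qed

lemma smooth_fun_const: "smooth_fun A W (\<lambda>_. c)"
  by (simp add: smooth_fun_def o_def smooth_on_const)

lemma smooth_fun_divide:
  assumes "atlas_open A W" "smooth_fun A W f" "smooth_fun A W g" "\<And>p. p \<in> W \<Longrightarrow> g p \<noteq> 0"
  shows "smooth_fun A W (\<lambda>p. f p / g p)"
  unfolding smooth_fun_def o_def
proof
  fix i assume i: "i \<in> chart_ind A"
  have "g (chart_inv A i u) \<noteq> 0" if u: "u \<in> chart_map A i ` (W \<inter> chart_dom A i)" for u
  proof -
    obtain p where "u = chart_map A i p" "p \<in> W" "i \<in> charts_at A p"
      using u i by (auto simp: charts_at_iff)
    then show ?thesis
      using assms(4) by (simp add: chart_inv_chart_map)
  qed
  then show "smooth_on (chart_map A i ` (W \<inter> chart_dom A i)) (\<lambda>u. f (chart_inv A i u) / g (chart_inv A i u))"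
    using assms i by (intro smooth_on_divide atlas_open_chart_image) (auto simp: smooth_fun_def o_def)
qed

lemma vector_field_diff:
  assumes "atlas_open A W" "vector_field A W X" "vector_field A W Y"
  shows "vector_field A W (\<lambda>q i. X q i - Y q i)"
  using vector_field_add[OF assms(1,2) vector_field_scale[OF assms(1) smooth_fun_const assms(3), of "-1"]]
  by simp

lemma vector_field_zero: "vector_field A W (\<lambda>q i. 0)"
  by (rule vector_fieldI) (rule fibre_subspace_0[OF fibre_subspace_tangent], rule smooth_on_const)

lemma vector_field_sum:
  assumes "atlas_open A W" "\<And>k. k \<in> I \<Longrightarrow> vector_field A W (X k)"
  shows "vector_field A W (\<lambda>q i. \<Sum>k\<in>I. X k q i)"
proof (rule vector_fieldI)
  show "(\<lambda>i. \<Sum>k\<in>I. X k p i) \<in> tangent_space A p" if "p \<in> W" for p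
    by (rule fibre_subspace_sum[OF fibre_subspace_tangent]) (rule vector_field_tangent[OF assms(2) that])
  show "smooth_on (chart_map A i ` (W \<inter> chart_dom A i)) (\<lambda>u. \<Sum>k\<in>I. X k (chart_inv A i u) i)"
    if "i \<in> chart_ind A" for i
    by (rule smooth_on_sum[OF atlas_open_chart_image[OF assms(1) that]])
      (rule vector_field_smooth[OF assms(2) that])
qed

text \<open>\<open>deriv_along\<close> uses an unspecified chart; the chain rule for
  \<open>f\<close> and the transformation law of \<open>X p\<close> compensate each other.\<close>

lemma deriv_along_chart:
  assumes W: "atlas_open A W" "p \<in> W" and f: "smooth_fun A W f"
    and X: "X p \<in> tangent_space A p" and c: "c \<in> charts_at A p"
  shows "deriv_along A X f p = frechet_derivative (f \<circ> chart_inv A c) (at (chart_map A c p)) (X p c)"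
proof -
  define i where "i = (SOME i. i \<in> charts_at A p)"
  have i: "i \<in> charts_at A p"
    unfolding i_def using c by (rule someI)
  let ?S = "chart_map A i ` (W \<inter> chart_dom A c \<inter> chart_dom A i)"
  have ind: "i \<in> chart_ind A" "c \<in> chart_ind A"
    using i c by (auto simp: charts_at_iff)
  have "open ?S"
    by (intro atlas_open_chart_image atlas_open_Int atlas_open_chart_dom W ind)
  then have "frechet_derivative (f \<circ> chart_inv A i) (at (chart_map A i p)) =
      frechet_derivative ((f \<circ> chart_inv A c) \<circ> transition A i c) (at (chart_map A i p))"
    using i c W transition_chart_image(1)[OF ind]
    by (intro frechet_derivative_transform_within_open[of _ _ ?S] smooth_fun_differentiable[OF f])
      (auto simp: charts_at_iff)
  also have "\<dots> = frechet_derivative (f \<circ> chart_inv A c) (at (chart_map A c p)) \<circ> jac i c p"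
    using i c transition_chart_map[OF i] smooth_fun_differentiable[OF f W(2) c]
    by (subst frechet_derivative_compose) (simp_all add: transition_differentiable)
  finally show ?thesis
    using tangent_jac[OF X i c] by (simp add: deriv_along_def i_def[symmetric])
qed

section \<open>Lie brackets of vector fields\<close>

lemma lie_bracket_chart:
  assumes "i \<in> charts_at A p"
  shows "lie_bracket A X Y p i =
     frechet_derivative (\<lambda>u. Y (chart_inv A i u) i) (at (chart_map A i p)) (X p i)
   - frechet_derivative (\<lambda>u. X (chart_inv A i u) i) (at (chart_map A i p)) (Y p i)"
  using assms by (simp add: lie_bracket_def)

text \<open>Differentiating \<open>X j = D\<phi> (X i)\<close>, where \<open>\<phi>\<close> is the coordinate change: the second
  derivative of \<open>\<phi>\<close> cancels in the Lie bracket by symmetry.\<close>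

lemma frechet_derivative_field_transition:
  assumes W: "atlas_open A W" "p \<in> W" and X: "vector_field A W X"
    and i: "i \<in> charts_at A p" and j: "j \<in> charts_at A p"
  shows "frechet_derivative (\<lambda>u. X (chart_inv A j u) j) (at (chart_map A j p)) (jac i j p w) =
    jac i j p (frechet_derivative (\<lambda>u. X (chart_inv A i u) i) (at (chart_map A i p)) w) +
    frechet_derivative (\<lambda>u. frechet_derivative (transition A i j) (at u) w) (at (chart_map A i p)) (X p i)"
proof -
  let ?S = "chart_map A i ` (W \<inter> chart_dom A j \<inter> chart_dom A i)"
  let ?x = "chart_map A i p" and ?\<phi> = "transition A i j"
  let ?X = "\<lambda>u. X (chart_inv A i u) i" and ?Y = "\<lambda>u. X (chart_inv A j u) j"
  have ind: "i \<in> chart_ind A" "j \<in> chart_ind A"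
    using i j by (auto simp: charts_at_iff)
  have S: "open ?S" "?x \<in> ?S"
    using W i j ind
    by (auto intro!: atlas_open_chart_image atlas_open_Int atlas_open_chart_dom simp: charts_at_iff)
  have sm: "smooth_on ?S ?\<phi>"
    by (rule smooth_on_subset[OF smooth_transition[OF ind]]) auto
  have dX: "(?X has_derivative frechet_derivative ?X (at ?x)) (at ?x)"
    by (rule vector_field_has_derivative[OF X W(2) i])
  have "((\<lambda>u. ?Y (?\<phi> u)) has_derivative
     (\<lambda>w. jac i j p (frechet_derivative ?X (at ?x) w) +
        frechet_derivative (\<lambda>u. frechet_derivative ?\<phi> (at u) w) (at ?x) (?X ?x))) (at ?x)"
  proof (rule has_derivative_transform_within_open[OF has_derivative_frechet_apply[OF S sm dX] S])
    fix u assume u: "u \<in> ?S"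
    then obtain q where q: "u = chart_map A i q" "q \<in> W" "i \<in> charts_at A q" "j \<in> charts_at A q"
      using ind by (auto simp: charts_at_iff)
    show "frechet_derivative ?\<phi> (at u) (?X u) = ?Y (?\<phi> u)"
      using q(3,4) tangent_jac[OF vector_field_tangent[OF X q(2)] q(3,4)]
      by (simp add: q(1) chart_inv_chart_map transition_chart_map)
  qed
  moreover have "((\<lambda>u. ?Y (?\<phi> u)) has_derivative
     (\<lambda>w. frechet_derivative ?Y (at (chart_map A j p)) (jac i j p w))) (at ?x)"
    by (rule has_derivative_compose[OF smooth_on_has_derivative[OF sm S(2)]])
      (simp only: transition_chart_map[OF i] vector_field_has_derivative[OF X W(2) j])
  ultimately have "(\<lambda>w. jac i j p (frechet_derivative ?X (at ?x) w) +
        frechet_derivative (\<lambda>u. frechet_derivative ?\<phi> (at u) w) (at ?x) (?X ?x)) =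
     (\<lambda>w. frechet_derivative ?Y (at (chart_map A j p)) (jac i j p w))"
    by (rule has_derivative_unique)
  then show ?thesis
    by (simp only: fun_eq_iff chart_inv_chart_map[OF i])
qed

lemma lie_bracket_tangent:
  assumes W: "atlas_open A W" "p \<in> W" and X: "vector_field A W X" and Y: "vector_field A W Y"
  shows "lie_bracket A X Y p \<in> tangent_space A p"
proof (rule tangentI)
  fix i j assume i: "i \<in> charts_at A p" and j: "j \<in> charts_at A p"
  let ?S = "chart_map A i ` (chart_dom A i \<inter> chart_dom A j)"
  have "open ?S" "chart_map A i p \<in> ?S" "smooth_on ?S (transition A i j)"
    using i j open_overlap[of i j] smooth_transition[of i j] by (auto simp: charts_at_iff)
  then have sym: "frechet_derivative (\<lambda>u. frechet_derivative (transition A i j) (at u) (X p i)) (at (chart_map A i p)) (Y p i) =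
      frechet_derivative (\<lambda>u. frechet_derivative (transition A i j) (at u) (Y p i)) (at (chart_map A i p)) (X p i)"
    by (rule second_derivative_symmetric)
  have Xj: "X p j = jac i j p (X p i)" and Yj: "Y p j = jac i j p (Y p i)"
    using tangent_jac[OF vector_field_tangent[OF X W(2)] i j]
      tangent_jac[OF vector_field_tangent[OF Y W(2)] i j] by blast+
  show "lie_bracket A X Y p j = jac i j p (lie_bracket A X Y p i)"
    unfolding lie_bracket_chart[OF i] lie_bracket_chart[OF j] Xj Yj linear_diff[OF linear_jac[OF i j]]
      frechet_derivative_field_transition[OF W X i j] frechet_derivative_field_transition[OF W Y i j] sym
    by (rule add_diff_cancel_right)
qed (simp add: lie_bracket_def)

text \<open>Values of fields outside \<open>W\<close> are arbitrary; agreement on \<open>W\<close>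
  fixes the derivative because the chart image of \<open>W\<close> is open.\<close>

lemma frechet_derivative_field_cong:
  assumes W: "atlas_open A W" "p \<in> W" and X: "vector_field A W X"
    and eq: "\<And>q. q \<in> W \<Longrightarrow> X q i = Y q i" and i: "i \<in> charts_at A p"
  shows "frechet_derivative (\<lambda>u. X (chart_inv A i u) i) (at (chart_map A i p)) =
    frechet_derivative (\<lambda>u. Y (chart_inv A i u) i) (at (chart_map A i p))"
proof (rule frechet_derivative_transform_within_open)
  show "(\<lambda>u. X (chart_inv A i u) i) differentiable (at (chart_map A i p))"
    using vector_field_has_derivative[OF X W(2) i] by (auto simp: differentiable_def)
  show "open (chart_map A i ` (W \<inter> chart_dom A i))" "chart_map A i p \<in> chart_map A i ` (W \<inter> chart_dom A i)"
    using W i by (auto intro!: atlas_open_chart_image simp: charts_at_iff)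
  fix u assume "u \<in> chart_map A i ` (W \<inter> chart_dom A i)"
  then obtain q where "u = chart_map A i q" "q \<in> W" "i \<in> charts_at A q"
    using i by (auto simp: charts_at_iff)
  then show "X (chart_inv A i u) i = Y (chart_inv A i u) i"
    by (simp add: chart_inv_chart_map eq)
qed

lemma lie_bracket_cong_right:
  assumes W: "atlas_open A W" "p \<in> W" and Y: "vector_field A W Y"
    and eq: "\<And>q. q \<in> W \<Longrightarrow> Y q = Z q"
  shows "lie_bracket A X Y p = lie_bracket A X Z p"
proof
  fix i
  show "lie_bracket A X Y p i = lie_bracket A X Z p i"
  proof (cases "i \<in> charts_at A p")
    case i: True
    have "frechet_derivative (\<lambda>u. Y (chart_inv A i u) i) (at (chart_map A i p)) =
        frechet_derivative (\<lambda>u. Z (chart_inv A i u) i) (at (chart_map A i p))"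
      by (rule frechet_derivative_field_cong[OF W Y _ i]) (simp add: eq)
    then show ?thesis
      by (simp only: lie_bracket_chart[OF i] eq[OF W(2)])
  qed (simp add: lie_bracket_def)
qed

lemma lie_bracket_add_right:
  assumes W: "p \<in> W" and X: "vector_field A W X" and Y: "vector_field A W Y" and Z: "vector_field A W Z"
  shows "lie_bracket A X (\<lambda>q i. Y q i + Z q i) p = (\<lambda>i. lie_bracket A X Y p i + lie_bracket A X Z p i)"
proof
  fix i
  show "lie_bracket A X (\<lambda>q i. Y q i + Z q i) p i = lie_bracket A X Y p i + lie_bracket A X Z p i"
  proof (cases "i \<in> charts_at A p")
    case i: True
    let ?x = "chart_map A i p"
    have "frechet_derivative (\<lambda>u. Y (chart_inv A i u) i + Z (chart_inv A i u) i) (at ?x) =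
      (\<lambda>w. frechet_derivative (\<lambda>u. Y (chart_inv A i u) i) (at ?x) w +
           frechet_derivative (\<lambda>u. Z (chart_inv A i u) i) (at ?x) w)"
      by (intro frechet_derivative_eqI has_derivative_add vector_field_has_derivative[OF _ W i] Y Z)
    moreover have "linear (frechet_derivative (\<lambda>u. X (chart_inv A i u) i) (at ?x))"
      using vector_field_has_derivative[OF X W i] has_derivative_linear by blast
    ultimately show ?thesis
      by (simp add: lie_bracket_chart i linear_add)
  qed (simp add: lie_bracket_def)
qed

end

section \<open>Connections on distributions\<close>

lemma connectionD:
  assumes "connection A E D" "atlas_open A W"
    and "vector_field A W X" "Y \<in> sections A E W"
  shows connection_sections: "D X Y \<in> sections A E W"
    and connection_cong: "vector_field A W X' \<Longrightarrow> Y' \<in> sections A E W \<Longrightarrow>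
      (\<And>q. q \<in> W \<Longrightarrow> X' q = X q) \<Longrightarrow> (\<And>q. q \<in> W \<Longrightarrow> Y' q = Y q) \<Longrightarrow> p \<in> W \<Longrightarrow> D X' Y' p = D X Y p"
    and connection_add_left: "vector_field A W X' \<Longrightarrow> p \<in> W \<Longrightarrow>
      D (\<lambda>q i. X q i + X' q i) Y p = (\<lambda>i. D X Y p i + D X' Y p i)"
    and connection_add_right: "Y' \<in> sections A E W \<Longrightarrow> p \<in> W \<Longrightarrow>
      D X (\<lambda>q i. Y q i + Y' q i) p = (\<lambda>i. D X Y p i + D X Y' p i)"
    and connection_scale_left: "smooth_fun A W f \<Longrightarrow> p \<in> W \<Longrightarrow>
      D (\<lambda>q i. f q *\<^sub>R X q i) Y p = (\<lambda>i. f p *\<^sub>R D X Y p i)"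
    and connection_Leibniz: "smooth_fun A W f \<Longrightarrow> p \<in> W \<Longrightarrow>
      D X (\<lambda>q i. f q *\<^sub>R Y q i) p = (\<lambda>i. deriv_along A X f p *\<^sub>R Y p i + f p *\<^sub>R D X Y p i)"
proof -
  have X: "X \<in> sections A (tangent_space A) W"
    using assms(3) by (simp add: sections_tangent_space)
  note D = assms(1)[unfolded connection_def, rule_format, OF assms(2) X assms(4)]
  show "D X Y \<in> sections A E W"
    using D by blast
  show "D X' Y' p = D X Y p" if "vector_field A W X'" "Y' \<in> sections A E W"
      "\<And>q. q \<in> W \<Longrightarrow> X' q = X q" "\<And>q. q \<in> W \<Longrightarrow> Y' q = Y q" "p \<in> W"
    using D that unfolding sections_tangent_space by blast
  show "D (\<lambda>q i. X q i + X' q i) Y p = (\<lambda>i. D X Y p i + D X' Y p i)" if "vector_field A W X'" "p \<in> W"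
    using D that unfolding sections_tangent_space by blast
  show "D X (\<lambda>q i. Y q i + Y' q i) p = (\<lambda>i. D X Y p i + D X Y' p i)" if "Y' \<in> sections A E W" "p \<in> W"
    using D that by blast
  show "D (\<lambda>q i. f q *\<^sub>R X q i) Y p = (\<lambda>i. f p *\<^sub>R D X Y p i)"
      "D X (\<lambda>q i. f q *\<^sub>R Y q i) p = (\<lambda>i. deriv_along A X f p *\<^sub>R Y p i + f p *\<^sub>R D X Y p i)"
    if "smooth_fun A W f" "p \<in> W"
    using D that by blast+
qed

text \<open>Smoothness of \<open>D X Y\<close> and the algebraic rules are inherited from
  \<open>E\<close>; what is left is the pointwise condition that \<open>D\<close> does not leave
  \<open>K\<close>.\<close>

lemma connection_subdistribution:
  assumes "connection A E D" and sub: "\<And>p. p \<in> points A \<Longrightarrow> K p \<subseteq> E p"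
    and closed: "\<And>W X Y p. atlas_open A W \<Longrightarrow> vector_field A W X \<Longrightarrow> Y \<in> sections A K W \<Longrightarrow>
      p \<in> W \<Longrightarrow> D X Y p \<in> K p"
  shows "connection A K D"
  unfolding connection_def
proof (intro allI impI ballI)
  fix W X Y assume W: "atlas_open A W" and X: "X \<in> sections A (tangent_space A) W"
    and Y: "Y \<in> sections A K W"
  have KE: "sections A K W \<subseteq> sections A E W"
    by (rule sections_mono) (use sub W in \<open>auto simp: atlas_open_def\<close>)
  have "D X Y \<in> sections A K W"
    using X Y closed[OF W] KE connection_sections[OF assms(1) W, of X Y]
    by (auto simp: sections_tangent_space sections_def)
  moreover note assms(1)[unfolded connection_def, rule_format, OF W X subsetD[OF KE Y]]
  ultimately show "D X Y \<in> sections A K W \<and>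
        (\<forall>X'\<in>sections A (tangent_space A) W. \<forall>Y'\<in>sections A K W.
           (\<forall>p\<in>W. X' p = X p \<and> Y' p = Y p) \<longrightarrow> (\<forall>p\<in>W. D X' Y' p = D X Y p)) \<and>
        (\<forall>X'\<in>sections A (tangent_space A) W. \<forall>p\<in>W.
           D (\<lambda>q i. X q i + X' q i) Y p = (\<lambda>i. D X Y p i + D X' Y p i)) \<and>
        (\<forall>Y'\<in>sections A K W. \<forall>p\<in>W.
           D X (\<lambda>q i. Y q i + Y' q i) p = (\<lambda>i. D X Y p i + D X Y' p i)) \<and>
        (\<forall>f. smooth_fun A W f \<longrightarrow> (\<forall>p\<in>W.
           D (\<lambda>q i. f q *\<^sub>R X q i) Y p = (\<lambda>i. f p *\<^sub>R D X Y p i) \<and>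
           D X (\<lambda>q i. f q *\<^sub>R Y q i) p =
             (\<lambda>i. deriv_along A X f p *\<^sub>R Y p i + f p *\<^sub>R D X Y p i)))"
    using KE by blast
qed

context smooth_atlas
begin

lemma connection_sum_left:
  assumes D: "connection A (tangent_space A) D" and W: "atlas_open A W" "p \<in> W"
    and I: "finite I" "\<And>k. k \<in> I \<Longrightarrow> smooth_fun A W (f k)" "\<And>k. k \<in> I \<Longrightarrow> vector_field A W (X k)"
    and Y: "vector_field A W Y"
  shows "D (\<lambda>q i. \<Sum>k\<in>I. f k q *\<^sub>R X k q i) Y p = (\<lambda>i. \<Sum>k\<in>I. f k p *\<^sub>R D (X k) Y p i)"
  using I
proof (induction I)
  case empty
  show ?case
    \<comment> \<open>The empty sum is the zero field, regarded as the constant function 0 times a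
      field.\<close>
    using connection_scale_left[OF D W(1) vector_field_zero, of Y "\<lambda>_. 0" p] smooth_fun_const W Y
    by (simp add: sections_tangent_space)
next
  case (insert k I)
  then show ?case
    using connection_add_left[OF D W(1), of "\<lambda>q i. f k q *\<^sub>R X k q i" Y "\<lambda>q i. \<Sum>k\<in>I. f k q *\<^sub>R X k q i" p]
      connection_scale_left[OF D W(1), of "X k" Y "f k" p] W Y
    by (simp add: sections_tangent_space vector_field_scale vector_field_sum)
qed

lemma connection_sum_right:
  assumes D: "connection A (tangent_space A) D" and W: "atlas_open A W" "p \<in> W"
    and I: "finite I" "\<And>k. k \<in> I \<Longrightarrow> smooth_fun A W (f k)" "\<And>k. k \<in> I \<Longrightarrow> vector_field A W (Y k)"
    and X: "vector_field A W X"
  shows "D X (\<lambda>q i. \<Sum>k\<in>I. f k q *\<^sub>R Y k q i) p =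
    (\<lambda>i. \<Sum>k\<in>I. deriv_along A X (f k) p *\<^sub>R Y k p i + f k p *\<^sub>R D X (Y k) p i)"
  using I
proof (induction I)
  case empty
  show ?case
    using connection_Leibniz[OF D W(1) X, of "\<lambda>_ _. 0" "\<lambda>_. 0" p] smooth_fun_const W vector_field_zero
    by (simp add: sections_tangent_space)
next
  case (insert k I)
  then show ?case
    using connection_add_right[OF D W(1) X, of "\<lambda>q i. f k q *\<^sub>R Y k q i" "\<lambda>q i. \<Sum>k\<in>I. f k q *\<^sub>R Y k q i" p]
      connection_Leibniz[OF D W(1) X, of "Y k" "f k" p] W
    by (simp add: sections_tangent_space vector_field_scale vector_field_sum)
qed

end

lemma proj_pointwise: "X p = Y p \<Longrightarrow> proj E K X p = proj E K Y p"
  unfolding proj_def by simp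

context smooth_atlas
begin

lemma vector_field_cong:
  assumes W: "atlas_open A W" and X: "vector_field A W X" and eq: "\<And>q. q \<in> W \<Longrightarrow> X q = Y q"
  shows "vector_field A W Y"
proof (rule vector_fieldI)
  show "Y p \<in> tangent_space A p" if "p \<in> W" for p
    using vector_field_tangent[OF X that] eq[OF that] by simp
  show "smooth_on (chart_map A i ` (W \<inter> chart_dom A i)) (\<lambda>u. Y (chart_inv A i u) i)"
    if i: "i \<in> chart_ind A" for i
  proof (rule smooth_on_cong[OF atlas_open_chart_image[OF W i] vector_field_smooth[OF X i]])
    fix u assume "u \<in> chart_map A i ` (W \<inter> chart_dom A i)"
    then obtain q where "u = chart_map A i q" "q \<in> W" "i \<in> charts_at A q"
      using i by (auto simp: charts_at_iff)
    then show "X (chart_inv A i u) i = Y (chart_inv A i u) i"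
      by (simp add: chart_inv_chart_map eq)
  qed
qed

lemma sections_add:
  assumes W: "atlas_open A W" and E: "\<And>p. p \<in> W \<Longrightarrow> fibre_subspace (E p)"
    and X: "X \<in> sections A E W" and Y: "Y \<in> sections A E W"
  shows "(\<lambda>q i. X q i + Y q i) \<in> sections A E W"
proof (rule sectionsI)
  show "vector_field A W (\<lambda>q i. X q i + Y q i)"
    by (rule vector_field_add[OF W sections_vector_field[OF X] sections_vector_field[OF Y]])
  show "(\<lambda>i. X p i + Y p i) \<in> E p" if "p \<in> W" for p
    by (rule fibre_subspace_add[OF E[OF that] sections_mem[OF X that] sections_mem[OF Y that]])
qed

lemma sections_scale:
  assumes W: "atlas_open A W" and E: "\<And>p. p \<in> W \<Longrightarrow> fibre_subspace (E p)"
    and f: "smooth_fun A W f" and X: "X \<in> sections A E W"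
  shows "(\<lambda>q i. f q *\<^sub>R X q i) \<in> sections A E W"
proof (rule sectionsI)
  show "vector_field A W (\<lambda>q i. f q *\<^sub>R X q i)"
    by (rule vector_field_scale[OF W f sections_vector_field[OF X]])
  show "(\<lambda>i. f p *\<^sub>R X p i) \<in> E p" if "p \<in> W" for p
    by (rule fibre_subspace_scale[OF E[OF that] sections_mem[OF X that]])
qed

lemma atlas_open_points: "atlas_open A W \<Longrightarrow> p \<in> W \<Longrightarrow> p \<in> points A"
  by (auto simp: atlas_open_def)

end

lemma proj_sum_eq:
  assumes "fibre_subspace (E p)" "fibre_subspace (K p)" "E p \<inter> K p \<subseteq> {\<lambda>_. 0}"
    and "a \<in> E p" "b \<in> K p" and X: "X p = (\<lambda>i. a i + b i)"
  shows "proj E K X p = a" and "proj K E X p = b"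
proof -
  show "proj E K X p = a"
    by (rule proj_eqI[where E = E and K = K and p = p and X = X, OF assms(1,2,3,4)]) (simp add: X assms(5))
  have "K p \<inter> E p \<subseteq> {\<lambda>_. 0}"
    using assms(3) by blast
  then show "proj K E X p = b"
    by (rule proj_eqI[where E = K and K = E and p = p and X = X, OF assms(2,1) _ assms(5)]) (simp add: X assms(4))
qed

context smooth_atlas
begin

text \<open>Uniqueness of the splitting makes both projections linear over functions at each point
  of \<open>W\<close>. Such identities between projected fields hold on \<open>W\<close> only, so
  they are carried through \<open>D1\<close> and \<open>D2\<close> by \<open>connection_cong\<close>
  and not by rewriting.\<close>

lemma connection_sum_connection:
  assumes D1: "connection A E1 D1" and D2: "connection A E2 D2"
    and E1: "\<And>p. p \<in> points A \<Longrightarrow> fibre_subspace (E1 p)"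
    and E2: "\<And>p. p \<in> points A \<Longrightarrow> fibre_subspace (E2 p)"
    and disj: "\<And>p. p \<in> points A \<Longrightarrow> E1 p \<inter> E2 p \<subseteq> {\<lambda>_. 0}"
    and E: "\<And>p. p \<in> points A \<Longrightarrow> E p = dist_sum E1 E2 p"
    and sec1: "\<And>W Z. atlas_open A W \<Longrightarrow> Z \<in> sections A E W \<Longrightarrow> proj E1 E2 Z \<in> sections A E1 W"
    and sec2: "\<And>W Z. atlas_open A W \<Longrightarrow> Z \<in> sections A E W \<Longrightarrow> proj E2 E1 Z \<in> sections A E2 W"
  shows "connection A E (sum_connection E1 E2 D1 D2)"
  unfolding connection_def
proof (intro allI impI ballI)
  fix W X Y assume W: "atlas_open A W" and "X \<in> sections A (tangent_space A) W"
    and Y: "Y \<in> sections A E W"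
  then have X: "vector_field A W X"
    by (simp add: sections_tangent_space)
  have pts: "p \<in> points A" if "p \<in> W" for p
    by (rule atlas_open_points[OF W that])
  have sub1: "fibre_subspace (E1 p)" and sub2: "fibre_subspace (E2 p)" and sub: "fibre_subspace (E p)"
    if "p \<in> W" for p
    using fibre_subspace_dist_sum[where E = E1 and K = E2 and p = p] E1 E2 E pts[OF that] by simp_all
  note Y1 = sec1[OF W Y] and Y2 = sec2[OF W Y]
  have proj_eq: "proj E1 E2 Z p = a" "proj E2 E1 Z p = b"
    if p: "p \<in> W" and "a \<in> E1 p" "b \<in> E2 p" "Z p = (\<lambda>i. a i + b i)" for Z p a b
    using proj_sum_eq[where E = E1 and K = E2 and p = p and X = Z, OF E1[OF pts[OF p]]
        E2[OF pts[OF p]] disj[OF pts[OF p]]] that by blast+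
  have split: "Z p = (\<lambda>i. proj E1 E2 Z p i + proj E2 E1 Z p i)"
    if Z: "Z \<in> sections A E W" and p: "p \<in> W" for Z p
  proof -
    obtain a b where ab: "a \<in> E1 p" "b \<in> E2 p" "Z p = (\<lambda>i. a i + b i)"
      using sections_mem[OF Z p] E[OF pts[OF p]] unfolding dist_sum_def by blast
    show ?thesis
      unfolding proj_eq(1)[where Z = Z, OF p ab] proj_eq(2)[where Z = Z, OF p ab] by (rule ab(3))
  qed
  have in1: "proj E1 E2 Z p \<in> E1 p" and in2: "proj E2 E1 Z p \<in> E2 p"
    if "Z \<in> sections A E W" "p \<in> W" for Z p
    using sections_mem[OF sec1[OF W that(1)] that(2)] sections_mem[OF sec2[OF W that(1)] that(2)] by blast+
  have "sum_connection E1 E2 D1 D2 X Y \<in> sections A E W"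
  proof (rule sectionsI)
    show "vector_field A W (sum_connection E1 E2 D1 D2 X Y)"
      unfolding sum_connection_def[abs_def]
      by (rule vector_field_add[OF W sections_vector_field[OF connection_sections[OF D1 W X Y1]]
            sections_vector_field[OF connection_sections[OF D2 W X Y2]]])
    show "sum_connection E1 E2 D1 D2 X Y p \<in> E p" if p: "p \<in> W" for p
      unfolding sum_connection_def E[OF pts[OF p]]
      by (rule dist_sumI[where E = E1 and K = E2 and p = p and a = "D1 X (proj E1 E2 Y) p" and b = "D2 X (proj E2 E1 Y) p",
            OF sections_mem[OF connection_sections[OF D1 W X Y1] p]
              sections_mem[OF connection_sections[OF D2 W X Y2] p]])
  qed
  moreover have "sum_connection E1 E2 D1 D2 X' Y' p = sum_connection E1 E2 D1 D2 X Y p"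
    if X': "vector_field A W X'" and Y': "Y' \<in> sections A E W"
      and eq: "\<forall>p\<in>W. X' p = X p \<and> Y' p = Y p" and p: "p \<in> W" for X' Y' p
  proof -
    have "D1 X' (proj E1 E2 Y') p = D1 X (proj E1 E2 Y) p"
      by (rule connection_cong[OF D1 W X Y1 X' sec1[OF W Y'] _ _ p])
        (use eq in \<open>auto intro: proj_pointwise\<close>)
    moreover have "D2 X' (proj E2 E1 Y') p = D2 X (proj E2 E1 Y) p"
      by (rule connection_cong[OF D2 W X Y2 X' sec2[OF W Y'] _ _ p])
        (use eq in \<open>auto intro: proj_pointwise\<close>)
    ultimately show ?thesis
      by (simp only: sum_connection_def)
  qed
  moreover have "sum_connection E1 E2 D1 D2 (\<lambda>q i. X q i + X' q i) Y p =
      (\<lambda>i. sum_connection E1 E2 D1 D2 X Y p i + sum_connection E1 E2 D1 D2 X' Y p i)"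
    if X': "vector_field A W X'" and p: "p \<in> W" for X' p
    unfolding sum_connection_def connection_add_left[OF D1 W X Y1 X' p] connection_add_left[OF D2 W X Y2 X' p]
    by (simp add: algebra_simps)
  moreover have "sum_connection E1 E2 D1 D2 X (\<lambda>q i. Y q i + Y' q i) p =
      (\<lambda>i. sum_connection E1 E2 D1 D2 X Y p i + sum_connection E1 E2 D1 D2 X Y' p i)"
    if Y': "Y' \<in> sections A E W" and p: "p \<in> W" for Y' p
  proof -
    let ?Z = "\<lambda>q i. Y q i + Y' q i"
    let ?a = "\<lambda>q i. proj E1 E2 Y q i + proj E1 E2 Y' q i" and ?b = "\<lambda>q i. proj E2 E1 Y q i + proj E2 E1 Y' q i"
    have a: "?a q \<in> E1 q" and b: "?b q \<in> E2 q" if q: "q \<in> W" for q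
      using in1[OF Y q] in1[OF Y' q] in2[OF Y q] in2[OF Y' q]
        fibre_subspace_add[OF E1[OF pts[OF q]]] fibre_subspace_add[OF E2[OF pts[OF q]]] by blast+
    have Zq: "?Z q = (\<lambda>i. ?a q i + ?b q i)" if q: "q \<in> W" for q
      by (subst split[OF Y q], subst split[OF Y' q]) (simp add: algebra_simps)
    have a_sec: "?a \<in> sections A E1 W"
      by (rule sections_add[OF W sub1 Y1 sec1[OF W Y']])
    have b_sec: "?b \<in> sections A E2 W"
      by (rule sections_add[OF W sub2 Y2 sec2[OF W Y']])
    have Z_sec: "?Z \<in> sections A E W"
      by (rule sections_add[OF W sub Y Y'])
    have "D1 X (proj E1 E2 ?Z) p = D1 X ?a p"
      by (rule connection_cong[OF D1 W X a_sec X sec1[OF W Z_sec] refl _ p])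
        (rule proj_eq(1)[where Z = ?Z and a = "?a q" and b = "?b q" for q, OF _ a b Zq])
    moreover have "D2 X (proj E2 E1 ?Z) p = D2 X ?b p"
      by (rule connection_cong[OF D2 W X b_sec X sec2[OF W Z_sec] refl _ p])
        (rule proj_eq(2)[where Z = ?Z and a = "?a q" and b = "?b q" for q, OF _ a b Zq])
    ultimately show ?thesis
      unfolding sum_connection_def connection_add_right[OF D1 W X Y1 sec1[OF W Y'] p]
        connection_add_right[OF D2 W X Y2 sec2[OF W Y'] p]
      by (simp add: algebra_simps)
  qed
  moreover have "sum_connection E1 E2 D1 D2 (\<lambda>q i. f q *\<^sub>R X q i) Y p =
      (\<lambda>i. f p *\<^sub>R sum_connection E1 E2 D1 D2 X Y p i)"
    if f: "smooth_fun A W f" and p: "p \<in> W" for f p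
    unfolding sum_connection_def connection_scale_left[OF D1 W X Y1 f p] connection_scale_left[OF D2 W X Y2 f p]
    by (simp add: algebra_simps)
  moreover have "sum_connection E1 E2 D1 D2 X (\<lambda>q i. f q *\<^sub>R Y q i) p =
      (\<lambda>i. deriv_along A X f p *\<^sub>R Y p i + f p *\<^sub>R sum_connection E1 E2 D1 D2 X Y p i)"
    if f: "smooth_fun A W f" and p: "p \<in> W" for f p
  proof -
    let ?Z = "\<lambda>q i. f q *\<^sub>R Y q i"
    let ?a = "\<lambda>q i. f q *\<^sub>R proj E1 E2 Y q i" and ?b = "\<lambda>q i. f q *\<^sub>R proj E2 E1 Y q i"
    have a: "?a q \<in> E1 q" and b: "?b q \<in> E2 q" if q: "q \<in> W" for q
      using in1[OF Y q] in2[OF Y q]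
        fibre_subspace_scale[OF E1[OF pts[OF q]]] fibre_subspace_scale[OF E2[OF pts[OF q]]] by blast+
    have Zq: "?Z q = (\<lambda>i. ?a q i + ?b q i)" if q: "q \<in> W" for q
      by (subst split[OF Y q]) (simp add: scaleR_add_right)
    have a_sec: "?a \<in> sections A E1 W"
      by (rule sections_scale[OF W sub1 f Y1])
    have b_sec: "?b \<in> sections A E2 W"
      by (rule sections_scale[OF W sub2 f Y2])
    have Z_sec: "?Z \<in> sections A E W"
      by (rule sections_scale[OF W sub f Y])
    have 1: "D1 X (proj E1 E2 ?Z) p = D1 X ?a p"
      by (rule connection_cong[OF D1 W X a_sec X sec1[OF W Z_sec] refl _ p])
        (rule proj_eq(1)[where Z = ?Z and a = "?a q" and b = "?b q" for q, OF _ a b Zq])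
    have 2: "D2 X (proj E2 E1 ?Z) p = D2 X ?b p"
      by (rule connection_cong[OF D2 W X b_sec X sec2[OF W Z_sec] refl _ p])
        (rule proj_eq(2)[where Z = ?Z and a = "?a q" and b = "?b q" for q, OF _ a b Zq])
    have Yp: "Y p i = proj E1 E2 Y p i + proj E2 E1 Y p i" for i
      by (rule fun_cong[OF split[OF Y p]])
    show ?thesis
      unfolding sum_connection_def 1 2 connection_Leibniz[OF D1 W X Y1 f p]
        connection_Leibniz[OF D2 W X Y2 f p]
      by (rule ext) (subst Yp, simp add: algebra_simps)
  qed
  ultimately show "sum_connection E1 E2 D1 D2 X Y \<in> sections A E W \<and>
        (\<forall>X'\<in>sections A (tangent_space A) W. \<forall>Y'\<in>sections A E W.
           (\<forall>p\<in>W. X' p = X p \<and> Y' p = Y p) \<longrightarrow>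
             (\<forall>p\<in>W. sum_connection E1 E2 D1 D2 X' Y' p = sum_connection E1 E2 D1 D2 X Y p)) \<and>
        (\<forall>X'\<in>sections A (tangent_space A) W. \<forall>p\<in>W.
           sum_connection E1 E2 D1 D2 (\<lambda>q i. X q i + X' q i) Y p =
             (\<lambda>i. sum_connection E1 E2 D1 D2 X Y p i + sum_connection E1 E2 D1 D2 X' Y p i)) \<and>
        (\<forall>Y'\<in>sections A E W. \<forall>p\<in>W.
           sum_connection E1 E2 D1 D2 X (\<lambda>q i. Y q i + Y' q i) p =
             (\<lambda>i. sum_connection E1 E2 D1 D2 X Y p i + sum_connection E1 E2 D1 D2 X Y' p i)) \<and>
        (\<forall>f. smooth_fun A W f \<longrightarrow> (\<forall>p\<in>W.
           sum_connection E1 E2 D1 D2 (\<lambda>q i. f q *\<^sub>R X q i) Y p =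
             (\<lambda>i. f p *\<^sub>R sum_connection E1 E2 D1 D2 X Y p i) \<and>
           sum_connection E1 E2 D1 D2 X (\<lambda>q i. f q *\<^sub>R Y q i) p =
             (\<lambda>i. deriv_along A X f p *\<^sub>R Y p i + f p *\<^sub>R sum_connection E1 E2 D1 D2 X Y p i)))"
    unfolding sections_tangent_space mem_Collect_eq
    by (intro conjI ballI allI impI) (unfold mem_Collect_eq, blast+)
qed

section \<open>The slit tangent bundle\<close>

abbreviation slit :: "('i, 'p \<times> ('i \<Rightarrow> 'e), 'e \<times> 'e) atlas" where
  "slit \<equiv> slit_tangent_bundle A"

lemma slit_chart_ind: "chart_ind slit = chart_ind A"
  and slit_chart_map: "chart_map slit i q = (chart_map A i (fst q), snd q i)"
  and slit_chart_dom: "q \<in> chart_dom slit i \<longleftrightarrow>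
    fst q \<in> chart_dom A i \<and> snd q \<in> tangent_space A (fst q) \<and> snd q \<noteq> (\<lambda>_. 0)"
  by (auto simp: slit_tangent_bundle_def split: prod.splits)

lemma slit_charts_at: "i \<in> charts_at slit q \<longleftrightarrow>
    i \<in> charts_at A (fst q) \<and> snd q \<in> tangent_space A (fst q) \<and> snd q \<noteq> (\<lambda>_. 0)"
  by (auto simp: charts_at_iff slit_chart_ind slit_chart_dom)

lemma tangent_component_nonzero:
  assumes "v \<in> tangent_space A p" "i \<in> charts_at A p"
  shows "v i = 0 \<longleftrightarrow> v = (\<lambda>_. 0)"
  using tangent_eqI[OF assms(1) fibre_subspace_0[OF fibre_subspace_tangent] assms(2)] by auto

text \<open>A nonzero tangent vector has a nonzero component in every chart around its base point,
  and \<open>coord_field\<close> realises every nonzero component.\<close>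

lemma slit_chart_image:
  assumes "i \<in> chart_ind A"
  shows "chart_map slit i ` (chart_dom slit i \<inter> chart_dom slit j) =
    (chart_map A i ` (chart_dom A i \<inter> chart_dom A j)) \<times> (- {0::'e})"
proof (intro equalityI subsetI)
  fix z assume "z \<in> chart_map slit i ` (chart_dom slit i \<inter> chart_dom slit j)"
  then obtain q where q: "z = chart_map slit i q" "q \<in> chart_dom slit i" "q \<in> chart_dom slit j"
    by blast
  then have "snd q i \<noteq> 0"
    using assms tangent_component_nonzero[of "snd q" "fst q" i] by (auto simp: slit_chart_dom charts_at_iff)
  then show "z \<in> (chart_map A i ` (chart_dom A i \<inter> chart_dom A j)) \<times> (- {0::'e})"
    using q by (auto simp: slit_chart_map slit_chart_dom)
next
  fix z assume "z \<in> (chart_map A i ` (chart_dom A i \<inter> chart_dom A j)) \<times> (- {0::'e})"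
  then obtain p w where z: "z = (chart_map A i p, w)" "p \<in> chart_dom A i" "p \<in> chart_dom A j" "w \<noteq> 0"
    by auto
  have i: "i \<in> charts_at A p"
    using assms z by (simp add: charts_at_iff)
  have "coord_field A i w p \<noteq> (\<lambda>_. 0)"
    using tangent_component_nonzero[OF coord_field_tangent[OF i] i, of w] z(4)
    by (simp add: coord_field_self[OF i])
  then show "z \<in> chart_map slit i ` (chart_dom slit i \<inter> chart_dom slit j)"
    using z by (intro image_eqI[of _ _ "(p, coord_field A i w p)"])
      (simp_all add: slit_chart_map slit_chart_dom coord_field_self[OF i] coord_field_tangent[OF i])
qed

lemma slit_chart_inj:
  assumes "i \<in> chart_ind A"
  shows "inj_on (chart_map slit i) (chart_dom slit i)"
proof (rule inj_onI)
  fix q r assume q: "q \<in> chart_dom slit i" and r: "r \<in> chart_dom slit i"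
    and eq: "chart_map slit i q = chart_map slit i r"
  have "fst q = fst r"
    using inj_onD[OF inj_chart[OF assms]] eq q r by (simp add: slit_chart_map slit_chart_dom)
  moreover have "snd q = snd r"
    using q r eq assms calculation
    by (intro tangent_eqI[of _ "fst q" _ i]) (simp_all add: slit_chart_map slit_chart_dom charts_at_iff)
  ultimately show "q = r"
    by (simp add: prod_eq_iff)
qed

lemma slit_transition:
  assumes i: "i \<in> charts_at slit q" and j: "j \<in> charts_at slit q"
  shows "transition slit i j (chart_map slit i q) =
    (transition A i j (chart_map A i (fst q)), jac i j (fst q) (snd q i))"
proof -
  have "chart_inv slit i (chart_map slit i q) = q"
    using i slit_chart_inj[of i] by (auto simp: chart_inv_def charts_at_iff slit_chart_ind)
  then show ?thesis
    using i j tangent_jac[of "snd q" "fst q" i j]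
    by (simp add: transition_def[of slit] slit_charts_at slit_chart_map transition_chart_map)
qed

lemma frechet_derivative_comp_fst:
  assumes "f differentiable (at (fst z))"
  shows "frechet_derivative (\<lambda>z. f (fst z)) (at z) w = frechet_derivative f (at (fst z)) (fst w)"
proof -
  have "((\<lambda>z. f (fst z)) has_derivative (\<lambda>w. frechet_derivative f (at (fst z)) (fst w))) (at z)"
    by (rule has_derivative_compose[OF has_derivative_fst[OF has_derivative_ident]])
      (use assms in \<open>simp add: frechet_derivative_works\<close>)
  then show ?thesis
    by (simp add: frechet_derivative_eqI)
qed

text \<open>The fibre part is the Jacobian at \<open>fst z\<close> applied to \<open>snd z\<close>.
  Writing it as a derivative of a function on the product, in the direction
  \<open>(snd z, 0)\<close>, brings it into the form required by
  \<open>smooth_on_frechet_apply\<close> and \<open>has_derivative_frechet_apply\<close>.\<close>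

lemma slit_transition_image:
  assumes i: "i \<in> chart_ind A" and j: "j \<in> chart_ind A"
    and z: "z \<in> (chart_map A i ` (chart_dom A i \<inter> chart_dom A j)) \<times> (- {0::'e})"
  shows "transition slit i j z = (transition A i j (fst z),
     frechet_derivative (\<lambda>z. transition A i j (fst z)) (at z) (snd z, 0))"
proof -
  obtain q where q: "z = chart_map slit i q" "q \<in> chart_dom slit i" "q \<in> chart_dom slit j"
    using z unfolding slit_chart_image[OF i, symmetric] by blast
  have "i \<in> charts_at slit q" "j \<in> charts_at slit q"
    using q i j by (simp_all add: charts_at_iff slit_chart_ind)
  then show ?thesis
    using slit_transition[of i q j] transition_differentiable[of i "fst q" j]
    by (simp add: q(1) slit_chart_map frechet_derivative_comp_fst slit_charts_at)
qed

lemma smooth_slit_transition_aux: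
  assumes i: "i \<in> chart_ind A" and j: "j \<in> chart_ind A"
  shows "open ((chart_map A i ` (chart_dom A i \<inter> chart_dom A j)) \<times> (- {0::'e}))"
    and "smooth_on ((chart_map A i ` (chart_dom A i \<inter> chart_dom A j)) \<times> (- {0::'e}))
      (\<lambda>z. transition A i j (fst z))"
proof -
  let ?S = "(chart_map A i ` (chart_dom A i \<inter> chart_dom A j)) \<times> (- {0::'e})"
  show S: "open ?S"
    by (intro open_Times open_overlap i j) auto
  show "smooth_on ?S (\<lambda>z. transition A i j (fst z))"
    by (intro smooth_on_compose[OF S open_overlap[OF i j] _ smooth_transition[OF i j]]
        smooth_on_bounded_linear[OF bounded_linear_fst S]) auto
qed

lemma smooth_atlas_slit: "smooth_atlas slit"
proof
  fix i j assume "i \<in> chart_ind slit" and "j \<in> chart_ind slit"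
  then have i: "i \<in> chart_ind A" and j: "j \<in> chart_ind A"
    by (simp_all add: slit_chart_ind)
  note S = smooth_slit_transition_aux[OF i j, folded slit_chart_image[OF i]]
  show "open (chart_map slit i ` (chart_dom slit i \<inter> chart_dom slit j))"
    by (rule S)
  have "smooth_on (chart_map slit i ` (chart_dom slit i \<inter> chart_dom slit j))
    (\<lambda>z. (transition A i j (fst z),
      frechet_derivative (\<lambda>z. transition A i j (fst z)) (at z) (snd z, 0)))"
    using S
    by (intro smooth_on_Pair smooth_on_frechet_apply smooth_on_const
        smooth_on_bounded_linear[OF bounded_linear_snd])
  then show "smooth_on (chart_map slit i ` (chart_dom slit i \<inter> chart_dom slit j)) (transition slit i j)"
    by (rule smooth_on_cong[OF S(1)])
      (rule slit_transition_image[OF i j, folded slit_chart_image[OF i], symmetric])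
next
  fix i assume "i \<in> chart_ind slit"
  then have i: "i \<in> chart_ind A"
    by (simp add: slit_chart_ind)
  show "inj_on (chart_map slit i) (chart_dom slit i)"
    by (rule slit_chart_inj[OF i])
  show "open (chart_map slit i ` chart_dom slit i)"
    using slit_chart_image[OF i, of i] smooth_slit_transition_aux(1)[OF i i] by simp
qed

end

text \<open>The interpretation of \<open>smooth_atlas\<close> for the slit bundle sits in a separate
  locale, so that it is not applied once more to the slit bundle of the slit bundle.\<close>

locale slit_bundle = smooth_atlas A
  for A :: "('i, 'p, real^'n::finite) atlas"

sublocale slit_bundle \<subseteq> slit: smooth_atlas "slit_tangent_bundle A"
  by (rule smooth_atlas_slit)

context slit_bundle
begin

text \<open>The Jacobian of an induced coordinate change is block triangular: base components
  transform among themselves, and vertical vectors transform like tangent vectors of the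
  base.\<close>

lemma slit_jac:
  assumes i: "i \<in> charts_at slit q" and j: "j \<in> charts_at slit q"
  shows fst_slit_jac: "fst (slit.jac i j q w) = jac i j (fst q) (fst w)"
    and slit_jac_vertical: "slit.jac i j q (0, y) = (0, jac i j (fst q) y)"
proof -
  let ?S = "(chart_map A i ` (chart_dom A i \<inter> chart_dom A j)) \<times> (- {0::real^'n})"
  let ?f = "\<lambda>z :: (real^'n) \<times> (real^'n). transition A i j (fst z)"
  let ?z = "chart_map slit i q"
  have ind: "i \<in> chart_ind A" "j \<in> chart_ind A"
    using i j by (auto simp: charts_at_iff slit_chart_ind)
  note S = smooth_slit_transition_aux[OF ind]
  have z: "?z \<in> ?S"
    unfolding slit_chart_image[OF ind(1), symmetric] using i j by (auto simp: charts_at_iff)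
  have diff: "transition A i j differentiable (at (fst z))" if "z \<in> ?S" for z
    using that smooth_on_differentiable[OF smooth_transition[OF ind]] by auto
  have fd: "frechet_derivative ?f (at z) v = frechet_derivative (transition A i j) (at (fst z)) (fst v)"
    if "z \<in> ?S" for z v
    by (rule frechet_derivative_comp_fst[OF diff[OF that]])
  have "((\<lambda>z. (snd z, 0::real^'n)) has_derivative (\<lambda>d. (snd d, 0))) (at ?z)"
    by (auto intro!: derivative_eq_intros)
  from has_derivative_Pair[OF smooth_on_has_derivative[OF S(2) z]
      has_derivative_frechet_apply[OF S(1) z S(2) this]]
  have "(transition slit i j has_derivative (\<lambda>d. (frechet_derivative ?f (at ?z) d,
      frechet_derivative ?f (at ?z) (snd d, 0) +
      frechet_derivative (\<lambda>u. frechet_derivative ?f (at u) d) (at ?z) (snd ?z, 0)))) (at ?z)"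
    by (rule has_derivative_transform_within_open[OF _ S(1) z])
      (simp add: slit_transition_image[OF ind])
  then have J: "slit.jac i j q d = (frechet_derivative ?f (at ?z) d,
      frechet_derivative ?f (at ?z) (snd d, 0) +
      frechet_derivative (\<lambda>u. frechet_derivative ?f (at u) d) (at ?z) (snd ?z, 0))" for d
    by (simp only: frechet_derivative_eqI)
  show "fst (slit.jac i j q w) = jac i j (fst q) (fst w)"
    unfolding J fst_conv fd[OF z] by (simp add: slit_chart_map)
  \<comment> \<open>\<open>?f\<close> does not depend on the fibre variable, so its derivative in
    direction \<open>(0, y)\<close> vanishes in a neighbourhood, and with it the second-order term
    of the Jacobian.\<close>
  have "frechet_derivative (\<lambda>u. 0) (at ?z) = frechet_derivative (\<lambda>u. frechet_derivative ?f (at u) (0, y)) (at ?z)"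
    by (rule frechet_derivative_transform_within_open[OF _ S(1) z])
      (simp_all add: fd linear_0[OF linear_frechet_derivative[OF diff]])
  then have "frechet_derivative (\<lambda>u. frechet_derivative ?f (at u) (0, y)) (at ?z) = (\<lambda>_. 0)"
    by simp
  then show "slit.jac i j q (0, y) = (0, jac i j (fst q) y)"
    unfolding J fd[OF z] fst_conv snd_conv linear_0[OF linear_frechet_derivative[OF diff[OF z]]]
    by (simp add: slit_chart_map)
qed

lemma fst_slit_tangent:
  assumes "w \<in> tangent_space slit q" "i \<in> charts_at slit q" "j \<in> charts_at slit q"
  shows "fst (w j) = jac i j (fst q) (fst (w i))"
  using fst_slit_jac[OF assms(2,3)] slit.tangent_jac[OF assms] by simp

lemma slit_points_charts_at: "q \<in> points slit \<Longrightarrow> \<exists>i. i \<in> charts_at slit q"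
  by (auto simp: points_def charts_at_iff)

lemma slit_liouville_tangent:
  assumes "q \<in> points slit"
  shows "(\<lambda>i. (0, snd q i)) \<in> tangent_space slit q"
proof (rule slit.tangentI)
  fix i j assume i: "i \<in> charts_at slit q" and j: "j \<in> charts_at slit q"
  then show "(0, snd q j) = slit.jac i j q (0, snd q i)"
    using tangent_jac[of "snd q" "fst q" i j] slit_jac_vertical[OF i j]
    by (simp add: slit_charts_at)
next
  fix i assume "i \<notin> charts_at slit q"
  moreover obtain j where "j \<in> charts_at slit q"
    using slit_points_charts_at[OF assms] by blast
  ultimately have "snd q i = 0"
    using tangent_outside[of "snd q" "fst q" i] by (auto simp: slit_charts_at)
  then show "(0, snd q i) = 0"
    by (simp add: zero_prod_def)
qed

end

section \<open>The vertical frame and the vertical bundle\<close>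

lemma sum_scaleR_axis: "(\<Sum>k\<in>UNIV. a k *\<^sub>R axis k 1) = ((\<chi> k. a k) :: real^'n)"
  by (simp add: vec_eq_iff axis_def if_distrib[of "\<lambda>x. _ * x"] cong: if_cong)

context slit_bundle
begin

lemma ddy_self: "i \<in> charts_at slit q \<Longrightarrow> ddy A i k q i = (0, axis k 1)"
  by (simp add: ddy_def slit.coord_field_self)

lemma ddy_tangent: "i \<in> charts_at slit q \<Longrightarrow> ddy A i k q \<in> tangent_space slit q"
  by (simp add: ddy_def slit.coord_field_tangent)

lemma sum_ddy_self:
  "i \<in> charts_at slit q \<Longrightarrow> (\<Sum>k\<in>UNIV. a k *\<^sub>R ddy A i k q i) = (0, \<chi> k. a k)"
  by (simp add: ddy_self prod_eq_iff fst_sum snd_sum sum_scaleR_axis)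

lemma sum_ddy_tangent:
  "i \<in> charts_at slit q \<Longrightarrow> (\<lambda>c. \<Sum>k\<in>UNIV. a k *\<^sub>R ddy A i k q c) \<in> tangent_space slit q"
  by (intro fibre_subspace_linear_combination[OF slit.fibre_subspace_tangent] ddy_tangent)

lemma vertical_expand:
  assumes "w \<in> tangent_space slit q" "i \<in> charts_at slit q" "fst (w i) = 0"
  shows "w = (\<lambda>c. \<Sum>k\<in>UNIV. (snd (w i) $ k) *\<^sub>R ddy A i k q c)"
  by (rule slit.tangent_eqI[OF assms(1) sum_ddy_tangent[OF assms(2)] assms(2)])
    (simp add: sum_ddy_self[OF assms(2)] prod_eq_iff assms(3))

text \<open>The definition of \<open>vertical\<close> quantifies over all charts at
  \<open>q\<close>; the block triangular Jacobian preserves the vanishing of the base part, so one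
  chart decides.\<close>

lemma vertical_iff:
  assumes i: "i \<in> charts_at slit q"
  shows "w \<in> vertical A q \<longleftrightarrow> w \<in> tangent_space slit q \<and> fst (w i) = 0"
proof
  assume "w \<in> vertical A q"
  then obtain a where "w \<in> tangent_space slit q" "w = (\<lambda>c. \<Sum>k\<in>UNIV. a k *\<^sub>R ddy A i k q c)"
    using i unfolding vertical_def by blast
  then show "w \<in> tangent_space slit q \<and> fst (w i) = 0"
    by (simp add: sum_ddy_self[OF i])
next
  assume w: "w \<in> tangent_space slit q \<and> fst (w i) = 0"
  have "fst (w j) = 0" if "j \<in> charts_at slit q" for j
    using fst_slit_tangent[OF _ i that, of w] w i that linear_0[OF linear_jac[of i "fst q" j]]
    by (simp add: slit_charts_at)
  then show "w \<in> vertical A q"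
    unfolding vertical_def using w vertical_expand by blast
qed

end

text \<open>The homogeneity relation is differentiated at fixed \<open>t\<close>. The chain rule
  scales the fibre part of the direction, which is the origin of the factor \<open>t\<close> on
  \<open>snd w\<close>.\<close>

lemma frechet_derivative_fibre_scaling:
  fixes f :: "'a::real_normed_vector \<times> 'b::real_normed_vector \<Rightarrow> real"
  assumes S: "open S" "z \<in> S" and f: "smooth_on S f"
    and cone: "(fst z, t *\<^sub>R snd z) \<in> S"
    and hom: "\<And>z. z \<in> S \<Longrightarrow> f (fst z, t *\<^sub>R snd z) = c * f z"
  shows "frechet_derivative f (at (fst z, t *\<^sub>R snd z)) (fst w, t *\<^sub>R snd w) = c * frechet_derivative f (at z) w"
proof -
  have "((\<lambda>z. (fst z, t *\<^sub>R snd z)) has_derivative (\<lambda>w. (fst w, t *\<^sub>R snd w))) (at z)"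
    by (intro has_derivative_Pair has_derivative_scaleR_right has_derivative_fst has_derivative_snd
        has_derivative_ident)
  from has_derivative_compose[OF this smooth_on_has_derivative[OF f cone]]
  have "((\<lambda>z. f (fst z, t *\<^sub>R snd z)) has_derivative
     (\<lambda>w. frechet_derivative f (at (fst z, t *\<^sub>R snd z)) (fst w, t *\<^sub>R snd w))) (at z)" .
  then have "((\<lambda>z. c * f z) has_derivative
     (\<lambda>w. frechet_derivative f (at (fst z, t *\<^sub>R snd z)) (fst w, t *\<^sub>R snd w))) (at z)"
    by (rule has_derivative_transform_within_open[OF _ S]) (rule hom)
  moreover have "((\<lambda>z. c * f z) has_derivative (\<lambda>w. c * frechet_derivative f (at z) w)) (at z)"
    by (intro has_derivative_mult_right smooth_on_has_derivative[OF f S(2)])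
  ultimately have "(\<lambda>w. frechet_derivative f (at (fst z, t *\<^sub>R snd z)) (fst w, t *\<^sub>R snd w)) =
      (\<lambda>w. c * frechet_derivative f (at z) w)"
    by (rule has_derivative_unique)
  then show ?thesis
    by (rule fun_cong)
qed

section \<open>Finsler metrics: smoothness and fibre homogeneity of the local objects\<close>

locale finsler =
  fixes M :: "('i, 'p, real^'n::finite) atlas" and F :: "('i, 'p, 'n) tm_point \<Rightarrow> real"
  assumes finsler: "finsler_manifold M F"

sublocale finsler \<subseteq> slit_bundle M
  using finsler unfolding finsler_manifold_def slit_bundle_def by (blast intro: smooth_manifold_smooth_atlas)

context finsler
begin

abbreviation coords :: "'i \<Rightarrow> ((real^'n) \<times> (real^'n)) set" where
  "coords i \<equiv> chart_map slit i ` chart_dom slit i"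

lemma open_coords: "i \<in> chart_ind M \<Longrightarrow> open (coords i)"
  by (simp add: slit.open_chart slit_chart_ind)

lemma chart_map_coords: "i \<in> charts_at slit q \<Longrightarrow> chart_map slit i q \<in> coords i"
  by (simp add: charts_at_iff)

lemma coordsE:
  assumes "i \<in> chart_ind M" "z \<in> coords i"
  obtains q where "z = chart_map slit i q" "i \<in> charts_at slit q"
  using assms by (auto simp: charts_at_iff slit_chart_ind)

lemma smooth_Dx: "smooth_on S f \<Longrightarrow> smooth_on S (Dx k f)"
  unfolding Dx_def[abs_def] by (rule smooth_on_frechet_derivative)

lemma smooth_Dy: "smooth_on S f \<Longrightarrow> smooth_on S (Dy k f)"
  unfolding Dy_def[abs_def] by (rule smooth_on_frechet_derivative)

lemma smooth_Fsq:
  assumes i: "i \<in> chart_ind M"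
  shows "smooth_on (coords i) (Fsq M F i)"
proof -
  have "points slit \<inter> chart_dom slit i = chart_dom slit i"
    using i by (auto simp: points_def slit_chart_ind)
  then have "smooth_on (coords i) (\<lambda>u. F (chart_inv slit i u))"
    using finsler i smooth_fun_smooth[of slit "points slit" F i]
    unfolding finsler_manifold_def by (simp add: slit_chart_ind)
  then show ?thesis
    unfolding Fsq_def[abs_def] power2_eq_square
    by (intro smooth_on_mult open_coords i)
qed

lemma smooth_gmat: "i \<in> chart_ind M \<Longrightarrow> smooth_on (coords i) (\<lambda>z. gmat M F i z $ k $ l)"
  unfolding gmat_def vec_lambda_beta
  by (intro smooth_on_mult smooth_on_const smooth_Dy smooth_Fsq open_coords)

lemma invertible_gmat:
  assumes "i \<in> chart_ind M" "z \<in> coords i"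
  shows "invertible (gmat M F i z)"
proof -
  have pos: "\<forall>\<xi>. \<xi> \<noteq> 0 \<longrightarrow> \<xi> \<bullet> (gmat M F i z *v \<xi>) > 0"
    using finsler assms unfolding finsler_manifold_def by blast
  have "\<forall>x. gmat M F i z *v x = 0 \<longrightarrow> x = 0"
  proof (intro allI impI)
    fix x assume "gmat M F i z *v x = 0"
    then show "x = 0"
      using pos[rule_format, of x] by (cases "x = 0") simp_all
  qed
  then show ?thesis
    using invertible_left_inverse matrix_left_invertible_ker by blast
qed

lemma smooth_ginv: "i \<in> chart_ind M \<Longrightarrow> smooth_on (coords i) (ginv M F i k l)"
  unfolding ginv_def[abs_def]
  by (intro smooth_on_matrix_inv open_coords smooth_gmat invertible_gmat)

lemma smooth_snd_nth: "open S \<Longrightarrow> smooth_on S (\<lambda>z. snd z $ h :: real)"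
  by (intro smooth_on_linear[OF bounded_linear_vec_nth] smooth_on_bounded_linear[OF bounded_linear_snd])

lemma smooth_spray: "i \<in> chart_ind M \<Longrightarrow> smooth_on (coords i) (spray M F i j)"
  unfolding spray_def[abs_def]
  by (intro smooth_on_mult smooth_on_const smooth_on_sum smooth_on_diff smooth_Dy smooth_Dx smooth_Fsq
      smooth_ginv smooth_snd_nth open_coords)

lemma smooth_nlc: "i \<in> chart_ind M \<Longrightarrow> smooth_on (coords i) (nlc M F i k j)"
  unfolding nlc_def[abs_def] by (intro smooth_Dy smooth_spray)

text \<open>Scaling by a positive number stays in the fibre and away from the zero section. The
  degree 2 of F^2 starts the count of degrees that ends with \<open>nlc_scale\<close>.\<close>

lemma coords_scale:
  assumes i: "i \<in> chart_ind M" and z: "z \<in> coords i" and t: "t > 0"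
  shows "(fst z, t *\<^sub>R snd z) \<in> coords i"
    and "Fsq M F i (fst z, t *\<^sub>R snd z) = t\<^sup>2 * Fsq M F i z"
proof -
  obtain q where q: "z = chart_map slit i q" "i \<in> charts_at slit q"
    using coordsE[OF i z] .
  define r where "r = (fst q, \<lambda>j. t *\<^sub>R snd q j)"
  have r: "i \<in> charts_at slit r"
    using q(2) t fibre_subspace_scale[OF fibre_subspace_tangent, of "snd q" "fst q" t]
    by (auto simp: r_def slit_charts_at fun_eq_iff)
  have z': "(fst z, t *\<^sub>R snd z) = chart_map slit i r"
    by (simp add: q(1) r_def slit_chart_map)
  then show "(fst z, t *\<^sub>R snd z) \<in> coords i"
    using chart_map_coords[OF r] by simp
  have "i \<in> charts_at M (fst q)" and tan: "snd q \<in> tangent_space M (fst q)"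
    using q(2) by (simp_all add: slit_charts_at)
  then have "fst q \<in> points M"
    by (auto simp: points_def charts_at_iff)
  with tan have "F (fst q, \<lambda>i. t *\<^sub>R snd q i) = t * F (fst q, snd q)"
    using finsler less_imp_le[OF t] unfolding finsler_manifold_def by simp
  then have "F r = t * F q"
    by (simp add: r_def)
  then show "Fsq M F i (fst z, t *\<^sub>R snd z) = t\<^sup>2 * Fsq M F i z"
    unfolding z' unfolding q(1) Fsq_def slit.chart_inv_chart_map[OF r] slit.chart_inv_chart_map[OF q(2)]
    by (simp add: power_mult_distrib)
qed

lemma Dx_scale:
  assumes i: "i \<in> chart_ind M" and z: "z \<in> coords i" and t: "t > 0" and f: "smooth_on (coords i) f"
    and hom: "\<And>z. z \<in> coords i \<Longrightarrow> f (fst z, t *\<^sub>R snd z) = c * f z"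
  shows "Dx k f (fst z, t *\<^sub>R snd z) = c * Dx k f z"
  using frechet_derivative_fibre_scaling[where f = f and t = t and c = c and w = "(axis k 1, 0)",
      OF open_coords[OF i] z f coords_scale(1)[OF i z t] hom]
  by (simp add: Dx_def)

text \<open>A fibre derivative lowers the degree by one. The factor in \<open>hom\<close> is written
  \<open>t * c\<close> because the \<open>t\<close> produced by scaling the direction cancels
  against it.\<close>

lemma Dy_scale:
  assumes i: "i \<in> chart_ind M" and z: "z \<in> coords i" and t: "t > 0" and f: "smooth_on (coords i) f"
    and hom: "\<And>z. z \<in> coords i \<Longrightarrow> f (fst z, t *\<^sub>R snd z) = (t * c) * f z"
  shows "Dy k f (fst z, t *\<^sub>R snd z) = c * Dy k f z"
proof -
  have z': "(fst z, t *\<^sub>R snd z) \<in> coords i"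
    by (rule coords_scale(1)[OF i z t])
  have lin: "linear (frechet_derivative f (at (fst z, t *\<^sub>R snd z)))"
    by (intro linear_frechet_derivative smooth_on_differentiable[OF f z'])
  have "t * Dy k f (fst z, t *\<^sub>R snd z) = frechet_derivative f (at (fst z, t *\<^sub>R snd z)) (t *\<^sub>R (0, axis k 1))"
    unfolding Dy_def linear_cmul[OF lin] by simp
  also have "\<dots> = (t * c) * Dy k f z"
    using frechet_derivative_fibre_scaling[where f = f and t = t and c = "t * c" and w = "(0, axis k 1)",
      OF open_coords[OF i] z f z' hom]
    by (simp add: Dy_def)
  finally show ?thesis
    using t by simp
qed

lemma gmat_scale:
  assumes i: "i \<in> chart_ind M" and z: "z \<in> coords i" and t: "t > 0"
  shows "gmat M F i (fst z, t *\<^sub>R snd z) = gmat M F i z"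
proof -
  \<comment> \<open>The first fibre derivative has degree 1; the form \<open>t * 1\<close> prepares
    the second application of \<open>Dy_scale\<close>, which leaves the factor 1.\<close>
  have "Dy l (Fsq M F i) (fst z, t *\<^sub>R snd z) = (t * 1) * Dy l (Fsq M F i) z" if "z \<in> coords i" for l z
    using Dy_scale[OF i that t smooth_Fsq[OF i], of t] coords_scale(2)[OF i _ t]
    by (simp add: power2_eq_square)
  then have "Dy k (Dy l (Fsq M F i)) (fst z, t *\<^sub>R snd z) = 1 * Dy k (Dy l (Fsq M F i)) z" for k l
    by (intro Dy_scale[OF i z t smooth_Dy[OF smooth_Fsq[OF i]]])
  then show ?thesis
    by (simp add: gmat_def vec_eq_iff)
qed

text \<open>Degree count: the inverse matrix has degree 0, the mixed derivative of F^2 has degree 1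
  and is multiplied by y, and the derivative of F^2 in x has degree 2.\<close>

lemma spray_scale:
  assumes i: "i \<in> chart_ind M" and z: "z \<in> coords i" and t: "t > 0"
  shows "spray M F i j (fst z, t *\<^sub>R snd z) = (t * t) * spray M F i j z"
proof -
  have Dx: "Dx h (Fsq M F i) (fst z, t *\<^sub>R snd z) = (t * t) * Dx h (Fsq M F i) z" if "z \<in> coords i" for h z
    using Dx_scale[OF i that t smooth_Fsq[OF i], of "t * t"] coords_scale(2)[OF i _ t]
    by (simp add: power2_eq_square)
  have Dy: "Dy k (Dx h (Fsq M F i)) (fst z, t *\<^sub>R snd z) = t * Dy k (Dx h (Fsq M F i)) z" for k h
    by (rule Dy_scale[OF i z t smooth_Dx[OF smooth_Fsq[OF i]]]) (rule Dx)
  have ginv: "ginv M F i j k (fst z, t *\<^sub>R snd z) = ginv M F i j k z" for k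
    by (simp add: ginv_def gmat_scale[OF i z t])
  show ?thesis
    unfolding spray_def Dx[OF z] Dy ginv
    by (simp add: sum_distrib_left algebra_simps)
qed

lemma nlc_scale:
  assumes i: "i \<in> chart_ind M" and z: "z \<in> coords i" and t: "t > 0"
  shows "nlc M F i k j (fst z, t *\<^sub>R snd z) = t * nlc M F i k j z"
  unfolding nlc_def by (rule Dy_scale[OF i z t smooth_spray[OF i]]) (rule spray_scale[OF i _ t])

text \<open>Euler's relation for the functions \<open>G\<^sub>k\<^sup>j\<close>; it says that \<open>\<Gamma>\<close> commutes with
  \<open>\<delta>/\<delta>x\<^sup>k\<close>.\<close>

lemma nlc_Euler:
  assumes i: "i \<in> chart_ind M" and z: "z \<in> coords i"
  shows "frechet_derivative (nlc M F i k j) (at z) (0, snd z) = nlc M F i k j z"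
proof -
  have "((\<lambda>t::real. (fst z, t *\<^sub>R snd z)) has_derivative (\<lambda>d. (0, d *\<^sub>R snd z))) (at 1)"
    by (intro has_derivative_Pair has_derivative_const has_derivative_scaleR_left has_derivative_ident)
  moreover have "(nlc M F i k j has_derivative frechet_derivative (nlc M F i k j) (at z)) (at (fst z, 1 *\<^sub>R snd z))"
    using smooth_on_has_derivative[OF smooth_nlc[OF i] z] by simp
  ultimately have "((\<lambda>t. nlc M F i k j (fst z, t *\<^sub>R snd z)) has_derivative
      (\<lambda>d. frechet_derivative (nlc M F i k j) (at z) (0, d *\<^sub>R snd z))) (at 1)"
    by (rule has_derivative_compose)
  then have "((\<lambda>t. t * nlc M F i k j z) has_derivative
      (\<lambda>d. frechet_derivative (nlc M F i k j) (at z) (0, d *\<^sub>R snd z))) (at 1)"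
    by (rule has_derivative_transform_within_open[of _ _ _ _ "{0<..}"])
      (simp_all add: nlc_scale[OF i z])
  moreover have "((\<lambda>t. t * nlc M F i k j z) has_derivative (\<lambda>d. d * nlc M F i k j z)) (at 1)"
    by (intro has_derivative_mult_left has_derivative_ident)
  ultimately have "(\<lambda>d. frechet_derivative (nlc M F i k j) (at z) (0, d *\<^sub>R snd z)) = (\<lambda>d. d * nlc M F i k j z)"
    by (rule has_derivative_unique)
  from fun_cong[OF this, of 1] show ?thesis
    by simp
qed

section \<open>Horizontal, vertical and Liouville distributions\<close>

text \<open>The coordinates of \<delta>/\<delta>x^k in chart \<open>i\<close> as a function of (x,
  y); in contrast to \<open>delta\<close>, a family over all charts, this is a map between Euclidean
  spaces and can be differentiated.\<close>

definition hframe :: "'i \<Rightarrow> 'n \<Rightarrow> (real^'n) \<times> (real^'n) \<Rightarrow> (real^'n) \<times> (real^'n)" where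
  "hframe i k z = (axis k 1, - (\<Sum>j\<in>UNIV. nlc M F i k j z *\<^sub>R axis j 1))"

text \<open>The horizontal lift at \<open>z\<close> of the base vector \<xi>, in the coordinates of
  chart \<open>i\<close>.\<close>

definition hlift :: "'i \<Rightarrow> (real^'n) \<times> (real^'n) \<Rightarrow> real^'n \<Rightarrow> (real^'n) \<times> (real^'n)" where
  "hlift i z \<xi> = (\<Sum>k\<in>UNIV. (\<xi> $ k) *\<^sub>R hframe i k z)"

lemma fst_hlift: "fst (hlift i z \<xi>) = \<xi>"
  by (simp add: hlift_def hframe_def fst_sum sum_scaleR_axis)

lemma linear_hlift: "linear (hlift i z)"
  by (rule linearI) (simp_all add: hlift_def scaleR_add_left sum.distrib scaleR_sum_right)

lemma smooth_hframe: "i \<in> chart_ind M \<Longrightarrow> smooth_on (coords i) (hframe i k)"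
  unfolding hframe_def[abs_def]
  by (intro smooth_on_Pair smooth_on_const smooth_on_minus smooth_on_sum smooth_on_scaleR smooth_nlc
      open_coords)

text \<open>The first component of \<open>hframe\<close> is constant, and the coefficients of the
  second satisfy Euler's relation in degree 1.\<close>

lemma frechet_derivative_hframe_liouville:
  assumes i: "i \<in> chart_ind M" and z: "z \<in> coords i"
  shows "frechet_derivative (hframe i k) (at z) (0, snd z) = (0, snd (hframe i k z))"
proof -
  have "(hframe i k has_derivative
     (\<lambda>w. (0, - (\<Sum>j\<in>UNIV. frechet_derivative (nlc M F i k j) (at z) w *\<^sub>R axis j 1)))) (at z)"
    unfolding hframe_def[abs_def]
    by (intro has_derivative_Pair has_derivative_const has_derivative_minus has_derivative_sum
        has_derivative_scaleR_left smooth_on_has_derivative[OF smooth_nlc[OF i] z])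
  then show ?thesis
    by (simp add: frechet_derivative_eqI nlc_Euler[OF i z] hframe_def)
qed

lemma delta_self:
  "i \<in> charts_at slit q \<Longrightarrow> delta M F i k q i = hframe i k (chart_map slit i q)"
  by (simp add: delta_def slit.coord_field_self ddy_self hframe_def prod_eq_iff fst_sum snd_sum)

lemma delta_tangent: "i \<in> charts_at slit q \<Longrightarrow> delta M F i k q \<in> tangent_space slit q"
  unfolding delta_def
  by (intro fibre_subspace_diff[OF slit.fibre_subspace_tangent] slit.coord_field_tangent
      fibre_subspace_linear_combination[OF slit.fibre_subspace_tangent] ddy_tangent)

lemma sum_delta_self:
  "i \<in> charts_at slit q \<Longrightarrow>
    (\<Sum>k\<in>UNIV. a k *\<^sub>R delta M F i k q i) = hlift i (chart_map slit i q) (\<chi> k. a k)"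
  by (simp add: delta_self hlift_def)

lemma sum_delta_tangent:
  "i \<in> charts_at slit q \<Longrightarrow> (\<lambda>c. \<Sum>k\<in>UNIV. a k *\<^sub>R delta M F i k q c) \<in> tangent_space slit q"
  by (intro fibre_subspace_linear_combination[OF slit.fibre_subspace_tangent] delta_tangent)

lemma horizontal_tangent: "w \<in> horizontal M F q \<Longrightarrow> w \<in> tangent_space slit q"
  unfolding horizontal_def by blast

lemma horizontal_expand:
  assumes "w \<in> horizontal M F q" "i \<in> charts_at slit q"
  shows "w = (\<lambda>c. \<Sum>k\<in>UNIV. (fst (w i) $ k) *\<^sub>R delta M F i k q c)"
proof -
  obtain a where a: "w = (\<lambda>c. \<Sum>k\<in>UNIV. a k *\<^sub>R delta M F i k q c)"
    using assms unfolding horizontal_def by blast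
  have "fst (w i) $ k = a k" for k
    unfolding a sum_delta_self[OF assms(2)] fst_hlift by simp
  then show ?thesis
    using a by simp
qed

lemma horizontal_chart:
  assumes "w \<in> horizontal M F q" "i \<in> charts_at slit q"
  shows "w i = hlift i (chart_map slit i q) (fst (w i))"
  using fun_cong[OF horizontal_expand[OF assms], of i] sum_delta_self[OF assms(2)] by simp

lemma liouville_tangent: "q \<in> points slit \<Longrightarrow> liouville q \<in> tangent_space slit q"
  unfolding liouville_def by (rule slit_liouville_tangent)

lemma liouville_vertical:
  assumes "q \<in> points slit"
  shows "liouville q \<in> vertical M q"
proof -
  obtain i where i: "i \<in> charts_at slit q"
    using slit_points_charts_at[OF assms] by blast
  show ?thesis
    unfolding vertical_iff[OF i] using liouville_tangent[OF assms] by (simp add: liouville_def)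
qed

lemma liouville_nonzero:
  assumes "i \<in> charts_at slit q"
  shows "liouville q \<noteq> (\<lambda>_. 0)"
proof
  assume "liouville q = (\<lambda>_. 0)"
  then have "snd q i = 0"
    by (auto simp: liouville_def zero_prod_def dest: fun_cong[of _ _ i])
  then show False
    using assms tangent_component_nonzero[of "snd q" "fst q" i] by (simp add: slit_charts_at)
qed

lemma vertical_tangent: "w \<in> vertical M q \<Longrightarrow> w \<in> tangent_space slit q"
  unfolding vertical_def by blast

lemma fibre_subspace_vertical:
  assumes "q \<in> points slit"
  shows "fibre_subspace (vertical M q)"
proof -
  obtain i where i: "i \<in> charts_at slit q"
    using slit_points_charts_at[OF assms] by blast
  show ?thesis
    unfolding fibre_subspace_def vertical_iff[OF i]
    by (simp add: fibre_subspaceD[OF slit.fibre_subspace_tangent] vertical_iff[OF i])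
qed

lemma fibre_subspace_liouville:
  fixes q :: "('i, 'p, 'n) tm_point"
  shows "fibre_subspace (liouville_line q)"
  unfolding fibre_subspace_def
proof (intro conjI ballI allI)
  show "(\<lambda>_. 0) \<in> liouville_line q"
    unfolding liouville_line_def by (intro CollectI exI[of _ 0]) simp
next
  fix u v :: "('i, 'n) ttm_vector"
  assume "u \<in> liouville_line q" "v \<in> liouville_line q"
  then obtain a b where "u = (\<lambda>i. a *\<^sub>R liouville q i)" "v = (\<lambda>i. b *\<^sub>R liouville q i)"
    unfolding liouville_line_def by blast
  then show "(\<lambda>i. u i + v i) \<in> liouville_line q"
    unfolding liouville_line_def by (intro CollectI exI[of _ "a + b"]) (simp add: scaleR_add_left)
next
  fix c and u :: "('i, 'n) ttm_vector"
  assume "u \<in> liouville_line q"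
  then obtain a where "u = (\<lambda>i. a *\<^sub>R liouville q i)"
    unfolding liouville_line_def by blast
  then show "(\<lambda>i. c *\<^sub>R u i) \<in> liouville_line q"
    unfolding liouville_line_def by (intro CollectI exI[of _ "c * a"]) simp
qed

lemma liouville_line_vertical:
  assumes "q \<in> points slit"
  shows "liouville_line q \<subseteq> vertical M q"
proof
  fix w :: "('i, 'n) ttm_vector" assume "w \<in> liouville_line q"
  then obtain t where "w = (\<lambda>i. t *\<^sub>R liouville q i)"
    unfolding liouville_line_def by blast
  then show "w \<in> vertical M q"
    by (simp add: fibre_subspace_scale[OF fibre_subspace_vertical[OF assms] liouville_vertical[OF assms]])
qed

end

section \<open>The Sasaki metric and the orthogonal decompositions\<close>

locale finsler_sasaki = finsler M F
  for M :: "('i, 'p, real^'n::finite) atlas" and F :: "('i, 'p, 'n) tm_point \<Rightarrow> real" +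
  fixes G :: "('i, 'p, 'n) ttm_metric"
  assumes sasaki: "sasaki_lift M F G"
begin

abbreviation "H \<equiv> horizontal M F"
abbreviation "V \<equiv> vertical M"
abbreviation "P \<equiv> liouville_vert M G"
abbreviation "L \<equiv> liouville_line :: ('i, 'p, 'n) ttm_dist"
abbreviation "LP \<equiv> liouville_perp M G"

lemma riemannian: "riemannian_metric slit G"
  using sasaki unfolding sasaki_lift_def by blast

context
  fixes q
  assumes q: "q \<in> points slit"
begin

lemma G_metric:
  assumes "u \<in> tangent_space slit q" "v \<in> tangent_space slit q"
  shows "G q u v = G q v u \<and>
    (\<forall>w\<in>tangent_space slit q. \<forall>a b.
       G q (\<lambda>i. a *\<^sub>R u i + b *\<^sub>R v i) w = a * G q u w + b * G q v w) \<and>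
    (u \<noteq> (\<lambda>_. 0) \<longrightarrow> G q u u > 0)"
  by (rule riemannian[unfolded riemannian_metric_def, THEN conjunct1, THEN bspec, OF q,
        THEN bspec, OF assms(1), THEN bspec, OF assms(2)])

lemma G_linear:
  assumes "u \<in> tangent_space slit q" "v \<in> tangent_space slit q" "w \<in> tangent_space slit q"
  shows "G q (\<lambda>i. a *\<^sub>R u i + b *\<^sub>R v i) w = a * G q u w + b * G q v w"
  by (rule G_metric[OF assms(1,2), THEN conjunct2, THEN conjunct1, THEN bspec, OF assms(3), rule_format])

lemma G_sym: "u \<in> tangent_space slit q \<Longrightarrow> v \<in> tangent_space slit q \<Longrightarrow> G q u v = G q v u"
  by (rule G_metric[THEN conjunct1])

lemma G_pos: "u \<in> tangent_space slit q \<Longrightarrow> u \<noteq> (\<lambda>_. 0) \<Longrightarrow> G q u u > 0"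
  by (rule G_metric[THEN conjunct2, THEN conjunct2, THEN mp])

lemma G_definite:
  assumes "u \<in> tangent_space slit q" "G q u u = 0"
  shows "u = (\<lambda>_. 0)"
proof (rule ccontr)
  assume "u \<noteq> (\<lambda>_. 0)"
  from G_pos[OF assms(1) this] assms(2) show False
    by simp
qed

lemma G_add:
  assumes "u \<in> tangent_space slit q" "v \<in> tangent_space slit q" "w \<in> tangent_space slit q"
  shows "G q (\<lambda>i. u i + v i) w = G q u w + G q v w"
  using G_linear[OF assms, of 1 1] by simp

lemma G_diff:
  assumes "u \<in> tangent_space slit q" "v \<in> tangent_space slit q" "w \<in> tangent_space slit q"
  shows "G q (\<lambda>i. u i - v i) w = G q u w - G q v w"
  using G_linear[OF assms, of 1 "-1"] by simp

lemma G_scale: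
  assumes "u \<in> tangent_space slit q" "w \<in> tangent_space slit q"
  shows "G q (\<lambda>i. a *\<^sub>R u i) w = a * G q u w"
  using G_linear[OF assms(1,1,2), of a 0] by simp

lemma G_zero:
  assumes "w \<in> tangent_space slit q"
  shows "G q (\<lambda>_. 0) w = 0"
  using G_scale[OF assms assms, of 0] by simp

lemma G_sum:
  assumes "finite I" "\<And>k. k \<in> I \<Longrightarrow> u k \<in> tangent_space slit q" "w \<in> tangent_space slit q"
  shows "G q (\<lambda>i. \<Sum>k\<in>I. a k *\<^sub>R u k i) w = (\<Sum>k\<in>I. a k * G q (u k) w)"
  using assms(1,2)
proof (induction I)
  case empty
  then show ?case by (simp add: G_zero[OF assms(3)])
next
  case (insert k I)
  have "(\<lambda>i. \<Sum>k\<in>I. a k *\<^sub>R u k i) \<in> tangent_space slit q"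
    by (rule fibre_subspace_linear_combination[OF slit.fibre_subspace_tangent]) (simp add: insert.prems)
  moreover have "(\<lambda>i. a k *\<^sub>R u k i) \<in> tangent_space slit q"
    by (rule fibre_subspace_scale[OF slit.fibre_subspace_tangent]) (simp add: insert.prems)
  ultimately show ?case
    using insert by (simp add: G_add G_scale assms(3))
qed

text \<open>Stated for the frame of one chart and not for \<open>H q\<close>, since it serves to
  prove that the span of the frame is the same in all charts.\<close>

lemma horizontal_frame_orthogonal_vertical:
  assumes i: "i \<in> charts_at slit q" and v: "v \<in> V q"
  shows "G q (\<lambda>c. \<Sum>k\<in>UNIV. a k *\<^sub>R delta M F i k q c) v = 0"
proof -
  have *: "G q (delta M F i k q) (ddy M i l q) = 0" for k l
    using sasaki i unfolding sasaki_lift_def Let_def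
    by (auto simp: charts_at_iff slit_chart_ind)
  have "v = (\<lambda>c. \<Sum>k\<in>UNIV. (snd (v i) $ k) *\<^sub>R ddy M i k q c)"
    using v vertical_iff[OF i] vertical_expand[OF _ i] by blast
  then have "G q v (delta M F i k q) = (\<Sum>l\<in>UNIV. (snd (v i) $ l) * G q (ddy M i l q) (delta M F i k q))" for k
    using G_sum[of UNIV "\<lambda>l. ddy M i l q" "delta M F i k q" "\<lambda>l. snd (v i) $ l"]
      ddy_tangent[OF i] delta_tangent[OF i] by simp
  also have "\<dots> k = 0" for k
    using * G_sym[OF ddy_tangent[OF i] delta_tangent[OF i]] by simp
  finally have "G q (delta M F i k q) v = 0" for k
    using G_sym[OF delta_tangent[OF i] vertical_tangent[OF v]] by simp
  then show ?thesis
    using G_sum[of UNIV "\<lambda>k. delta M F i k q" v a] delta_tangent[OF i] vertical_tangent[OF v] by simp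
qed

text \<open>The horizontal space is the \<open>G\<close>-orthogonal complement of the vertical one; hence it does not
  depend on the chart.\<close>

lemma horizontal_iff:
  assumes i: "i \<in> charts_at slit q"
  shows "w \<in> H q \<longleftrightarrow> w \<in> tangent_space slit q \<and> w i = hlift i (chart_map slit i q) (fst (w i))"
proof
  assume w: "w \<in> H q"
  show "w \<in> tangent_space slit q \<and> w i = hlift i (chart_map slit i q) (fst (w i))"
    by (intro conjI horizontal_tangent[OF w] horizontal_chart[OF w i])
next
  assume w: "w \<in> tangent_space slit q \<and> w i = hlift i (chart_map slit i q) (fst (w i))"
  then have wt: "w \<in> tangent_space slit q" by blast
  have w_eq: "w = (\<lambda>c. \<Sum>k\<in>UNIV. (fst (w i) $ k) *\<^sub>R delta M F i k q c)"
    by (rule slit.tangent_eqI[OF wt sum_delta_tangent[OF i] i])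
      (use w in \<open>simp add: sum_delta_self[OF i]\<close>)
  have w_orth: "G q w v = 0" if "v \<in> V q" for v
    by (subst w_eq) (rule horizontal_frame_orthogonal_vertical[OF i that])
  have "w = (\<lambda>c. \<Sum>k\<in>UNIV. (fst (w j) $ k) *\<^sub>R delta M F j k q c)" if j: "j \<in> charts_at slit q" for j
  proof -
    \<comment> \<open>This combination has the base components of \<open>w\<close> in chart
      \<open>j\<close>, so \<open>w - u\<close> is vertical. It is orthogonal to the vertical space
      as well, hence zero by definiteness.\<close>
    define u where "u = (\<lambda>c. \<Sum>k\<in>UNIV. (fst (w j) $ k) *\<^sub>R delta M F j k q c)"
    have u: "u \<in> tangent_space slit q"
      unfolding u_def by (rule sum_delta_tangent[OF j])
    have d: "(\<lambda>c. w c - u c) \<in> tangent_space slit q"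
      by (rule fibre_subspace_diff[OF slit.fibre_subspace_tangent wt u])
    have "fst (w j - u j) = 0"
      unfolding u_def sum_delta_self[OF j] by (simp add: fst_hlift)
    then have d': "(\<lambda>c. w c - u c) \<in> V q"
      using vertical_iff[OF j] d by blast
    have "G q u (\<lambda>c. w c - u c) = 0"
      unfolding u_def by (rule horizontal_frame_orthogonal_vertical[OF j d'[unfolded u_def]])
    then have "G q (\<lambda>c. w c - u c) (\<lambda>c. w c - u c) = 0"
      using G_diff[OF wt u d] w_orth[OF d'] by simp
    then have "(\<lambda>c. w c - u c) = (\<lambda>_. 0)"
      by (rule G_definite[OF d])
    then have "w = u"
      by (simp add: fun_eq_iff)
    then show ?thesis
      unfolding u_def .
  qed
  then have "\<exists>a. w = (\<lambda>c. \<Sum>k\<in>UNIV. a k *\<^sub>R delta M F j k q c)" if "j \<in> charts_at slit q" for j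
    by (rule exI[of "\<lambda>a. w = (\<lambda>c. \<Sum>k\<in>UNIV. a k *\<^sub>R delta M F j k q c)" "\<lambda>k. fst (w j) $ k"]) (rule that)
  then show "w \<in> H q"
    unfolding horizontal_def by (intro CollectI conjI wt ballI)
qed

lemma horizontal_orthogonal_vertical: "w \<in> H q \<Longrightarrow> v \<in> V q \<Longrightarrow> G q w v = 0"
proof -
  assume w: "w \<in> H q" and v: "v \<in> V q"
  obtain i where i: "i \<in> charts_at slit q"
    using slit_points_charts_at[OF q] by blast
  show ?thesis
    by (subst horizontal_expand[OF w i]) (rule horizontal_frame_orthogonal_vertical[OF i v])
qed

lemma fibre_subspace_horizontal: "fibre_subspace (H q)"
proof -
  obtain i where i: "i \<in> charts_at slit q"
    using slit_points_charts_at[OF q] by blast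
  show ?thesis
    unfolding fibre_subspace_def horizontal_iff[OF i]
  proof (intro conjI ballI allI fibre_subspaceD[OF slit.fibre_subspace_tangent])
    show "(0::(real^'n)\<times>(real^'n)) = hlift i (chart_map slit i q) (fst (0::(real^'n)\<times>(real^'n)))"
      by (simp add: linear_0[OF linear_hlift])
  next
    fix u v assume "u \<in> H q" "v \<in> H q"
    then show "u \<in> tangent_space slit q" "v \<in> tangent_space slit q"
      "u i + v i = hlift i (chart_map slit i q) (fst (u i + v i))"
      by (simp_all add: horizontal_tangent linear_add[OF linear_hlift] flip: horizontal_chart[OF _ i])
  next
    fix c u assume "u \<in> H q"
    then show "u \<in> tangent_space slit q"
      "c *\<^sub>R u i = hlift i (chart_map slit i q) (fst (c *\<^sub>R u i))"
      by (simp_all add: horizontal_tangent linear_cmul[OF linear_hlift] flip: horizontal_chart[OF _ i])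
  qed
qed

lemma fibre_subspace_liouville_vert: "fibre_subspace (P q)"
  unfolding fibre_subspace_def liouville_vert_def mem_Collect_eq
  using fibre_subspaceD[OF fibre_subspace_vertical[OF q]] liouville_tangent[OF q]
  by (simp add: G_zero G_add G_scale vertical_tangent)

lemma fibre_subspace_liouville_perp: "fibre_subspace (LP q)"
  unfolding fibre_subspace_def liouville_perp_def mem_Collect_eq
  using fibre_subspaceD[OF slit.fibre_subspace_tangent[of q]] liouville_tangent[OF q]
  by (simp add: G_zero G_add G_scale)

lemma G_liouville_pos: "G q (liouville q) (liouville q) > 0"
proof -
  obtain i where i: "i \<in> charts_at slit q"
    using slit_points_charts_at[OF q] by blast
  show ?thesis
    by (rule G_pos[OF liouville_tangent[OF q] liouville_nonzero[OF i]])
qed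

lemma horizontal_vertical_disjoint: "H q \<inter> V q \<subseteq> {\<lambda>_. 0}"
proof
  fix w assume w: "w \<in> H q \<inter> V q"
  then have "G q w w = 0" "w \<in> tangent_space slit q"
    using horizontal_orthogonal_vertical horizontal_tangent by blast+
  then show "w \<in> {\<lambda>_. 0}"
    using G_definite[of w] by simp
qed

lemma liouville_perp_line_disjoint: "LP q \<inter> L q \<subseteq> {\<lambda>_. 0}"
proof
  fix w assume w: "w \<in> LP q \<inter> L q"
  then obtain t where t: "w = (\<lambda>i. t *\<^sub>R liouville q i)"
    unfolding liouville_line_def by blast
  have "G q w (liouville q) = 0"
    using w unfolding liouville_perp_def by blast
  then have "t * G q (liouville q) (liouville q) = 0"
    unfolding t by (simp add: G_scale liouville_tangent[OF q])
  then show "w \<in> {\<lambda>_. 0}"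
    using G_liouville_pos by (simp add: t)
qed

lemma liouville_vert_sub_vertical: "P q \<subseteq> V q"
  unfolding liouville_vert_def by blast

lemma liouville_vert_sub_perp: "P q \<subseteq> LP q"
  unfolding liouville_vert_def liouville_perp_def by (auto simp: vertical_tangent)

lemma horizontal_sub_perp: "H q \<subseteq> LP q"
  unfolding liouville_perp_def
  by (auto simp: horizontal_tangent horizontal_orthogonal_vertical[OF _ liouville_vertical[OF q]])

lemma perp_vertical_liouville_vert: "w \<in> LP q \<Longrightarrow> w \<in> V q \<Longrightarrow> w \<in> P q"
  unfolding liouville_vert_def liouville_perp_def by blast

lemma liouville_vert_line_disjoint: "P q \<inter> L q \<subseteq> {\<lambda>_. 0}"
  using liouville_perp_line_disjoint liouville_vert_sub_perp by blast

text \<open>The part in \<open>L\<close> is vertical, so for a vertical sum the part in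
  \<open>H\<close> is horizontal and vertical at once and vanishes; this reduces the claim to
  \<open>P\<close> and \<open>L\<close>.\<close>

lemma liouville_vert_horizontal_line_disjoint: "P q \<inter> dist_sum H L q \<subseteq> {\<lambda>_. 0}"
proof
  fix w assume w: "w \<in> P q \<inter> dist_sum H L q"
  then obtain a b where ab: "w = (\<lambda>i. a i + b i)" "a \<in> H q" "b \<in> L q"
    unfolding dist_sum_def by blast
  have "w \<in> V q" "b \<in> V q"
    using w ab(3) liouville_vert_sub_vertical liouville_line_vertical[OF q] by blast+
  then have "(\<lambda>i. w i - b i) \<in> V q"
    by (rule fibre_subspace_diff[OF fibre_subspace_vertical[OF q]])
  then have "a \<in> V q"
    by (simp add: ab(1))
  then have "a = (\<lambda>_. 0)"
    using horizontal_vertical_disjoint ab(2) by blast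
  then have "w \<in> L q"
    using ab by simp
  then show "w \<in> {\<lambda>_. 0}"
    using w liouville_vert_line_disjoint by blast
qed

text \<open>Lifting the base components of \<open>X q\<close> gives a horizontal vector that differs
  from \<open>X q\<close> by a vertical one. The explicit formula in a chart is the source of the
  smoothness of the horizontal part.\<close>

lemma horizontal_part:
  assumes X: "X q \<in> tangent_space slit q"
  shows "proj H V X q \<in> H q" and "(\<lambda>i. X q i - proj H V X q i) \<in> V q"
    and "i \<in> charts_at slit q \<Longrightarrow> proj H V X q i = hlift i (chart_map slit i q) (fst (X q i))"
proof -
  have main: "proj H V X q \<in> H q \<and> (\<lambda>i. X q i - proj H V X q i) \<in> V q \<and>
      proj H V X q i = hlift i (chart_map slit i q) (fst (X q i))" if i: "i \<in> charts_at slit q" for i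
  proof -
    define u where "u = (\<lambda>c. \<Sum>k\<in>UNIV. (fst (X q i) $ k) *\<^sub>R delta M F i k q c)"
    have ui: "u i = hlift i (chart_map slit i q) (fst (X q i))"
      by (simp add: u_def sum_delta_self[OF i])
    have u: "u \<in> H q"
      unfolding horizontal_iff[OF i] using ui sum_delta_tangent[OF i] by (simp add: fst_hlift u_def)
    have "(\<lambda>i. X q i - u i) \<in> V q"
      unfolding vertical_iff[OF i]
      using fibre_subspace_diff[OF slit.fibre_subspace_tangent X horizontal_tangent[OF u]]
      by (simp add: ui fst_hlift)
    then have "proj H V X q = u" "(\<lambda>i. X q i - u i) \<in> V q"
      using proj_eqI[where E = H and K = V and p = q and X = X, OF fibre_subspace_horizontal fibre_subspace_vertical[OF q]
          horizontal_vertical_disjoint u] by blast+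
    then show ?thesis
      using u ui by simp
  qed
  then show "proj H V X q \<in> H q" "(\<lambda>i. X q i - proj H V X q i) \<in> V q"
    using slit_points_charts_at[OF q] by blast+
  show "i \<in> charts_at slit q \<Longrightarrow> proj H V X q i = hlift i (chart_map slit i q) (fst (X q i))"
    using main by blast
qed

text \<open>\<open>t\<close> is the Gram-Schmidt coefficient of \<open>w\<close> with respect to
  \<Gamma>. As \<Gamma> is vertical, subtracting its multiple keeps a vertical vector
  vertical.\<close>

lemma liouville_part:
  assumes w: "w \<in> tangent_space slit q"
  defines "t \<equiv> G q w (liouville q) / G q (liouville q) (liouville q)"
  shows "(\<lambda>i. w i - t *\<^sub>R liouville q i) \<in> LP q" and "(\<lambda>i. t *\<^sub>R liouville q i) \<in> L q"
    and "w \<in> V q \<Longrightarrow> (\<lambda>i. w i - t *\<^sub>R liouville q i) \<in> P q"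
proof -
  have lt: "(\<lambda>i. t *\<^sub>R liouville q i) \<in> tangent_space slit q"
    by (rule fibre_subspace_scale[OF slit.fibre_subspace_tangent liouville_tangent[OF q]])
  have "G q (\<lambda>i. w i - t *\<^sub>R liouville q i) (liouville q) = 0"
    unfolding G_diff[OF w lt liouville_tangent[OF q]] G_scale[OF liouville_tangent[OF q] liouville_tangent[OF q]]
    using G_liouville_pos by (simp add: t_def)
  then show perp: "(\<lambda>i. w i - t *\<^sub>R liouville q i) \<in> LP q"
    unfolding liouville_perp_def
    using fibre_subspace_diff[OF slit.fibre_subspace_tangent w lt] by blast
  show lin: "(\<lambda>i. t *\<^sub>R liouville q i) \<in> L q"
    unfolding liouville_line_def by blast
  assume "w \<in> V q"
  then have "(\<lambda>i. w i - t *\<^sub>R liouville q i) \<in> V q"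
    by (rule fibre_subspace_diff[OF fibre_subspace_vertical[OF q]])
      (use lin liouville_line_vertical[OF q] in blast)
  then show "(\<lambda>i. w i - t *\<^sub>R liouville q i) \<in> P q"
    by (rule perp_vertical_liouville_vert[OF perp])
qed

end

end

section \<open>Brackets with vertical fields\<close>

lemma frechet_derivative_linear_comp:
  assumes "bounded_linear h" "(f has_derivative f') (at x)"
  shows "frechet_derivative (\<lambda>u. h (f u)) (at x) w = h (f' w)"
  by (simp add: frechet_derivative_eqI[OF bounded_linear.has_derivative[OF assms]])

context finsler
begin

lemma smooth_hlift:
  assumes i: "i \<in> chart_ind M" and S: "open S" "S \<subseteq> coords i" and \<xi>: "smooth_on S \<xi>"
  shows "smooth_on S (\<lambda>u. hlift i u (\<xi> u))"
  unfolding hlift_def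
  by (intro smooth_on_sum smooth_on_scaleR S(1) smooth_on_linear[OF bounded_linear_vec_nth S(1) \<xi>]
      smooth_on_subset[OF smooth_hframe[OF i] S(2)])

lemma chart_image_subset_coords: "chart_map slit i ` (W \<inter> chart_dom slit i) \<subseteq> coords i"
  by blast

lemma liouville_field:
  assumes W: "atlas_open slit W"
  shows "vector_field slit W liouville"
proof (rule vector_fieldI)
  show "liouville p \<in> tangent_space slit p" if "p \<in> W" for p
    by (rule liouville_tangent[OF slit.atlas_open_points[OF W that]])
  fix i assume i: "i \<in> chart_ind slit"
  note S = slit.atlas_open_chart_image[OF W i]
  have "smooth_on (chart_map slit i ` (W \<inter> chart_dom slit i)) (\<lambda>u. (0, snd u))"
    by (intro smooth_on_Pair smooth_on_const smooth_on_bounded_linear[OF bounded_linear_snd] S)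
  then show "smooth_on (chart_map slit i ` (W \<inter> chart_dom slit i)) (\<lambda>u. liouville (chart_inv slit i u) i)"
  proof (rule smooth_on_cong[OF S])
    fix u assume "u \<in> chart_map slit i ` (W \<inter> chart_dom slit i)"
    then obtain q where q: "u = chart_map slit i q" "i \<in> charts_at slit q"
      using i by (auto simp: charts_at_iff)
    show "(0, snd u) = liouville (chart_inv slit i u) i"
      unfolding q(1) slit.chart_inv_chart_map[OF q(2)] by (simp add: liouville_def slit_chart_map)
  qed
qed

lemma delta_field:
  assumes W: "atlas_open slit W" "W \<subseteq> chart_dom slit c" and c: "c \<in> chart_ind M"
  shows "vector_field slit W (delta M F c k)"
proof (rule slit.vector_field_chart[OF W])
  show "c \<in> chart_ind slit" using c by (simp add: slit_chart_ind)
  have at: "c \<in> charts_at slit p" if "p \<in> W" for p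
    using that W c by (auto simp: charts_at_iff slit_chart_ind)
  show "delta M F c k p \<in> tangent_space slit p" if "p \<in> W" for p
    by (rule delta_tangent[OF at[OF that]])
  have Wc: "chart_map slit c ` W = chart_map slit c ` (W \<inter> chart_dom slit c)"
    using W(2) by (simp add: Int_absorb2)
  have S: "open (chart_map slit c ` W)"
    unfolding Wc by (rule slit.atlas_open_chart_image[OF W(1)]) (simp add: c slit_chart_ind)
  have "smooth_on (chart_map slit c ` W) (hframe c k)"
    by (rule smooth_on_subset[OF smooth_hframe[OF c]]) (use W(2) in blast)
  then show "smooth_on (chart_map slit c ` W) (\<lambda>u. delta M F c k (chart_inv slit c u) c)"
    by (rule smooth_on_cong[OF S]) (auto simp: slit.chart_inv_chart_map[OF at] delta_self[OF at])
qed

lemma ddy_field: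
  assumes W: "atlas_open slit W" "W \<subseteq> chart_dom slit c" and c: "c \<in> chart_ind M"
  shows "vector_field slit W (ddy M c k)"
proof (rule slit.vector_field_chart[OF W])
  show "c \<in> chart_ind slit" using c by (simp add: slit_chart_ind)
  have at: "c \<in> charts_at slit p" if "p \<in> W" for p
    using that W c by (auto simp: charts_at_iff slit_chart_ind)
  show "ddy M c k p \<in> tangent_space slit p" if "p \<in> W" for p
    by (rule ddy_tangent[OF at[OF that]])
  have Wc: "chart_map slit c ` W = chart_map slit c ` (W \<inter> chart_dom slit c)"
    using W(2) by (simp add: Int_absorb2)
  have S: "open (chart_map slit c ` W)"
    unfolding Wc by (rule slit.atlas_open_chart_image[OF W(1)]) (simp add: c slit_chart_ind)
  show "smooth_on (chart_map slit c ` W) (\<lambda>u. ddy M c k (chart_inv slit c u) c)"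
    by (rule smooth_on_cong[OF S smooth_on_const[of _ "(0, axis k 1)"]])
      (auto simp: slit.chart_inv_chart_map[OF at] ddy_self[OF at])
qed

lemma smooth_fun_component:
  assumes W: "atlas_open slit W" "W \<subseteq> chart_dom slit c" and c: "c \<in> chart_ind M"
    and X: "vector_field slit W X" and h: "bounded_linear h"
  shows "smooth_fun slit W (\<lambda>q. h (X q c))"
proof (rule slit.smooth_fun_chart[OF W])
  show c': "c \<in> chart_ind slit" using c by (simp add: slit_chart_ind)
  have Wc: "chart_map slit c ` W = chart_map slit c ` (W \<inter> chart_dom slit c)"
    using W(2) by (simp add: Int_absorb2)
  show "smooth_on (chart_map slit c ` W) ((\<lambda>q. h (X q c)) \<circ> chart_inv slit c)"
    unfolding Wc o_def
    by (rule smooth_on_linear[OF h slit.atlas_open_chart_image[OF W(1) c'] vector_field_smooth[OF X c']])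
qed

lemma fst_derivative_vertical:
  assumes W: "atlas_open slit W" "p \<in> W" and X: "X \<in> sections slit (vertical M) W"
    and i: "i \<in> charts_at slit p"
  shows "fst (frechet_derivative (\<lambda>u. X (chart_inv slit i u) i) (at (chart_map slit i p)) w) = 0"
proof -
  note hd = slit.vector_field_has_derivative[OF sections_vector_field[OF X] W(2) i]
  have "((\<lambda>u. fst (X (chart_inv slit i u) i)) has_derivative
     (\<lambda>w. fst (frechet_derivative (\<lambda>u. X (chart_inv slit i u) i) (at (chart_map slit i p)) w)))
     (at (chart_map slit i p))"
    by (rule has_derivative_fst[OF hd])
  moreover have "((\<lambda>u. fst (X (chart_inv slit i u) i)) has_derivative (\<lambda>w. 0)) (at (chart_map slit i p))"
  proof (rule has_derivative_transform_within_open[OF has_derivative_const])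
    have ind: "i \<in> chart_ind slit" using i by (simp add: charts_at_iff)
    show "open (chart_map slit i ` (W \<inter> chart_dom slit i))"
      by (rule slit.atlas_open_chart_image[OF W(1) ind])
    show "chart_map slit i p \<in> chart_map slit i ` (W \<inter> chart_dom slit i)"
      using W(2) i by (auto simp: charts_at_iff)
    fix u assume "u \<in> chart_map slit i ` (W \<inter> chart_dom slit i)"
    then obtain q where q: "u = chart_map slit i q" "q \<in> W" "i \<in> charts_at slit q"
      using ind by (auto simp: charts_at_iff)
    show "0 = fst (X (chart_inv slit i u) i)"
      unfolding q(1) slit.chart_inv_chart_map[OF q(3)]
      using vertical_iff[OF q(3), of "X q"] sections_mem[OF X q(2)] by simp
  qed
  ultimately have "(\<lambda>w. fst (frechet_derivative (\<lambda>u. X (chart_inv slit i u) i) (at (chart_map slit i p)) w)) = (\<lambda>w. 0)"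
    by (rule has_derivative_unique)
  then show ?thesis
    by (rule fun_cong)
qed

text \<open>The base components of the vertical field \<open>X\<close> vanish identically on
  \<open>W\<close>, so the term of the bracket that differentiates \<open>X\<close> has no base
  part.\<close>

lemma fst_bracket_vertical:
  assumes "atlas_open slit W" "p \<in> W" "X \<in> sections slit (vertical M) W" "i \<in> charts_at slit p"
  shows "fst (lie_bracket slit X Y p i) =
    fst (frechet_derivative (\<lambda>u. Y (chart_inv slit i u) i) (at (chart_map slit i p)) (X p i))"
  by (simp add: slit.lie_bracket_chart[OF assms(4)] fst_derivative_vertical[OF assms])

text \<open>Integrability of the vertical foliation: neither of the two derivative terms of the
  bracket has a base part.\<close>

lemma bracket_vertical:
  assumes W: "atlas_open slit W" "p \<in> W" and X: "X \<in> sections slit (vertical M) W"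
    and Y: "Y \<in> sections slit (vertical M) W"
  shows "lie_bracket slit X Y p \<in> vertical M p"
proof -
  obtain i where i: "i \<in> charts_at slit p"
    using slit.atlas_open_charts_at[OF W] by blast
  show ?thesis
    unfolding vertical_iff[OF i] fst_bracket_vertical[OF W X i] fst_derivative_vertical[OF W Y i]
    using slit.lie_bracket_tangent[OF W sections_vector_field[OF X] sections_vector_field[OF Y]] by simp
qed

text \<open>Product rule for a \<Gamma>; the coordinates (0, y) of \<Gamma> are linear, so
  differentiating them returns the fibre part of the direction.\<close>

lemma liouville_multiple_derivative:
  assumes W: "atlas_open slit W" "p \<in> W" and a: "smooth_fun slit W a"
    and X: "\<And>q. q \<in> W \<Longrightarrow> X q = (\<lambda>i. a q *\<^sub>R liouville q i)" and i: "i \<in> charts_at slit p"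
  shows "frechet_derivative (\<lambda>u. X (chart_inv slit i u) i) (at (chart_map slit i p)) w =
    a p *\<^sub>R (0, snd w) +
    frechet_derivative (a \<circ> chart_inv slit i) (at (chart_map slit i p)) w *\<^sub>R (0, snd p i)"
proof -
  have ind: "i \<in> chart_ind slit" using i by (simp add: charts_at_iff)
  have "((\<lambda>u. (a \<circ> chart_inv slit i) u *\<^sub>R (0::real^'n, snd u)) has_derivative
    (\<lambda>w. (a \<circ> chart_inv slit i) (chart_map slit i p) *\<^sub>R (0, snd w) +
      frechet_derivative (a \<circ> chart_inv slit i) (at (chart_map slit i p)) w *\<^sub>R (0, snd (chart_map slit i p))))
    (at (chart_map slit i p))"
    by (intro has_derivative_scaleR has_derivative_Pair has_derivative_const has_derivative_snd
        has_derivative_ident slit.smooth_fun_differentiable[OF a W(2) i, unfolded frechet_derivative_works])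
  then have "((\<lambda>u. X (chart_inv slit i u) i) has_derivative
    (\<lambda>w. (a \<circ> chart_inv slit i) (chart_map slit i p) *\<^sub>R (0, snd w) +
      frechet_derivative (a \<circ> chart_inv slit i) (at (chart_map slit i p)) w *\<^sub>R (0, snd (chart_map slit i p))))
    (at (chart_map slit i p))"
  proof (rule has_derivative_transform_within_open)
    show "open (chart_map slit i ` (W \<inter> chart_dom slit i))"
      by (rule slit.atlas_open_chart_image[OF W(1) ind])
    show "chart_map slit i p \<in> chart_map slit i ` (W \<inter> chart_dom slit i)"
      using W(2) i by (auto simp: charts_at_iff)
    fix u assume "u \<in> chart_map slit i ` (W \<inter> chart_dom slit i)"
    then obtain q where q: "u = chart_map slit i q" "q \<in> W" "i \<in> charts_at slit q"
      using ind by (auto simp: charts_at_iff)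
    show "(a \<circ> chart_inv slit i) u *\<^sub>R (0, snd u) = X (chart_inv slit i u) i"
      unfolding o_def q(1) slit.chart_inv_chart_map[OF q(3)] X[OF q(2)]
      by (simp add: liouville_def slit_chart_map)
  qed
  from fun_cong[OF frechet_derivative_eqI[OF this], of w] show ?thesis
    unfolding o_apply slit.chart_inv_chart_map[OF i] by (simp add: slit_chart_map)
qed

lemma bracket_liouville_multiples:
  assumes W: "atlas_open slit W" "p \<in> W" and a: "smooth_fun slit W a" and b: "smooth_fun slit W b"
    and X: "\<And>q. q \<in> W \<Longrightarrow> X q = (\<lambda>i. a q *\<^sub>R liouville q i)"
    and Y: "\<And>q. q \<in> W \<Longrightarrow> Y q = (\<lambda>i. b q *\<^sub>R liouville q i)"
    and vf: "vector_field slit W X" "vector_field slit W Y"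
  shows "lie_bracket slit X Y p \<in> liouville_line p"
proof -
  obtain i where i: "i \<in> charts_at slit p"
    using slit.atlas_open_charts_at[OF W] by blast
  \<comment> \<open>The coefficient X(b) - Y(a). The terms that differentiate y are both
    \<open>a p * b p\<close> times \<Gamma> and cancel.\<close>
  let ?t = "frechet_derivative (b \<circ> chart_inv slit i) (at (chart_map slit i p)) (X p i) -
    frechet_derivative (a \<circ> chart_inv slit i) (at (chart_map slit i p)) (Y p i)"
  have p: "p \<in> points slit"
    by (rule slit.atlas_open_points[OF W])
  have "lie_bracket slit X Y p = (\<lambda>i. ?t *\<^sub>R liouville p i)"
  proof (rule slit.tangent_eqI[OF slit.lie_bracket_tangent[OF W vf] _ i])
    show "(\<lambda>i. ?t *\<^sub>R liouville p i) \<in> tangent_space slit p"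
      by (rule fibre_subspace_scale[OF slit.fibre_subspace_tangent liouville_tangent[OF p]])
    have "lie_bracket slit X Y p i =
        (b p *\<^sub>R (0, snd (X p i)) +
          frechet_derivative (b \<circ> chart_inv slit i) (at (chart_map slit i p)) (X p i) *\<^sub>R (0, snd p i)) -
        (a p *\<^sub>R (0, snd (Y p i)) +
          frechet_derivative (a \<circ> chart_inv slit i) (at (chart_map slit i p)) (Y p i) *\<^sub>R (0, snd p i))"
      unfolding slit.lie_bracket_chart[OF i]
      by (intro arg_cong2[where f = minus] liouville_multiple_derivative[where X = X and a = a, OF W a X i]
        liouville_multiple_derivative[where X = Y and a = b, OF W b Y i])
    also have "\<dots> = ?t *\<^sub>R liouville p i"
      unfolding X[OF W(2)] Y[OF W(2)] by (simp add: liouville_def algebra_simps)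
    finally show "lie_bracket slit X Y p i = ?t *\<^sub>R liouville p i" .
  qed
  then show ?thesis
    unfolding liouville_line_def by blast
qed

text \<open>Since \<open>\<Gamma>\<close> commutes with \<open>\<delta>/\<delta>x\<^sup>k\<close>, the bracket of \<open>a \<Gamma>\<close> with a horizontal field \<open>Z\<close> is the
  horizontal lift of the derivative of the components of \<open>Z\<close>, up to a multiple of \<open>\<Gamma>\<close>.\<close>

lemma bracket_liouville_horizontal:
  assumes W: "atlas_open slit W" "p \<in> W" and a: "smooth_fun slit W a"
    and X: "\<And>q. q \<in> W \<Longrightarrow> X q = (\<lambda>i. a q *\<^sub>R liouville q i)"
    and Z: "Z \<in> sections slit (horizontal M F) W"
    and i: "i \<in> charts_at slit p"
  shows "lie_bracket slit X Z p i =
    hlift i (chart_map slit i p)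
      (fst (frechet_derivative (\<lambda>u. Z (chart_inv slit i u) i) (at (chart_map slit i p)) (X p i))) -
    frechet_derivative (a \<circ> chart_inv slit i) (at (chart_map slit i p)) (Z p i) *\<^sub>R liouville p i"
proof -
  let ?z = "chart_map slit i p" and ?S = "chart_map slit i ` (W \<inter> chart_dom slit i)"
  let ?Z = "\<lambda>u. Z (chart_inv slit i u) i"
  let ?D = "frechet_derivative ?Z (at ?z)"
  have ind: "i \<in> chart_ind slit" "i \<in> chart_ind M"
    using i by (simp_all add: charts_at_iff slit_chart_ind)
  have z: "?z \<in> coords i"
    by (rule chart_map_coords[OF i])
  have S: "open ?S" "?z \<in> ?S"
    using slit.atlas_open_chart_image[OF W(1) ind(1)] W(2) i by (auto simp: charts_at_iff)
  note hd = slit.vector_field_has_derivative[OF sections_vector_field[OF Z] W(2) i]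
  have "((\<lambda>u. \<Sum>k\<in>UNIV. (fst (?Z u) $ k) *\<^sub>R hframe i k u) has_derivative
    (\<lambda>w. \<Sum>k\<in>UNIV. (fst (?Z ?z) $ k) *\<^sub>R frechet_derivative (hframe i k) (at ?z) w +
      (fst (?D w) $ k) *\<^sub>R hframe i k ?z)) (at ?z)"
    by (intro has_derivative_sum has_derivative_scaleR smooth_on_has_derivative[OF smooth_hframe[OF ind(2)] z]
        bounded_linear.has_derivative[OF bounded_linear_vec_nth] has_derivative_fst[OF hd])
  then have "(?Z has_derivative
    (\<lambda>w. \<Sum>k\<in>UNIV. (fst (?Z ?z) $ k) *\<^sub>R frechet_derivative (hframe i k) (at ?z) w +
      (fst (?D w) $ k) *\<^sub>R hframe i k ?z)) (at ?z)"
  proof (rule has_derivative_transform_within_open[OF _ S])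
    fix u assume "u \<in> ?S"
    then obtain q where q: "u = chart_map slit i q" "q \<in> W" "i \<in> charts_at slit q"
      using ind by (auto simp: charts_at_iff)
    show "(\<Sum>k\<in>UNIV. (fst (?Z u) $ k) *\<^sub>R hframe i k u) = ?Z u"
      using horizontal_chart[OF sections_mem[OF Z q(2)] q(3)]
      by (simp add: q(1) slit.chart_inv_chart_map[OF q(3)] hlift_def)
  qed
  from fun_cong[OF has_derivative_unique[OF hd this]]
  have D: "?D w = (\<Sum>k\<in>UNIV. (fst (?Z ?z) $ k) *\<^sub>R frechet_derivative (hframe i k) (at ?z) w) +
      hlift i ?z (fst (?D w))" for w
    unfolding sum.distrib hlift_def .
  have Xp: "X p i = a p *\<^sub>R (0, snd ?z)"
    by (simp add: X[OF W(2)] liouville_def slit_chart_map)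
  have "frechet_derivative (hframe i k) (at ?z) (X p i) = a p *\<^sub>R (0, snd (hframe i k ?z))" for k
    unfolding Xp linear_cmul[OF linear_frechet_derivative[OF smooth_on_differentiable[OF smooth_hframe[OF ind(2)] z]]]
      frechet_derivative_hframe_liouville[OF ind(2) z] by (rule refl)
  then have "(\<Sum>k\<in>UNIV. (fst (?Z ?z) $ k) *\<^sub>R frechet_derivative (hframe i k) (at ?z) (X p i)) =
     a p *\<^sub>R (0, snd (hlift i ?z (fst (Z p i))))"
    by (simp add: slit.chart_inv_chart_map[OF i] hlift_def prod_eq_iff fst_sum snd_sum scaleR_sum_right
        mult.commute)
  also have "\<dots> = a p *\<^sub>R (0, snd (Z p i))"
    using horizontal_chart[OF sections_mem[OF Z W(2)] i] by simp
  \<comment> \<open>The term \<open>a p *\<^sub>R (0, snd (Z p i))\<close>, which comes from Euler's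
    relation, equals what differentiating y in a \<Gamma> contributes to the other half of the
    bracket; the two cancel.\<close>
  finally have DX: "?D (X p i) = a p *\<^sub>R (0, snd (Z p i)) + hlift i ?z (fst (?D (X p i)))"
    using D[of "X p i"] by simp
  have "lie_bracket slit X Z p i = ?D (X p i) -
      (a p *\<^sub>R (0, snd (Z p i)) +
        frechet_derivative (a \<circ> chart_inv slit i) (at ?z) (Z p i) *\<^sub>R (0, snd p i))"
    unfolding slit.lie_bracket_chart[OF i]
    by (intro arg_cong2[where f = minus] refl liouville_multiple_derivative[where X = X and a = a, OF W a X i])
  also have "\<dots> = (a p *\<^sub>R (0, snd (Z p i)) + hlift i ?z (fst (?D (X p i)))) -
      (a p *\<^sub>R (0, snd (Z p i)) +
        frechet_derivative (a \<circ> chart_inv slit i) (at ?z) (Z p i) *\<^sub>R (0, snd p i))"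
    by (rule arg_cong2[where f = minus, OF DX refl])
  finally show ?thesis
    by (simp only: liouville_def add_diff_cancel_left)
qed

end

section \<open>The three connections\<close>

context finsler_sasaki
begin

section \<open>Smoothness of the horizontal, vertical and Liouville parts\<close>

lemma horizontal_part_field:
  assumes W: "atlas_open slit W" and X: "vector_field slit W X"
  shows "vector_field slit W (proj H V X)"
proof (rule vector_fieldI)
  have tan: "X p \<in> tangent_space slit p" "p \<in> points slit" if "p \<in> W" for p
    using vector_field_tangent[OF X that] slit.atlas_open_points[OF W that] .
  show "proj H V X p \<in> tangent_space slit p" if "p \<in> W" for p
    by (rule horizontal_tangent[OF horizontal_part(1)[where X = X, OF tan(2)[OF that] tan(1)[OF that]]])
  fix i assume i: "i \<in> chart_ind slit"
  then have i': "i \<in> chart_ind M" by (simp add: slit_chart_ind)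
  note S = slit.atlas_open_chart_image[OF W i]
  have "smooth_on (chart_map slit i ` (W \<inter> chart_dom slit i)) (\<lambda>u. hlift i u (fst (X (chart_inv slit i u) i)))"
    by (rule smooth_hlift[OF i' S chart_image_subset_coords
          smooth_on_linear[OF bounded_linear_fst S vector_field_smooth[OF X i]]])
  then show "smooth_on (chart_map slit i ` (W \<inter> chart_dom slit i)) (\<lambda>u. proj H V X (chart_inv slit i u) i)"
  proof (rule smooth_on_cong[OF S])
    fix u assume "u \<in> chart_map slit i ` (W \<inter> chart_dom slit i)"
    then obtain q where q: "u = chart_map slit i q" "q \<in> W" "i \<in> charts_at slit q"
      using i by (auto simp: charts_at_iff)
    show "hlift i u (fst (X (chart_inv slit i u) i)) = proj H V X (chart_inv slit i u) i"
      unfolding q(1) slit.chart_inv_chart_map[OF q(3)]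
      by (rule horizontal_part(3)[where X = X, OF tan(2)[OF q(2)] tan(1)[OF q(2)] q(3), symmetric])
  qed
qed

lemma horizontal_part_section:
  assumes W: "atlas_open slit W" and X: "vector_field slit W X"
  shows "proj H V X \<in> sections slit H W"
  by (rule sectionsI[OF horizontal_part_field[OF W X]])
    (rule horizontal_part(1)[where X = X, OF slit.atlas_open_points[OF W] vector_field_tangent[OF X]])

lemma vertical_part_section:
  assumes W: "atlas_open slit W" and X: "vector_field slit W X"
  shows "(\<lambda>q i. X q i - proj H V X q i) \<in> sections slit V W"
  by (rule sectionsI[OF slit.vector_field_diff[OF W X horizontal_part_field[OF W X]]])
    (rule horizontal_part(2)[where X = X, OF slit.atlas_open_points[OF W] vector_field_tangent[OF X]])

text \<open>Membership in the line gives a coefficient at each point without any regularity;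
  expressing it as a quotient of values of \<open>G\<close> shows that it is smooth.\<close>

lemma liouville_section_multiple:
  assumes W: "atlas_open slit W" and X: "X \<in> sections slit L W"
  obtains a where "smooth_fun slit W a" "\<And>q. q \<in> W \<Longrightarrow> X q = (\<lambda>i. a q *\<^sub>R liouville q i)"
proof
  let ?a = "\<lambda>q. G q (X q) (liouville q) / G q (liouville q) (liouville q)"
  have sm: "smooth_fun slit W (\<lambda>q. G q (Y q) (liouville q))" if "vector_field slit W Y" for Y
    using riemannian[unfolded riemannian_metric_def, THEN conjunct2] W that liouville_field[OF W] by blast
  show "smooth_fun slit W ?a"
    by (rule slit.smooth_fun_divide[OF W sm[OF sections_vector_field[OF X]] sm[OF liouville_field[OF W]]])
      (use G_liouville_pos[OF slit.atlas_open_points[OF W]] in fastforce)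
  fix q assume q: "q \<in> W"
  note pt = slit.atlas_open_points[OF W q]
  obtain t where t: "X q = (\<lambda>i. t *\<^sub>R liouville q i)"
    using sections_mem[OF X q] unfolding liouville_line_def by blast
  have "?a q = t"
    unfolding t G_scale[OF pt liouville_tangent[OF pt] liouville_tangent[OF pt]]
    using G_liouville_pos[OF pt] by simp
  then show "X q = (\<lambda>i. ?a q *\<^sub>R liouville q i)"
    by (simp only: t)
qed

lemma bracket_liouville_line:
  assumes W: "atlas_open slit W" "p \<in> W" and X: "X \<in> sections slit L W" and Y: "Y \<in> sections slit L W"
  shows "lie_bracket slit X Y p \<in> L p"
proof -
  obtain a where a: "smooth_fun slit W a" "\<And>q. q \<in> W \<Longrightarrow> X q = (\<lambda>i. a q *\<^sub>R liouville q i)"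
    by (rule liouville_section_multiple[OF W(1) X]) (rule that)
  obtain b where b: "smooth_fun slit W b" "\<And>q. q \<in> W \<Longrightarrow> Y q = (\<lambda>i. b q *\<^sub>R liouville q i)"
    by (rule liouville_section_multiple[OF W(1) Y]) (rule that)
  show ?thesis
    by (rule bracket_liouville_multiples[where X = X and Y = Y and a = a and b = b, OF W a(1) b(1) a(2) b(2)
          sections_vector_field[OF X] sections_vector_field[OF Y]])
qed

lemma sections_vertical_subset:
  assumes W: "atlas_open slit W"
  shows sections_P_V: "sections slit P W \<subseteq> sections slit V W"
    and sections_L_V: "sections slit L W \<subseteq> sections slit V W"
  by (rule sections_mono[OF liouville_vert_sub_vertical[OF slit.atlas_open_points[OF W]]],
      assumption, rule sections_mono[OF liouville_line_vertical[OF slit.atlas_open_points[OF W]]])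

section \<open>Existence of the projections along the Liouville line\<close>

lemma proj_liouville_vert:
  assumes q: "q \<in> points slit" and X: "X q \<in> V q"
  shows "proj P L X q \<in> P q" and "(\<lambda>i. X q i - proj P L X q i) \<in> L q"
proof -
  define t where "t = G q (X q) (liouville q) / G q (liouville q) (liouville q)"
  note part = liouville_part[OF q vertical_tangent[OF X], folded t_def]
  have d: "(\<lambda>i. X q i - (X q i - t *\<^sub>R liouville q i)) \<in> L q"
    using part(2) by simp
  have "proj P L X q = (\<lambda>i. X q i - t *\<^sub>R liouville q i)"
    by (rule proj_eqI[where E = P and K = L and p = q and X = X, OF fibre_subspace_liouville_vert[OF q]
          fibre_subspace_liouville liouville_vert_line_disjoint[OF q] part(3)[OF X] d])
  then show "proj P L X q \<in> P q" "(\<lambda>i. X q i - proj P L X q i) \<in> L q"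
    using part(3)[OF X] d by simp_all
qed

lemma proj_liouville_perp:
  assumes q: "q \<in> points slit" and X: "X q \<in> tangent_space slit q"
  shows "proj LP L X q \<in> LP q" and "(\<lambda>i. X q i - proj LP L X q i) \<in> L q"
proof -
  define t where "t = G q (X q) (liouville q) / G q (liouville q) (liouville q)"
  note part = liouville_part[OF q X, folded t_def]
  have d: "(\<lambda>i. X q i - (X q i - t *\<^sub>R liouville q i)) \<in> L q"
    using part(2) by simp
  have "proj LP L X q = (\<lambda>i. X q i - t *\<^sub>R liouville q i)"
    by (rule proj_eqI[where E = LP and K = L and p = q and X = X, OF fibre_subspace_liouville_perp[OF q]
          fibre_subspace_liouville liouville_perp_line_disjoint[OF q] part(1) d])
  then show "proj LP L X q \<in> LP q" "(\<lambda>i. X q i - proj LP L X q i) \<in> L q"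
    using part(1) d by simp_all
qed

text \<open>For the threefold splitting the horizontal part is removed first, then the Liouville
  part of the vertical remainder.\<close>

lemma proj_liouville_vert_tangent:
  assumes q: "q \<in> points slit" and X: "X q \<in> tangent_space slit q"
  shows "proj P (dist_sum H L) X q \<in> P q"
proof -
  define v where "v = (\<lambda>i. X q i - proj H V X q i)"
  have v: "v \<in> V q"
    unfolding v_def by (rule horizontal_part(2)[where X = X, OF q X])
  define t where "t = G q v (liouville q) / G q (liouville q) (liouville q)"
  note part = liouville_part[OF q vertical_tangent[OF v], folded t_def]
  have d: "(\<lambda>i. X q i - (v i - t *\<^sub>R liouville q i)) \<in> dist_sum H L q"
    using dist_sumI[where E = H and K = L and p = q and a = "proj H V X q"
        and b = "\<lambda>i. t *\<^sub>R liouville q i", OF horizontal_part(1)[where X = X, OF q X] part(2)]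
    by (simp add: v_def algebra_simps)
  have "proj P (dist_sum H L) X q = (\<lambda>i. v i - t *\<^sub>R liouville q i)"
    by (rule proj_eqI[where E = P and K = "dist_sum H L" and p = q and X = X,
          OF fibre_subspace_liouville_vert[OF q]
          fibre_subspace_dist_sum[where E = H and K = L and p = q, OF fibre_subspace_horizontal[OF q] fibre_subspace_liouville]
          liouville_vert_horizontal_line_disjoint[OF q] part(3)[OF v] d])
  then show ?thesis
    using part(3)[OF v] by simp
qed

section \<open>The Vaisman connection on the complement of the Liouville line in the vertical
  bundle\<close>

lemma vaisman_basic:
  assumes D: "vaisman_connection M F G D"
  shows "basic_connection slit V P L D"
proof -
  note D' = D[unfolded vaisman_connection_def Let_def]
  have conn: "connection slit V D"
    by (rule D'[THEN conjunct1])
  note D'' = D'[THEN conjunct2, THEN spec, THEN mp]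
  have a: "D X Y \<in> sections slit P W"
    if W: "atlas_open slit W" and X: "X \<in> sections slit V W" and Y: "Y \<in> sections slit P W" for W X Y
    by (rule D''[OF W, THEN conjunct1, THEN bspec, OF X, THEN conjunct1, THEN bspec, OF Y])
  have a': "D X Y \<in> sections slit L W"
    if W: "atlas_open slit W" and X: "X \<in> sections slit V W" and Y: "Y \<in> sections slit L W" for W X Y
    by (rule D''[OF W, THEN conjunct1, THEN bspec, OF X, THEN conjunct2, THEN bspec, OF Y])
  have b: "proj P L (torsion slit D X Y) q = (\<lambda>_. 0)"
    if W: "atlas_open slit W" and X: "X \<in> sections slit V W" and Y: "Y \<in> sections slit V W"
      and YP: "Y \<in> sections slit P W" and q: "q \<in> W" for W X Y q
    by (rule D''[OF W, THEN conjunct2, THEN conjunct1, THEN bspec, OF X, THEN bspec, OF Y, THEN conjunct1,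
          THEN mp, OF disjI2[OF YP], THEN bspec, OF q])
  have d: "D X Y q = proj P (dist_sum H L) (lie_bracket slit X Y) q"
    if W: "atlas_open slit W" and X: "X \<in> sections slit H W" and Y: "Y \<in> sections slit P W"
      and q: "q \<in> W" for W X Y q
    by (rule D''[OF W, THEN conjunct2, THEN conjunct2, THEN conjunct2, THEN conjunct2, THEN bspec, OF X,
          THEN conjunct1, THEN bspec, OF Y, THEN bspec, OF q])
  \<comment> \<open>Condition (a) concerns vertical \<open>X\<close> and condition (d) horizontal
    \<open>X\<close>; an arbitrary field is the sum of two such fields, both smooth.\<close>
  have closed: "D X Y p \<in> P p"
    if W: "atlas_open slit W" and X: "vector_field slit W X" and Y: "Y \<in> sections slit P W" and p: "p \<in> W" for W X Y p
  proof -
    note pt = slit.atlas_open_points[OF W p]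
    note h = horizontal_part_section[OF W X] and v = vertical_part_section[OF W X]
    have YV: "Y \<in> sections slit V W"
      using Y sections_P_V[OF W] by blast
    have "D (\<lambda>q i. proj H V X q i + (X q i - proj H V X q i)) Y p =
        (\<lambda>i. D (proj H V X) Y p i + D (\<lambda>q i. X q i - proj H V X q i) Y p i)"
      by (rule connection_add_left[OF conn W sections_vector_field[OF h] YV sections_vector_field[OF v] p])
    then have "D X Y p = (\<lambda>i. D (proj H V X) Y p i + D (\<lambda>q i. X q i - proj H V X q i) Y p i)"
      by simp
    moreover have "D (proj H V X) Y p \<in> P p"
      unfolding d[OF W h Y p]
      by (rule proj_liouville_vert_tangent[where X = "lie_bracket slit (proj H V X) Y", OF pt
            slit.lie_bracket_tangent[OF W p sections_vector_field[OF h] sections_vector_field[OF Y]]])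
    moreover have "D (\<lambda>q i. X q i - proj H V X q i) Y p \<in> P p"
      by (rule sections_mem[OF a[OF W v Y] p])
    ultimately show ?thesis
      using fibre_subspace_add[OF fibre_subspace_liouville_vert[OF pt]] by simp
  qed
  have "connection slit P D"
    by (rule connection_subdistribution[OF conn liouville_vert_sub_vertical closed])
  moreover have "D X Z p = proj P L (lie_bracket slit X Z') p"
    if W: "atlas_open slit W" and X: "X \<in> sections slit L W" and Z: "Z \<in> sections slit P W"
      and Z': "Z' \<in> sections slit V W" and eq: "\<forall>p\<in>W. proj P L Z' p = Z p" and p: "p \<in> W" for W X Z Z' p
  proof -
    note pt = slit.atlas_open_points[OF W p]
    have XV: "X \<in> sections slit V W" and ZV: "Z \<in> sections slit V W"
      using X Z sections_P_V[OF W] sections_L_V[OF W] by blast+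
    note Xf = sections_vector_field[OF X] and Zf = sections_vector_field[OF Z]
    \<comment> \<open>The difference between the lift and \<open>Z\<close>. It is a section of
      \<open>L\<close>, so its bracket with \<open>X\<close> stays in \<open>L\<close> and the
      choice of the lift has no effect modulo \<open>L\<close>.\<close>
    define l where "l = (\<lambda>q i. Z' q i - Z q i)"
    have l: "l \<in> sections slit L W"
    proof (rule sectionsI)
      show "vector_field slit W l"
        unfolding l_def by (rule slit.vector_field_diff[OF W sections_vector_field[OF Z'] Zf])
      show "l q \<in> L q" if q: "q \<in> W" for q
        using proj_liouville_vert(2)[where X = Z', OF slit.atlas_open_points[OF W q] sections_mem[OF Z' q]] eq q
        by (simp add: l_def)
    qed
    have "lie_bracket slit X (\<lambda>q i. Z q i + l q i) p = (\<lambda>i. lie_bracket slit X Z p i + lie_bracket slit X l p i)"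
      by (rule slit.lie_bracket_add_right[OF p Xf Zf sections_vector_field[OF l]])
    then have br: "lie_bracket slit X Z' p = (\<lambda>i. lie_bracket slit X Z p i + lie_bracket slit X l p i)"
      by (simp add: l_def)
    have t1: "lie_bracket slit X l p \<in> L p"
      by (rule bracket_liouville_line[OF W p X l])
    have t2: "D Z X p \<in> L p"
      by (rule sections_mem[OF a'[OF W ZV X] p])
    have DXZ: "D X Z p \<in> P p"
      by (rule sections_mem[OF a[OF W XV Z] p])
    \<comment> \<open>Condition (b) removes the part of the torsion in \<open>P\<close>; as the
      torsion is vertical here, it lies in \<open>L\<close>.\<close>
    let ?T = "torsion slit D X Z"
    note V_diff = fibre_subspace_diff[OF fibre_subspace_vertical[OF pt]]
    have "?T p \<in> V p"
      unfolding torsion_def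
      by (rule V_diff[OF V_diff bracket_vertical[OF W p XV ZV]])
        (use DXZ t2 liouville_vert_sub_vertical[OF pt] liouville_line_vertical[OF pt] in blast)+
    from proj_liouville_vert(2)[where X = ?T, OF pt this] have t3: "?T p \<in> L p"
      by (simp add: b[OF W XV ZV Z p])
    note L_diff = fibre_subspace_diff[OF fibre_subspace_liouville]
    \<comment> \<open>Since \<open>?T\<close> is D X Z - D Z X - [X, Z], this combination equals
      [X, Z + l] - D X Z.\<close>
    have "(\<lambda>i. lie_bracket slit X l p i - D Z X p i - ?T p i) \<in> L p"
      by (rule L_diff[OF L_diff[OF t1 t2] t3])
    then have "(\<lambda>i. lie_bracket slit X Z' p i - D X Z p i) \<in> L p"
      by (simp add: br torsion_def algebra_simps)
    then show ?thesis
      by (rule proj_eqI[where E = P and K = L and p = p and X = "lie_bracket slit X Z'", symmetric,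
            OF fibre_subspace_liouville_vert[OF pt] fibre_subspace_liouville
            liouville_vert_line_disjoint[OF pt] DXZ])
  qed
  ultimately show ?thesis
    unfolding basic_connection_def by blast
qed

section \<open>The Vranceanu connection on the horizontal bundle\<close>

lemma hlift_axis: "hlift i z (axis k 1) = hframe i k z"
proof -
  have "(axis k 1 $ j) *\<^sub>R hframe i j z = (if j = k then hframe i j z else 0)" for j
    by (simp add: axis_def)
  then show ?thesis
    by (simp add: hlift_def)
qed

lemma delta_horizontal:
  assumes c: "c \<in> charts_at slit q"
  shows "delta M F c k q \<in> H q"
proof -
  have pt: "q \<in> points slit"
    using c by (auto simp: points_def charts_at_iff)
  have "hframe c k z = hlift c z (fst (hframe c k z))" for z
    by (simp only: hlift_axis hframe_def[of c k z] fst_conv)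
  then show ?thesis
    unfolding horizontal_iff[OF pt c] delta_self[OF c] using delta_tangent[OF c] by blast
qed

context
  fixes D :: "('i, 'p, 'n) ttm_connection"
  assumes D: "vranceanu_connection M F D"
begin

lemma vranceanu_conn: "connection slit (tangent_space slit) D"
  using D unfolding vranceanu_connection_def by (rule conjunct1)

lemma vranceanu_frame:
  assumes q: "c \<in> charts_at slit q"
  shows "D (ddy M c j) (delta M F c i) q = (\<lambda>a. 0)"
    and "D (delta M F c j) (delta M F c i) q \<in> H q"
proof -
  have c: "c \<in> chart_ind M" "q \<in> chart_dom slit c"
    using q by (simp_all add: charts_at_iff slit_chart_ind)
  note frame = D[unfolded vranceanu_connection_def Let_def, THEN conjunct2, THEN bspec, OF c(1),
      THEN bspec, OF c(2), THEN spec, of i, THEN spec, of j]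
  show "D (ddy M c j) (delta M F c i) q = (\<lambda>a. 0)"
    by (rule frame[THEN conjunct2, THEN conjunct2, THEN conjunct1])
  have pt: "q \<in> points slit"
    using q by (auto simp: points_def charts_at_iff)
  show "D (delta M F c j) (delta M F c i) q \<in> H q"
    unfolding frame[THEN conjunct2, THEN conjunct2, THEN conjunct2]
    by (intro fibre_subspace_linear_combination[OF fibre_subspace_horizontal[OF pt]] delta_horizontal[OF q])
qed

text \<open>\<open>X\<close> is expanded in the frame of \<open>delta\<close> and \<open>ddy\<close>
  with smooth coefficients. The \<open>ddy\<close> terms contribute zero, and the coefficients of
  the \<open>delta\<close> terms are the base components of \<open>X\<close>, which vanish for
  vertical \<open>X\<close>.\<close>

lemma vranceanu_delta:
  assumes W: "atlas_open slit W" "W \<subseteq> chart_dom slit c" and c: "c \<in> chart_ind M" and p: "p \<in> W"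
    and X: "vector_field slit W X"
  shows "D X (delta M F c i) p \<in> H p"
    and "X \<in> sections slit V W \<Longrightarrow> D X (delta M F c i) p = (\<lambda>_. 0)"
proof -
  have at: "c \<in> charts_at slit q" if "q \<in> W" for q
    using that W(2) c by (auto simp: charts_at_iff slit_chart_ind)
  note pt = slit.atlas_open_points[OF W(1) p]
  note h = horizontal_part_section[OF W(1) X] and v = vertical_part_section[OF W(1) X]
  let ?v = "\<lambda>q i. X q i - proj H V X q i"
  define a where "a = (\<lambda>j q. fst (proj H V X q c) $ j)"
  define b where "b = (\<lambda>j q. snd (?v q c) $ j)"
  have a: "smooth_fun slit W (a j)" for j
    unfolding a_def by (rule smooth_fun_component[OF W c sections_vector_field[OF h]
          bounded_linear_compose[OF bounded_linear_vec_nth bounded_linear_fst]])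
  have b: "smooth_fun slit W (b j)" for j
    unfolding b_def by (rule smooth_fun_component[OF W c sections_vector_field[OF v]
          bounded_linear_compose[OF bounded_linear_vec_nth bounded_linear_snd]])
  note \<delta> = delta_field[OF W c] and \<partial> = ddy_field[OF W c]
  let ?A = "\<lambda>q i. \<Sum>j\<in>UNIV. a j q *\<^sub>R delta M F c j q i"
  let ?B = "\<lambda>q i. \<Sum>j\<in>UNIV. b j q *\<^sub>R ddy M c j q i"
  have A: "proj H V X q = ?A q" if q: "q \<in> W" for q
    unfolding a_def by (rule horizontal_expand[OF sections_mem[OF h q] at[OF q]])
  have B: "?v q = ?B q" if q: "q \<in> W" for q
    unfolding b_def
    by (rule vertical_expand[OF vertical_tangent[OF sections_mem[OF v q]] at[OF q]])
      (use sections_mem[OF v q] in \<open>simp add: vertical_iff[OF at[OF q]]\<close>)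
  have vA: "vector_field slit W ?A"
    by (rule slit.vector_field_sum[OF W(1)]) (rule slit.vector_field_scale[OF W(1) a \<delta>])
  have vB: "vector_field slit W ?B"
    by (rule slit.vector_field_sum[OF W(1)]) (rule slit.vector_field_scale[OF W(1) b \<partial>])
  have \<delta>': "delta M F c i \<in> sections slit (tangent_space slit) W"
    using \<delta> by (simp add: sections_tangent_space)
  have X_eq: "X q = (\<lambda>i. ?A q i + ?B q i)" if q: "q \<in> W" for q
    using fun_cong[OF A[OF q]] fun_cong[OF B[OF q]] by (simp add: fun_eq_iff flip: fun_cong[OF A[OF q]] fun_cong[OF B[OF q]])
  have "D X (delta M F c i) p = D (\<lambda>q i. ?A q i + ?B q i) (delta M F c i) p"
    by (rule connection_cong[OF vranceanu_conn W(1) slit.vector_field_add[OF W(1) vA vB] \<delta>' X \<delta>' X_eq refl p])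
  also have "\<dots> = (\<lambda>i'. D ?A (delta M F c i) p i' + D ?B (delta M F c i) p i')"
    by (rule connection_add_left[OF vranceanu_conn W(1) vA \<delta>' vB p])
  also have "D ?B (delta M F c i) p = (\<lambda>i'. \<Sum>j\<in>UNIV. b j p *\<^sub>R D (ddy M c j) (delta M F c i) p i')"
    by (rule slit.connection_sum_left[OF vranceanu_conn W(1) p finite b \<partial> \<delta>])
  also have "\<dots> = (\<lambda>_. 0)"
    by (simp add: vranceanu_frame(1)[OF at[OF p]])
  also have "D ?A (delta M F c i) p = (\<lambda>i'. \<Sum>j\<in>UNIV. a j p *\<^sub>R D (delta M F c j) (delta M F c i) p i')"
    by (rule slit.connection_sum_left[OF vranceanu_conn W(1) p finite a \<delta> \<delta>])
  finally have eq: "D X (delta M F c i) p = (\<lambda>i'. \<Sum>j\<in>UNIV. a j p *\<^sub>R D (delta M F c j) (delta M F c i) p i')"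
    by simp
  show "D X (delta M F c i) p \<in> H p"
    unfolding eq by (rule fibre_subspace_linear_combination[OF fibre_subspace_horizontal[OF pt]])
      (rule vranceanu_frame(2)[OF at[OF p]])
  assume XV: "X \<in> sections slit V W"
  have "fst (X p c) = 0"
    using sections_mem[OF XV p] vertical_iff[OF at[OF p]] by blast
  then have "a j p = 0" for j
    unfolding a_def horizontal_part(3)[where X = X, OF pt vector_field_tangent[OF X p] at[OF p]]
    by (simp add: fst_hlift)
  then show "D X (delta M F c i) p = (\<lambda>_. 0)"
    unfolding eq by simp
qed

text \<open>The Leibniz rule for the expansion of \<open>Z\<close> in the frame
  \<open>delta\<close>. The second formula is shaped for comparison with
  \<open>fst_bracket_vertical\<close> and \<open>bracket_liouville_horizontal\<close>, where the
  same derivative of base components occurs.\<close>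

lemma vranceanu_horizontal:
  assumes W: "atlas_open slit W" and p: "p \<in> W" and X: "vector_field slit W X"
    and Z: "Z \<in> sections slit H W"
  shows "D X Z p \<in> H p"
    and "X \<in> sections slit V W \<Longrightarrow> c \<in> charts_at slit p \<Longrightarrow>
      D X Z p c = hlift c (chart_map slit c p)
        (fst (frechet_derivative (\<lambda>u. Z (chart_inv slit c u) c) (at (chart_map slit c p)) (X p c)))"
proof -
  note pt = slit.atlas_open_points[OF W p]
  have main: "D X Z p \<in> H p \<and> (X \<in> sections slit V W \<longrightarrow> D X Z p c = hlift c (chart_map slit c p)
        (fst (frechet_derivative (\<lambda>u. Z (chart_inv slit c u) c) (at (chart_map slit c p)) (X p c))))"
    if at_p: "c \<in> charts_at slit p" for c
  proof -
    have c: "c \<in> chart_ind M" "c \<in> chart_ind slit"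
      using at_p by (simp_all add: charts_at_iff slit_chart_ind)
    \<comment> \<open>The frame of chart \<open>c\<close> is a smooth field only on the chart
      domain. As \<open>D\<close> is one operator for all open sets, passing to \<open>W'\<close>
      does not change \<open>D X Z p\<close>.\<close>
    define W' where "W' = W \<inter> chart_dom slit c"
    have W': "atlas_open slit W'" "W' \<subseteq> chart_dom slit c" "W' \<subseteq> W"
      unfolding W'_def by (auto intro: slit.atlas_open_Int[OF W] slit.atlas_open_chart_dom[OF c(2)])
    have p': "p \<in> W'"
      using p at_p by (simp add: W'_def charts_at_iff)
    have at: "c \<in> charts_at slit q" if "q \<in> W'" for q
      using that c by (auto simp: charts_at_iff W'_def)
    have X': "vector_field slit W' X"
      by (rule slit.vector_field_subset[OF X W'(3)])
    have Zs: "Z \<in> sections slit H W'"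
      by (rule slit.sections_subset[OF Z W'(3)])
    note Z' = sections_vector_field[OF Zs]
    define \<zeta> where "\<zeta> = (\<lambda>k q. fst (Z q c) $ k)"
    have \<zeta>: "smooth_fun slit W' (\<zeta> k)" for k
      unfolding \<zeta>_def by (rule smooth_fun_component[OF W'(1,2) c(1) Z'
            bounded_linear_compose[OF bounded_linear_vec_nth bounded_linear_fst]])
    note \<delta> = delta_field[OF W'(1,2) c(1)]
    let ?Z = "\<lambda>q i. \<Sum>k\<in>UNIV. \<zeta> k q *\<^sub>R delta M F c k q i"
    have Zeq: "Z q = ?Z q" if q: "q \<in> W'" for q
      unfolding \<zeta>_def by (rule horizontal_expand[OF sections_mem[OF Zs q] at[OF q]])
    have vZ: "?Z \<in> sections slit (tangent_space slit) W'"
      unfolding sections_tangent_space mem_Collect_eq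
      by (rule slit.vector_field_sum[OF W'(1)]) (rule slit.vector_field_scale[OF W'(1) \<zeta> \<delta>])
    have Zt: "Z \<in> sections slit (tangent_space slit) W'"
      unfolding sections_tangent_space mem_Collect_eq by (rule Z')
    have "D X Z p = D X ?Z p"
      by (rule connection_cong[OF vranceanu_conn W'(1) X' vZ X' Zt refl Zeq p'])
    also have "\<dots> = (\<lambda>i. \<Sum>k\<in>UNIV. deriv_along slit X (\<zeta> k) p *\<^sub>R delta M F c k p i +
        \<zeta> k p *\<^sub>R D X (delta M F c k) p i)"
      by (rule slit.connection_sum_right[OF vranceanu_conn W'(1) p' finite \<zeta> \<delta> X'])
    finally have eq: "D X Z p = (\<lambda>i. \<Sum>k\<in>UNIV. deriv_along slit X (\<zeta> k) p *\<^sub>R delta M F c k p i +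
        \<zeta> k p *\<^sub>R D X (delta M F c k) p i)" .
    note sub = fibre_subspace_horizontal[OF pt]
    have "D X Z p \<in> H p"
      unfolding eq
      by (intro fibre_subspace_sum[OF sub] fibre_subspace_add[OF sub] fibre_subspace_scale[OF sub]
          delta_horizontal[OF at_p]          vranceanu_delta(1)[OF W'(1,2) c(1) p' X'])
    moreover have "D X Z p c = hlift c (chart_map slit c p)
        (fst (frechet_derivative (\<lambda>u. Z (chart_inv slit c u) c) (at (chart_map slit c p)) (X p c)))"
      if XV: "X \<in> sections slit V W"
    proof -
      have XV': "X \<in> sections slit V W'"
        by (rule slit.sections_subset[OF XV W'(3)])
      have d: "deriv_along slit X (\<zeta> k) p =
          fst (frechet_derivative (\<lambda>u. Z (chart_inv slit c u) c) (at (chart_map slit c p)) (X p c)) $ k" for k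
        unfolding slit.deriv_along_chart[where X = X and p = p, OF W'(1) p' \<zeta> vector_field_tangent[OF X p] at_p]
        unfolding o_def \<zeta>_def
        by (rule frechet_derivative_linear_comp[OF
              bounded_linear_compose[OF bounded_linear_vec_nth bounded_linear_fst]
              slit.vector_field_has_derivative[OF Z' p' at_p]])
      show ?thesis
        unfolding eq d vranceanu_delta(2)[OF W'(1,2) c(1) p' X' XV']
        by (simp add: delta_self[OF at_p] hlift_def)
    qed
    ultimately show ?thesis
      by blast
  qed
  show "D X Z p \<in> H p"
    using slit_points_charts_at[OF pt] main by blast
  show "X \<in> sections slit V W \<Longrightarrow> c \<in> charts_at slit p \<Longrightarrow>
      D X Z p c = hlift c (chart_map slit c p)
        (fst (frechet_derivative (\<lambda>u. Z (chart_inv slit c u) c) (at (chart_map slit c p)) (X p c)))"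
    using main by blast
qed

lemma vranceanu_basic: "basic_connection slit (tangent_space slit) H V D"
proof -
  have "connection slit H D"
    by (rule connection_subdistribution[OF vranceanu_conn _ vranceanu_horizontal(1)])
      (blast intro: horizontal_tangent)
  moreover have "D X Z p = proj H V (lie_bracket slit X Z') p"
    if W: "atlas_open slit W" and X: "X \<in> sections slit V W" and Z: "Z \<in> sections slit H W"
      and Z': "Z' \<in> sections slit (tangent_space slit) W" and eq: "\<forall>p\<in>W. proj H V Z' p = Z p"
      and p: "p \<in> W" for W X Z Z' p
  proof -
    note pt = slit.atlas_open_points[OF W p]
    note Xf = sections_vector_field[OF X] and Zf = sections_vector_field[OF Z] and Zf' = sections_vector_field[OF Z']
    obtain c where c: "c \<in> charts_at slit p"
      using slit_points_charts_at[OF pt] by blast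
    have ind: "c \<in> chart_ind slit"
      using c by (simp add: charts_at_iff)
    let ?z = "chart_map slit c p"
    note DH = vranceanu_horizontal(1)[OF W p Xf Z]
    have br: "lie_bracket slit X Z' p \<in> tangent_space slit p"
      by (rule slit.lie_bracket_tangent[OF W p Xf Zf'])
    \<comment> \<open>Projection along the vertical bundle preserves base components; those of
      \<open>Z\<close> and of its lift agree on \<open>W\<close> and have equal derivatives.\<close>
    have "((\<lambda>u. fst (Z (chart_inv slit c u) c)) has_derivative
        (\<lambda>w. fst (frechet_derivative (\<lambda>u. Z' (chart_inv slit c u) c) (at ?z) w))) (at ?z)"
    proof (rule has_derivative_transform_within_open[OF
          has_derivative_fst[OF slit.vector_field_has_derivative[OF Zf' p c]]])
      show "open (chart_map slit c ` (W \<inter> chart_dom slit c))"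
        by (rule slit.atlas_open_chart_image[OF W ind])
      show "?z \<in> chart_map slit c ` (W \<inter> chart_dom slit c)"
        using p c by (auto simp: charts_at_iff)
      fix u assume "u \<in> chart_map slit c ` (W \<inter> chart_dom slit c)"
      then obtain q where q: "u = chart_map slit c q" "q \<in> W" "c \<in> charts_at slit q"
        using ind by (auto simp: charts_at_iff)
      have "fst (proj H V Z' q c) = fst (Z' q c)"
        unfolding horizontal_part(3)[where X = Z', OF slit.atlas_open_points[OF W q(2)]
            vector_field_tangent[OF Zf' q(2)] q(3)] by (rule fst_hlift)
      then show "fst (Z' (chart_inv slit c u) c) = fst (Z (chart_inv slit c u) c)"
        unfolding q(1) slit.chart_inv_chart_map[OF q(3)] using eq q(2) by simp
    qed
    from has_derivative_unique[OF has_derivative_fst[OF slit.vector_field_has_derivative[OF Zf p c]] this]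
    have "fst (frechet_derivative (\<lambda>u. Z (chart_inv slit c u) c) (at ?z) (X p c)) =
        fst (frechet_derivative (\<lambda>u. Z' (chart_inv slit c u) c) (at ?z) (X p c))"
      by (rule fun_cong)
    \<comment> \<open>Equality of base parts in one chart is what makes the difference of the two
      sides vertical.\<close>
    then have "fst (D X Z p c) = fst (lie_bracket slit X Z' p c)"
      unfolding vranceanu_horizontal(2)[OF W p Xf Z X c] fst_hlift fst_bracket_vertical[OF W p X c] .
    then have "(\<lambda>i. lie_bracket slit X Z' p i - D X Z p i) \<in> V p"
      unfolding vertical_iff[OF c]
      using fibre_subspace_diff[OF slit.fibre_subspace_tangent br horizontal_tangent[OF DH]] by simp
    then show ?thesis
      by (rule proj_eqI[where E = H and K = V and p = p and X = "lie_bracket slit X Z'", symmetric,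
            OF fibre_subspace_horizontal[OF pt] fibre_subspace_vertical[OF pt]
            horizontal_vertical_disjoint[OF pt] DH])
  qed
  ultimately show ?thesis
    unfolding basic_connection_def by blast
qed

text \<open>For X = a \<Gamma> the bracket and the covariant derivative contain the same horizontal
  lift; what remains is -Z(a) times \<Gamma>, from differentiating the coefficient
  \<open>a\<close>.\<close>

lemma vranceanu_liouville_bracket:
  assumes W: "atlas_open slit W" and p: "p \<in> W" and X: "X \<in> sections slit L W"
    and Z: "Z \<in> sections slit H W"
  shows "(\<lambda>i. lie_bracket slit X Z p i - D X Z p i) \<in> L p"
proof -
  note pt = slit.atlas_open_points[OF W p]
  have XV: "X \<in> sections slit V W"
    using X sections_L_V[OF W] by blast
  note Xf = sections_vector_field[OF X] and Zf = sections_vector_field[OF Z]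
  obtain a where a: "smooth_fun slit W a" "\<And>q. q \<in> W \<Longrightarrow> X q = (\<lambda>i. a q *\<^sub>R liouville q i)"
    by (rule liouville_section_multiple[OF W X]) (rule that)
  obtain c where c: "c \<in> charts_at slit p"
    using slit_points_charts_at[OF pt] by blast
  let ?t = "- frechet_derivative (a \<circ> chart_inv slit c) (at (chart_map slit c p)) (Z p c)"
  have "(\<lambda>i. lie_bracket slit X Z p i - D X Z p i) = (\<lambda>i. ?t *\<^sub>R liouville p i)"
  proof (rule slit.tangent_eqI[OF _ _ c])
    show "(\<lambda>i. lie_bracket slit X Z p i - D X Z p i) \<in> tangent_space slit p"
      by (rule fibre_subspace_diff[OF slit.fibre_subspace_tangent slit.lie_bracket_tangent[OF W p Xf Zf]
            horizontal_tangent[OF vranceanu_horizontal(1)[OF W p Xf Z]]])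
    show "(\<lambda>i. ?t *\<^sub>R liouville p i) \<in> tangent_space slit p"
      by (rule fibre_subspace_scale[OF slit.fibre_subspace_tangent liouville_tangent[OF pt]])
    have "lie_bracket slit X Z p c = D X Z p c + ?t *\<^sub>R liouville p c"
      unfolding vranceanu_horizontal(2)[OF W p Xf Z XV c] scaleR_minus_left
        add_uminus_conv_diff
      by (rule bracket_liouville_horizontal[where X = X and a = a, OF W p a Z c])
    then show "lie_bracket slit X Z p c - D X Z p c = ?t *\<^sub>R liouville p c"
      by simp
  qed
  then show ?thesis
    unfolding liouville_line_def by blast
qed

end

section \<open>The sum connection on the orthogonal complement of the Liouville field\<close>

lemma perp_parts:
  assumes q: "q \<in> points slit" and Z: "Z q \<in> LP q"
  shows "proj H P Z q = proj H V Z q" and "proj P H Z q = (\<lambda>i. Z q i - proj H V Z q i)"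
    and "(\<lambda>i. Z q i - proj H V Z q i) \<in> P q"
proof -
  have Zt: "Z q \<in> tangent_space slit q"
    using Z unfolding liouville_perp_def by blast
  note h = horizontal_part(1,2)[where X = Z, OF q Zt]
  \<comment> \<open>Horizontal vectors are orthogonal to \<Gamma>, so removing the horizontal part
    preserves orthogonality to \<Gamma>. On \<open>LP\<close> the splitting into \<open>H\<close>
    and \<open>P\<close> is therefore that into \<open>H\<close> and \<open>V\<close>, whose parts
    are known to be smooth.\<close>
  show P: "(\<lambda>i. Z q i - proj H V Z q i) \<in> P q"
    by (rule perp_vertical_liouville_vert[OF q fibre_subspace_diff[OF fibre_subspace_liouville_perp[OF q] Z
            subsetD[OF horizontal_sub_perp[OF q] h(1)]] h(2)])
  have disj: "H q \<inter> P q \<subseteq> {\<lambda>_. 0}"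
    using horizontal_vertical_disjoint[OF q] liouville_vert_sub_vertical[OF q] by blast
  note eq = proj_sum_eq[where E = H and K = P and p = q and X = Z, OF fibre_subspace_horizontal[OF q]
      fibre_subspace_liouville_vert[OF q] disj h(1) P]
  show "proj H P Z q = proj H V Z q" "proj P H Z q = (\<lambda>i. Z q i - proj H V Z q i)"
    by (rule eq, simp)+
qed

lemma perp_part_sections:
  assumes W: "atlas_open slit W" and Z: "Z \<in> sections slit LP W"
  shows "proj H P Z \<in> sections slit H W" and "proj P H Z \<in> sections slit P W"
proof -
  note Zf = sections_vector_field[OF Z]
  have parts: "proj H P Z q = proj H V Z q" "proj P H Z q = (\<lambda>i. Z q i - proj H V Z q i)"
    "(\<lambda>i. Z q i - proj H V Z q i) \<in> P q" if q: "q \<in> W" for q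
    by (rule perp_parts[where Z = Z, OF slit.atlas_open_points[OF W q] sections_mem[OF Z q]])+
  show "proj H P Z \<in> sections slit H W"
  proof (rule sectionsI)
    \<comment> \<open>The two horizontal projections are only known to agree on \<open>W\<close>,
      where \<open>Z\<close> takes values in \<open>LP\<close>; hence the passage through
      \<open>vector_field_cong\<close>.\<close>
    show "vector_field slit W (proj H P Z)"
      by (rule slit.vector_field_cong[OF W horizontal_part_field[OF W Zf] parts(1)[symmetric]])
    show "proj H P Z p \<in> H p" if p: "p \<in> W" for p
      unfolding parts(1)[OF p]
      by (rule sections_mem[OF horizontal_part_section[OF W Zf] p])
  qed
  show "proj P H Z \<in> sections slit P W"
  proof (rule sectionsI)
    show "vector_field slit W (proj P H Z)"
      by (rule slit.vector_field_cong[OF W sections_vector_field[OF vertical_part_section[OF W Zf]] parts(2)[symmetric]])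
    show "proj P H Z p \<in> P p" if p: "p \<in> W" for p
      unfolding parts(2)[OF p] by (rule parts(3)[OF p])
  qed
qed

lemma liouville_perp_dist_sum:
  assumes q: "q \<in> points slit"
  shows "LP q = dist_sum H P q"
proof (intro equalityI subsetI)
  fix w assume w: "w \<in> LP q"
  then have wt: "w \<in> tangent_space slit q"
    unfolding liouville_perp_def by blast
  note h = horizontal_part(1)[where X = "\<lambda>_. w", OF q wt] and P = perp_parts(3)[where Z = "\<lambda>_. w", OF q w]
  show "w \<in> dist_sum H P q"
    using dist_sumI[where E = H and K = P and p = q and a = "proj H V (\<lambda>_. w) q"
        and b = "\<lambda>i. w i - proj H V (\<lambda>_. w) q i", OF h P] by simp
next
  fix w assume "w \<in> dist_sum H P q"
  then obtain a b where ab: "w = (\<lambda>i. a i + b i)" "a \<in> H q" "b \<in> P q"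
    unfolding dist_sum_def by blast
  show "w \<in> LP q"
    unfolding ab(1)
    by (rule fibre_subspace_add[OF fibre_subspace_liouville_perp[OF q]
          subsetD[OF horizontal_sub_perp[OF q] ab(2)] subsetD[OF liouville_vert_sub_perp[OF q] ab(3)]])
qed

text \<open>The lift is the sum of its part in \<open>H\<close>, its part in \<open>P\<close> and a
  multiple of \<Gamma>. The bracket of \<open>X\<close> with each of them differs from the
  corresponding term of the connection, zero for the last, by an element of
  \<open>L\<close>.\<close>

lemma sum_basic:
  assumes Ds: "vranceanu_connection M F Ds" and Dv: "vaisman_connection M F G Dv"
  shows "basic_connection slit (tangent_space slit) LP L (sum_connection H P Ds Dv)"
proof -
  note bs = vranceanu_basic[OF Ds] and bv = vaisman_basic[OF Dv]
  have cs: "connection slit H Ds" and cv: "connection slit P Dv"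
    using bs bv unfolding basic_connection_def by blast+
  have disj: "H q \<inter> P q \<subseteq> {\<lambda>_. 0}" if "q \<in> points slit" for q
    using horizontal_vertical_disjoint[OF that] liouville_vert_sub_vertical[OF that] by blast
  have conn: "connection slit LP (sum_connection H P Ds Dv)"
    by (rule slit.connection_sum_connection[OF cs cv fibre_subspace_horizontal fibre_subspace_liouville_vert
          disj liouville_perp_dist_sum perp_part_sections])
  moreover have "sum_connection H P Ds Dv X Z p = proj LP L (lie_bracket slit X Z') p"
    if W: "atlas_open slit W" and X: "X \<in> sections slit L W" and Z: "Z \<in> sections slit LP W"
      and Z': "Z' \<in> sections slit (tangent_space slit) W" and eq: "\<forall>p\<in>W. proj LP L Z' p = Z p"
      and p: "p \<in> W" for W X Z Z' p
  proof -
    note pt = slit.atlas_open_points[OF W]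
    note Xf = sections_vector_field[OF X] and Zf = sections_vector_field[OF Z] and Zf' = sections_vector_field[OF Z']
    let ?h = "proj H P Z" and ?v = "proj P H Z"
    note h = perp_part_sections(1)[OF W Z] and v = perp_part_sections(2)[OF W Z]
    note hf = sections_vector_field[OF h] and vf = sections_vector_field[OF v]
    define l where "l = (\<lambda>q i. Z' q i - Z q i)"
    have l: "l \<in> sections slit L W"
    proof (rule sectionsI)
      show "vector_field slit W l"
        unfolding l_def by (rule slit.vector_field_diff[OF W Zf' Zf])
      show "l q \<in> L q" if q: "q \<in> W" for q
        using proj_liouville_perp(2)[where X = Z', OF pt[OF q] vector_field_tangent[OF Zf' q]] eq q
        by (simp add: l_def)
    qed
    note lf = sections_vector_field[OF l]
    have Z'_eq: "Z' q = (\<lambda>i. (?h q i + ?v q i) + l q i)" if q: "q \<in> W" for q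
      unfolding perp_parts(1,2)[where Z = Z, OF pt[OF q] sections_mem[OF Z q]] l_def by simp
    note hvf = slit.vector_field_add[OF W hf vf]
    have "lie_bracket slit X Z' p = lie_bracket slit X (\<lambda>q i. (?h q i + ?v q i) + l q i) p"
      by (rule slit.lie_bracket_cong_right[OF W p Zf' Z'_eq])
    also have "\<dots> = (\<lambda>i. lie_bracket slit X (\<lambda>q i. ?h q i + ?v q i) p i + lie_bracket slit X l p i)"
      by (rule slit.lie_bracket_add_right[OF p Xf hvf lf])
    finally have br: "lie_bracket slit X Z' p =
        (\<lambda>i. lie_bracket slit X ?h p i + lie_bracket slit X ?v p i + lie_bracket slit X l p i)"
      unfolding slit.lie_bracket_add_right[OF p Xf hf vf] .
    have t1: "(\<lambda>i. lie_bracket slit X ?h p i - Ds X ?h p i) \<in> L p"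
      by (rule vranceanu_liouville_bracket[OF Ds W p X h])
    have XV: "X \<in> sections slit V W" and vV: "?v \<in> sections slit V W"
      using X v sections_L_V[OF W] sections_P_V[OF W] by blast+
    \<comment> \<open>\<open>?v\<close> is a lift of itself, so the basic property of the Vaisman
      connection applies with both arguments equal to \<open>?v\<close>.\<close>
    have "\<forall>q\<in>W. proj P L ?v q = ?v q"
    proof
      fix q assume q: "q \<in> W"
      show "proj P L ?v q = ?v q"
        by (rule proj_eqI[where E = P and K = L and p = q and X = ?v,
              OF fibre_subspace_liouville_vert[OF pt[OF q]] fibre_subspace_liouville
              liouville_vert_line_disjoint[OF pt[OF q]] sections_mem[OF v q]])
          (simp add: fibre_subspace_0[OF fibre_subspace_liouville])
    qed
    then have Dv: "Dv X ?v p = proj P L (lie_bracket slit X ?v) p"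
      using bv W X v vV p unfolding basic_connection_def by blast
    have t2: "(\<lambda>i. lie_bracket slit X ?v p i - Dv X ?v p i) \<in> L p"
      unfolding Dv
      by (rule proj_liouville_vert(2)[where X = "lie_bracket slit X ?v", OF pt[OF p] bracket_vertical[OF W p XV vV]])
    have t3: "lie_bracket slit X l p \<in> L p"
      by (rule bracket_liouville_line[OF W p X l])
    note L_add = fibre_subspace_add[OF fibre_subspace_liouville]
    have "(\<lambda>i. (lie_bracket slit X ?h p i - Ds X ?h p i) + (lie_bracket slit X ?v p i - Dv X ?v p i) +
        lie_bracket slit X l p i) \<in> L p"
      by (rule L_add[OF L_add[OF t1 t2] t3])
    then have "(\<lambda>i. lie_bracket slit X Z' p i - sum_connection H P Ds Dv X Z p i) \<in> L p"
      by (simp add: br sum_connection_def algebra_simps)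
    then show ?thesis
      by (rule proj_eqI[where E = LP and K = L and p = p and X = "lie_bracket slit X Z'", symmetric,
            OF fibre_subspace_liouville_perp[OF pt[OF p]] fibre_subspace_liouville
            liouville_perp_line_disjoint[OF pt[OF p]]
            sections_mem[OF connection_sections[OF conn W Xf Z] p]])
  qed
  ultimately show ?thesis
    unfolding basic_connection_def by blast
qed

end

theorem proposition3p6:
  fixes M :: "('i, 'p, real^'n::finite) atlas"
    and F :: "('i, 'p, 'n) tm_point \<Rightarrow> real"
    and G :: "('i, 'p, 'n) ttm_metric"
    and nabla_v nabla_star :: "('i, 'p, 'n) ttm_connection"
  assumes "finsler_manifold M F"
    and "sasaki_lift M F G"
    and "vaisman_connection M F G nabla_v"
    and "vranceanu_connection M F nabla_star"
  shows "adapted_basic_triple M F G nabla_v nabla_star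
           (sum_connection (horizontal M F) (liouville_vert M G) nabla_star nabla_v)"
proof -
  interpret finsler_sasaki M F G
    by unfold_locales (rule assms)+
  show ?thesis
    unfolding adapted_basic_triple_def Let_def
    by (intro conjI vaisman_basic vranceanu_basic sum_basic assms)
qed

end
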